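(* Let $k\ge 2$ be an integer and let $T$ be a tree of order $n$ with $n \ge (2k+1)^{30+33(k-1)r_{0.00006}}$. If $S_k(T) \in [2k,\,2k + \eta - 2)$, then $T$ is isomorphic to a member of the family $$\mathcal{T}= \left\{ P_{1,1,1,n-3}^{1,a,n-5},\ P_{1,1,n-2}^{1,b},\ P_{1,1,n-2}^{2,n-6},\ P_{1,1,n-2}^{2,n-5},\ P_{1,2,n-3}^{1,n-6},\ T_{2,2,n-5},\ T_{1,c,n-c-2} \right\}$$ for some integers $a\in [4,\,n-8]$, $b\in [4,\,n-5]$ and $c\in [2,\,n-4]$.
   Context: All graphs are finite, simple and undirected. For a graph $G$ of order $n$ (number of vertices), $\lambda_1(G)\ge\cdots\ge\lambda_n(G)$ are the eigenvalues of its adjacency matrix, and for $1\le k\le n$, $S_k(G)=\sum_{i=1}^k\lambda_i(G)$. $\eta=\sqrt{2+\sqrt5}$. For an integer $k\ge 2$ and a real $0<\varepsilon\le 1$, define $r_\varepsilon=\left\lceil\frac{\pi}{\arccos(1-\varepsilon/(k-1))}\right\rceil-1$ (it depends on $k$); $r_{0.00006}$ is this quantity with $\varepsilon=0.00006$. $P_n$ is the path of order $n$. For positive integers $a,b,c$, $T_{a,b,c}$ is the tree obtained by identifying one endpoint from each of $P_{a+1},P_{b+1},P_{c+1}$ (so it has $a+b+c+1$ vertices). For integers $1\le m_1<\cdots<m_t\le p-2$ and positive integers $n_1,\ldots,n_t$, $P_{n_1,\ldots,n_t,p}^{m_1,\ldots,m_t}$ is the tree obtained from the path $0\sim1\sim\cdots\sim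 p-1$ on $p$ vertices by attaching a path of $n_i$ new vertices at the vertex $m_i$ (i.e. joining an endpoint of that path to $m_i$ by an edge), for each $i=1,\ldots,t$; its order is $p+\sum_i n_i$. *)

theory Defs
  imports
    "HOL-Library.Multiset"
    "Graph_Theory.Graph_Theory"
    "Jordan_Normal_Form.Char_Poly"
begin

text \<open>
  A finite simple undirected graph is a \<open>pair_graph\<close>: finitely many vertices and an
  irreflexive, symmetric set of arcs, where an undirected edge is a pair of opposite arcs.
\<close>

section \<open>Trees\<close>

text \<open>
  Here \<open>Digraph_Component.tree\<close> cannot be used: in a symmetric digraph, every
  edge traversed back and forth is a \<open>pre_digraph.cycle\<close> of length 2. The cycles of the
  undirected graph are exactly those of length at least 3.
\<close>

definition tree_graph :: "'a pair_pre_digraph \<Rightarrow> bool" where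
  "tree_graph G \<longleftrightarrow>
     pair_graph G \<and> connected (with_proj G) \<and>
     \<not> (\<exists>p. pre_digraph.cycle (with_proj G) p \<and> length p \<ge> 3)"

section \<open>Adjacency eigenvalues\<close>

definition adj_mat :: "'a pair_pre_digraph \<Rightarrow> 'a list \<Rightarrow> real mat" where
  "adj_mat G xs =
     mat (length xs) (length xs) (\<lambda>(i, j). if (xs ! i, xs ! j) \<in> parcs G then 1 else 0)"

definition vertex_enum :: "'a pair_pre_digraph \<Rightarrow> 'a list" where
  "vertex_enum G = (SOME xs. distinct xs \<and> set xs = pverts G)"

text \<open>
  The eigenvalues with multiplicity, i.e. the roots of the characteristic polynomial, in
  decreasing order. The choice of the enumeration of the vertices is immaterial, see
  \<open>adj_eigenvalues_eq\<close> below.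
\<close>

definition adj_eigenvalues :: "'a pair_pre_digraph \<Rightarrow> real list" where
  "adj_eigenvalues G =
     rev (sorted_list_of_multiset (proots (char_poly (adj_mat G (vertex_enum G)))))"

text \<open>The list is indexed from 0, so \<open>\<lambda>\<^sub>i\<close> is its entry number \<open>i - 1\<close>.\<close>

definition adj_eigenvalue :: "'a pair_pre_digraph \<Rightarrow> nat \<Rightarrow> real" where
  "adj_eigenvalue G i = adj_eigenvalues G ! (i - 1)"

definition eigenvalue_sum :: "nat \<Rightarrow> 'a pair_pre_digraph \<Rightarrow> real" where
  "eigenvalue_sum k G = (\<Sum>i = 1..k. adj_eigenvalue G i)"

lemma adj_mat_similar:
  assumes xs: "distinct xs" and ys: "distinct ys" and eq: "set xs = set ys"
  shows "similar_mat (adj_mat G xs) (adj_mat G ys)"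
proof -
  define n where "n = length ys"
  have lx: "length xs = n"
    unfolding n_def using xs ys eq by (metis distinct_card)
  define P where "P = mat n n (\<lambda>(i, j). if xs ! i = ys ! j then 1 else (0::real))"
  define Q where "Q = mat n n (\<lambda>(i, j). if ys ! i = xs ! j then 1 else (0::real))"
  have ex: "\<exists>k<n. ys ! k = xs ! i" if "i < n" for i
    using that eq lx n_def by (metis in_set_conv_nth nth_mem)
  define f where "f i = (SOME k. k < n \<and> ys ! k = xs ! i)" for i
  have f: "f i < n" "ys ! f i = xs ! i" if "i < n" for i
    using someI_ex[of "\<lambda>k. k < n \<and> ys ! k = xs ! i"] ex[OF that] unfolding f_def by auto
  have fi: "xs ! i = ys ! k \<longleftrightarrow> k = f i" if "i < n" "k < n" for i k
    using f[OF that(1)] that ys n_def by (metis nth_eq_iff_index_eq)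
  have fi': "ys ! k = xs ! i \<longleftrightarrow> k = f i" if "i < n" "k < n" for i k
    using fi[OF that] by metis
  have finj: "f i = f j \<longleftrightarrow> i = j" if "i < n" "j < n" for i j
    using f that xs lx by (metis nth_eq_iff_index_eq)
  define B where "B = adj_mat G ys"
  have B: "B \<in> carrier_mat n n"
    unfolding B_def adj_mat_def n_def by simp
  have PQ: "P * Q = 1\<^sub>m n"
  proof (rule eq_matI)
    fix i j assume "i < dim_row (1\<^sub>m n :: real mat)" "j < dim_col (1\<^sub>m n :: real mat)"
    hence ij: "i < n" "j < n" by auto
    have "(P * Q) $$ (i, j) = (\<Sum>k = 0..<n. (if k = f i then 1 else 0) * (if k = f j then 1 else 0))"
      using ij unfolding P_def Q_def
      by (auto simp: scalar_prod_def fi fi' intro!: sum.cong)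
    also have "\<dots> = (\<Sum>k = 0..<n. if k = f i then (if f i = f j then 1 else 0) else 0)"
      by (intro sum.cong) auto
    also have "\<dots> = (1\<^sub>m n :: real mat) $$ (i, j)"
      using ij f by (simp add: finj)
    finally show "(P * Q) $$ (i, j) = (1\<^sub>m n :: real mat) $$ (i, j)" .
  qed (auto simp: P_def Q_def)
  have Pc: "P \<in> carrier_mat n n" and Qc: "Q \<in> carrier_mat n n"
    by (auto simp: P_def Q_def)
  have QP: "Q * P = 1\<^sub>m n"
    using mat_mult_left_right_inverse[OF Pc Qc PQ] .
  have A: "adj_mat G xs = P * B * Q"
  proof (rule eq_matI)
    fix i j assume "i < dim_row (P * B * Q)" "j < dim_col (P * B * Q)"
    hence ij: "i < n" "j < n" by (auto simp: P_def Q_def)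
    have PB: "(P * B) $$ (i, k) = B $$ (f i, k)" if "k < n" for k
    proof -
      have "(P * B) $$ (i, k) = (\<Sum>l = 0..<n. (if l = f i then 1 else 0) * B $$ (l, k))"
        using ij that B unfolding P_def
        by (auto simp: scalar_prod_def fi intro!: sum.cong)
      also have "\<dots> = (\<Sum>l = 0..<n. if l = f i then B $$ (f i, k) else 0)"
        by (intro sum.cong) auto
      finally show ?thesis using f ij by simp
    qed
    have PBc: "C \<in> carrier_mat n n \<Longrightarrow>
        (C * Q) $$ (i, j) = (\<Sum>k = 0..<n. C $$ (i, k) * Q $$ (k, j))" for C
      using ij Qc by (auto simp: scalar_prod_def)
    have "(P * B * Q) $$ (i, j) = (\<Sum>k = 0..<n. (P * B) $$ (i, k) * Q $$ (k, j))"
      by (rule PBc) (use B Pc in auto)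
    also have "\<dots> = (\<Sum>k = 0..<n. if k = f j then B $$ (f i, f j) else 0)"
      using ij by (intro sum.cong) (auto simp: PB Q_def fi')
    also have "\<dots> = B $$ (f i, f j)" using f ij by simp
    also have "\<dots> = adj_mat G xs $$ (i, j)"
      using ij f lx unfolding B_def adj_mat_def by (simp add: n_def[symmetric])
    finally show "adj_mat G xs $$ (i, j) = (P * B * Q) $$ (i, j)" by simp
  qed (auto simp: P_def Q_def adj_mat_def lx)
  have Ac: "adj_mat G xs \<in> carrier_mat n n"
    unfolding adj_mat_def lx by simp
  show ?thesis
    by (rule similar_matI[of _ _ P Q n]) (use A Ac B Pc Qc PQ QP B_def in auto)
qed

lemma adj_eigenvalues_eq:
  assumes "distinct xs" "set xs = pverts G"
  shows "adj_eigenvalues G = rev (sorted_list_of_multiset (proots (char_poly (adj_mat G xs))))"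
proof -
  have "distinct (vertex_enum G) \<and> set (vertex_enum G) = pverts G"
    unfolding vertex_enum_def by (rule someI[of _ xs]) (use assms in auto)
  hence "similar_mat (adj_mat G (vertex_enum G)) (adj_mat G xs)"
    using assms by (intro adj_mat_similar) auto
  thus ?thesis unfolding adj_eigenvalues_def by (simp add: char_poly_similar)
qed

text \<open>A graph of order \<open>n\<close> has \<open>n\<close> real eigenvalues, so the indices \<open>1, \<dots>, n\<close> are meaningful.\<close>

lemma adj_mat_eigenvalue_real:
  assumes G: "pair_graph G"
    and ev: "eigenvalue (map_mat complex_of_real (adj_mat G xs)) a"
  shows "a \<in> \<real>"
proof -
  define n where "n = length xs"
  define C where "C = map_mat complex_of_real (adj_mat G xs)"
  have C: "C \<in> carrier_mat n n"
    unfolding C_def adj_mat_def n_def by simp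
  have sym: "(x, y) \<in> parcs G \<longleftrightarrow> (y, x) \<in> parcs G" for x y
  proof -
    interpret pair_graph G by fact
    show ?thesis using arcs_symmetric by blast
  qed
  have Cs: "C $$ (i, j) = C $$ (j, i)" "cnj (C $$ (i, j)) = C $$ (i, j)" if "i < n" "j < n" for i j
    using that sym[of "xs ! i" "xs ! j"] unfolding C_def adj_mat_def n_def by auto
  from ev obtain v where v: "v \<in> carrier_vec n" "v \<noteq> 0\<^sub>v n" "C *\<^sub>v v = a \<cdot>\<^sub>v v"
    using C unfolding eigenvalue_def eigenvector_def C_def[symmetric] by auto
  have row: "(\<Sum>j = 0..<n. C $$ (i, j) * v $ j) = a * v $ i" if "i < n" for i
  proof -
    have "(\<Sum>j = 0..<n. C $$ (i, j) * v $ j) = (C *\<^sub>v v) $ i"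
      using that C v(1) by (auto simp: scalar_prod_def)
    thus ?thesis using v that by simp
  qed
  define s where "s = (\<Sum>i = 0..<n. \<Sum>j = 0..<n. cnj (v $ i) * C $$ (i, j) * v $ j)"
  have "cnj s = (\<Sum>i = 0..<n. \<Sum>j = 0..<n. v $ i * C $$ (j, i) * cnj (v $ j))"
    unfolding s_def cnj_sum by (intro sum.cong refl) (auto simp: Cs)
  also have "\<dots> = (\<Sum>j = 0..<n. \<Sum>i = 0..<n. v $ i * C $$ (j, i) * cnj (v $ j))"
    by (rule sum.swap)
  also have "\<dots> = s" unfolding s_def by (simp add: mult_ac)
  finally have sr: "s \<in> \<real>" by (simp add: Reals_cnj_iff)
  define r where "r = (\<Sum>i = 0..<n. (cmod (v $ i))\<^sup>2)"
  have "s = (\<Sum>i = 0..<n. cnj (v $ i) * (a * v $ i))"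
    unfolding s_def
    by (intro sum.cong refl) (simp add: row[symmetric] sum_distrib_left mult.assoc)
  also have "\<dots> = a * of_real r"
    unfolding r_def of_real_sum sum_distrib_left
    by (intro sum.cong refl) (simp add: complex_norm_square mult_ac del: of_real_power)
  finally have s: "s = a * of_real r" .
  obtain i where i: "i < n" "v $ i \<noteq> 0" using v(1,2) by (metis carrier_vecD eq_vecI index_zero_vec)
  have "r > 0" unfolding r_def
    by (rule sum_pos2[of _ i]) (use i in auto)
  hence "a = s / of_real r" using s by simp
  thus ?thesis using sr by simp
qed

lemma length_adj_eigenvalues:
  assumes G: "pair_graph G"
  shows "length (adj_eigenvalues G) = card (pverts G)"
proof -
  interpret pair_graph G by fact
  obtain xs where xs: "distinct xs" "set xs = pverts G"
    using pair_finite_verts finite_distinct_list by blast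
  define n where "n = length xs"
  define A where "A = adj_mat G xs"
  have A: "A \<in> carrier_mat n n" unfolding A_def adj_mat_def n_def by simp
  let ?C = "map_mat complex_of_real A"
  have C: "?C \<in> carrier_mat n n" using A by simp
  obtain as where as: "char_poly ?C = (\<Prod>a\<leftarrow>as. [:- a, 1:])" "length as = n"
    using char_poly_factorized[OF C] by blast
  have re: "a \<in> \<real>" if "a \<in> set as" for a
  proof -
    have "poly (char_poly ?C) a = 0"
      unfolding as(1) using that by (auto simp: poly_prod_list prod_list_zero_iff)
    hence "eigenvalue ?C a" using eigenvalue_root_char_poly[OF C] by blast
    thus ?thesis using adj_mat_eigenvalue_real[OF G] unfolding A_def by blast
  qed
  define rs where "rs = map Re as"
  have asrs: "as = map of_real rs" unfolding rs_def map_map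
    by (rule map_idI[symmetric]) (use re in \<open>auto simp: of_real_Re\<close>)
  interpret h: map_poly_inj_idom_hom complex_of_real ..
  have "map_poly complex_of_real (char_poly A) = char_poly ?C"
    by (rule of_real_hom.char_poly_hom[OF A, symmetric])
  also have "\<dots> = map_poly complex_of_real (\<Prod>r\<leftarrow>rs. [:- r, 1:])"
    unfolding as(1) asrs
  proof (induct rs)
    case (Cons r rs)
    have "map_poly complex_of_real (\<Prod>r\<leftarrow>r # rs. [:- r, 1:]) =
        map_poly complex_of_real [:- r, 1:] * map_poly complex_of_real (\<Prod>r\<leftarrow>rs. [:- r, 1:])"
      unfolding list.map prod_list.Cons by (rule h.hom_mult)
    also have "map_poly complex_of_real [:- r, 1:] = [:- of_real r, 1:]"
      by (simp add: map_poly_pCons)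
    finally show ?case unfolding list.map prod_list.Cons using Cons by simp
  qed simp
  finally have "char_poly A = (\<Prod>r\<leftarrow>rs. [:- r, 1:])" by simp
  moreover have "proots (\<Prod>r\<leftarrow>rs. [:- r, 1:]) = mset rs"
  proof (induct rs)
    case (Cons r rs)
    have "(\<Prod>r\<leftarrow>rs. [:- r, 1:]) \<noteq> 0" by (auto simp: prod_list_zero_iff)
    thus ?case using Cons proots_mult[of "[:- r, 1:]" "\<Prod>r\<leftarrow>rs. [:- r, 1:]"] by simp
  qed simp
  ultimately have "proots (char_poly A) = mset rs" by simp
  hence "length (adj_eigenvalues G) = length rs"
    unfolding adj_eigenvalues_eq[OF xs] A_def by simp
  thus ?thesis using as(2) xs unfolding rs_def n_def by (metis distinct_card length_map)
qed

section \<open>The parameters\<close>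

definition eta :: real where
  "eta = sqrt (2 + sqrt 5)"

definition r_eps :: "nat \<Rightarrow> real \<Rightarrow> int" where
  "r_eps k \<epsilon> = \<lceil>pi / arccos (1 - \<epsilon> / (real k - 1))\<rceil> - 1"

section \<open>The family of trees\<close>

text \<open>
  \<open>path_attach [n\<^sub>1, \<dots>, n\<^sub>t] [m\<^sub>1, \<dots>, m\<^sub>t] p\<close>: vertex \<open>j\<close> of the main path is \<open>(0, j)\<close>; the path
  attached at \<open>m\<^sub>i\<close> consists of \<open>(i, 0), \<dots>, (i, n\<^sub>i - 1)\<close>, with \<open>(i, 0)\<close> joined to \<open>(0, m\<^sub>i)\<close>.
\<close>

definition path_attach :: "nat list \<Rightarrow> nat list \<Rightarrow> nat \<Rightarrow> (nat \<times> nat) pair_pre_digraph" where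
  "path_attach ns ms p =
     (let E = {((0, j), (0, Suc j)) | j. Suc j < p}
            \<union> {((Suc i, j), (Suc i, Suc j)) | i j. i < length ns \<and> Suc j < ns ! i}
            \<union> {((0, ms ! i), (Suc i, 0)) | i. i < length ns}
      in \<lparr> pverts = {(0, j) | j. j < p} \<union> {(Suc i, j) | i j. i < length ns \<and> j < ns ! i},
           parcs = E \<union> E\<inverse> \<rparr>)"

text \<open>
  In \<open>T_tree a b c\<close> the vertices of the three paths are \<open>(i, 0), \<dots>, (i, l)\<close> with \<open>l\<close> equal
  to \<open>a\<close>, \<open>b\<close>, \<open>c\<close>; \<open>q\<close> identifies their endpoints \<open>(i, 0)\<close>.
\<close>

definition T_tree :: "nat \<Rightarrow> nat \<Rightarrow> nat \<Rightarrow> (nat \<times> nat) pair_pre_digraph" where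
  "T_tree a b c =
     (let ls = [a, b, c];
          q = (\<lambda>(i, j). if j = 0 then (0, 0) else (i, j));
          E = {(q (i, j), q (i, Suc j)) | i j. i < length ls \<and> j < ls ! i}
      in \<lparr> pverts = {q (i, j) | i j. i < length ls \<and> j \<le> ls ! i},
           parcs = E \<union> E\<inverse> \<rparr>)"

text \<open>Meant for \<open>n \<ge> 12\<close>, where no subtraction on \<open>nat\<close> truncates.\<close>

definition tree_family :: "nat \<Rightarrow> (nat \<times> nat) pair_pre_digraph set" where
  "tree_family n =
     {path_attach [1, 1, 1] [1, a, n - 5] (n - 3) | a. a \<in> {4..n - 8}} \<union>
     {path_attach [1, 1] [1, b] (n - 2) | b. b \<in> {4..n - 5}} \<union>
     {path_attach [1, 1] [2, n - 6] (n - 2),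
      path_attach [1, 1] [2, n - 5] (n - 2),
      path_attach [1, 2] [1, n - 6] (n - 3),
      T_tree 2 2 (n - 5)} \<union>
     {T_tree 1 c (n - c - 2) | c. c \<in> {2..n - 4}}"

end

theory Submission
  imports Defs "Jordan_Normal_Form.Schur_Decomposition"
begin

text \<open>
  By Ky Fan's principle, \<open>S\<^sub>k\<close> is at least the sum of the Rayleigh quotients of any \<open>k\<close> vectors
  with disjoint supports. A star shows that the degrees are less than \<open>(2k + 1)\<^sup>2\<close>, so a longest path
  of \<open>T\<close> is very long. Cutting it into blocks of length \<open>r\<close> yields arbitrarily placed vectors
  of quotient almost 2, with total loss at most \<open>2\<epsilon> = 0.00012\<close>. Hence \<open>T\<close> has no subtree near which
  the remaining vectors have quotient at least \<open>\<eta> + 2\<epsilon>\<close>, and no two disjoint subtrees with quotients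
  of sum at least \<open>2 + \<eta> + 2\<epsilon>\<close>. Explicit small integer vectors turn this into restrictions on what
  may hang off the longest path: single leaves at mutual distance at least 3, or a path of two
  vertices near an end, in only a few arrangements. Apart from the family, they leave trees
  in which every branch is a leaf next to an end of the path; these carry a positive function
  \<open>h\<close> with \<open>A h \<le> 2 h\<close>, so all their eigenvalues are at most 2 and only one of them equals 2.
\<close>

section \<open>Ky Fan's inequality and superharmonic functions\<close>

text \<open>The number \<eta> is the limit of the largest eigenvalue of T_{1,m,m} as m grows. A
  single leaf on a path therefore never reaches \<eta>, and a contradiction always needs more: a
  second leaf, in the same piece or in a disjoint one, or a second vertex on the branch. The weights
  imitate the limit vector: if t + 1/t = \<eta>, then t^2 is the golden ratio, so the weights fall
  by a factor of about 0.79 per step along a long arm, and the leaf gets 1/\<eta>, about 0.49, of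
  its neighbour. Only rational inequalities between such lists are evaluated; no eigenvalue of a
  particular tree is computed. The obstacle is room. A piece must be disjoint from the blocks that
  supply the other vectors, so it is confined to a window of 100 path vertices, which is at most
  \<open>r\<close>, and its outer arms must fit between a branch and an end of the path. The path
  has at least 400 vertices, hence at most one side of a branch is cramped; reversing the path puts
  the long arm on the right. Near the ends, where the spectral argument has no room, the maximality
  of the path takes over.\<close>

lemma symmetric_mat_orthonormal_diagonalization:
  fixes A :: "real mat"
  assumes "A \<in> carrier_mat n n" "A\<^sup>T = A"
    and "char_poly A = (\<Prod>e\<leftarrow>es. [:- e, 1:])"
  shows "\<exists>U \<in> carrier_mat n n. U\<^sup>T * U = 1\<^sub>m n \<and>
    U\<^sup>T * A * U = mat n n (\<lambda>(i, j). if i = j then es ! i else 0)"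
  using assms
proof (induct es arbitrary: n A)
  case Nil
  with degree_monic_char_poly[of A n] have "n = 0" by auto
  thus ?case using Nil by (intro bexI[of _ "1\<^sub>m 0"]) auto
next
  case (Cons e es n A)
  let ?n1 = "n - 1"
  note A = Cons(2) and sym = Cons(3)
  from Cons(4) have cp: "char_poly A = [: -e, 1 :] * (\<Prod>e \<leftarrow> es. [:- e, 1:])" by auto
  have mon: "monic (\<Prod>e\<leftarrow> es. [:- e, 1:])" by (rule monic_prod_list, auto)
  have deg: "degree (char_poly A) = Suc (degree (\<Prod>e\<leftarrow> es. [:- e, 1:]))" unfolding cp
    by (subst degree_mult_eq, insert mon, auto)
  with degree_monic_char_poly[OF A] have n: "n \<noteq> 0" by auto
  \<comment> \<open>An eigenvector for the first root is completed to an orthogonal basis. In that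
    basis the matrix splits into a block of size 1 and a symmetric block whose roots are
    \<open>es\<close>, to which the induction hypothesis applies.\<close>
  define v where "v = find_eigenvector A e"
  define b where "b = basis_completion v"
  define ws where "ws = gram_schmidt n b"
  have ev: "eigenvector A v e" unfolding v_def
    by (rule find_eigenvector[OF A]) (simp add: eigenvalue_root_char_poly[OF A] cp)
  hence v: "v \<in> carrier_vec n" and v0: "v \<noteq> 0\<^sub>v n" and Av: "A *\<^sub>v v = e \<cdot>\<^sub>v v"
    using A unfolding eigenvector_def by auto
  interpret cof_vec_space n "TYPE(real)" .
  from basis_completion[OF v v0, folded b_def]
  have dist_b: "distinct b" and indep: "\<not> lin_dep (set b)" and b: "set b \<subseteq> carrier_vec n"
    and hdb: "hd b = v" and len_b: "length b = n" by auto
  from hdb len_b n obtain vs where bv: "b = v # vs" by (cases b, auto)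
  from gram_schmidt_result[OF b dist_b indep refl, folded ws_def]
  have ws: "set ws \<subseteq> carrier_vec n" "corthogonal ws" "length ws = n"
    by (auto simp: len_b)
  from gram_schmidt_hd[OF v, of vs, folded bv] have hdws: "hd ws = v" unfolding ws_def .
  hence ws0: "ws ! 0 = v" using ws(3) n by (cases ws) auto
  have wsc: "ws ! i \<in> carrier_vec n" if "i < n" for i using ws that by auto
  have conj: "conjugate x = x" for x :: "real vec" by (rule eq_vecI) auto
  have orth: "ws ! i \<bullet> ws ! j = 0 \<longleftrightarrow> i \<noteq> j" if "i < n" "j < n" for i j
    using corthogonalD[OF ws(2), of i j] that ws(3) by (simp add: conj)
  \<comment> \<open>Gram-Schmidt makes \<open>ws\<close> orthogonal but not normalised. Division by
    the lengths \<open>c\<close> makes \<open>N\<close> an orthogonal matrix, so that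
    \<open>A'\<close> stays symmetric and its first row vanishes together with its first
    column.\<close>
  define c where "c i = sqrt (ws ! i \<bullet> ws ! i)" for i
  have c0: "c i > 0" and c2: "c i * c i = ws ! i \<bullet> ws ! i" if "i < n" for i
  proof -
    have "ws ! i \<bullet> ws ! i \<ge> 0" unfolding scalar_prod_def by (intro sum_nonneg) auto
    with orth[OF that that] show "c i > 0" "c i * c i = ws ! i \<bullet> ws ! i" unfolding c_def by auto
  qed
  define N where "N = mat n n (\<lambda>(i, j). ws ! j $ i / c j)"
  have N: "N \<in> carrier_mat n n" unfolding N_def by simp
  have colN: "col N j = (1 / c j) \<cdot>\<^sub>v ws ! j" if "j < n" for j
    using that wsc[OF that] unfolding N_def by (intro eq_vecI) auto
  have NN: "N\<^sup>T * N = 1\<^sub>m n"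
  proof (rule eq_matI)
    fix i j assume "i < dim_row (1\<^sub>m n :: real mat)" "j < dim_col (1\<^sub>m n :: real mat)"
    hence ij: "i < n" "j < n" by auto
    have "(N\<^sup>T * N) $$ (i, j) = (ws ! i \<bullet> ws ! j) / (c i * c j)"
      using ij N wsc[OF ij(1)] wsc[OF ij(2)] by (simp add: colN)
    thus "(N\<^sup>T * N) $$ (i, j) = (1\<^sub>m n :: real mat) $$ (i, j)"
      using orth[OF ij] c0[OF ij(1)] c2[OF ij(1)] ij by auto
  qed (use N in auto)
  have NN': "N * N\<^sup>T = 1\<^sub>m n"
    using mat_mult_left_right_inverse[OF _ N NN] N by simp
  define A' where "A' = N\<^sup>T * A * N"
  have A': "A' \<in> carrier_mat n n" unfolding A'_def using N A by simp
  have A'sym: "A'\<^sup>T = A'" unfolding A'_def using N A sym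
    by (simp add: transpose_mult[of _ n n _ n] assoc_mult_mat[of _ n n _ n _ n])
  have A'0: "A' $$ (i, 0) = (if i = 0 then e else 0)" if i: "i < n" for i
  proof -
    have c: "A *\<^sub>v col N 0 = e \<cdot>\<^sub>v col N 0"
      using A Av v n by (simp add: colN ws0 mult_mat_vec[of A n n v] smult_smult_assoc mult.commute)
    have "A' $$ (i, 0) = row (N\<^sup>T) i \<bullet> (A *\<^sub>v col N 0)"
      unfolding A'_def using A N n i
      by (simp add: assoc_mult_mat[of _ n n _ n _ n] mult_mat_vec_def)
    also have "\<dots> = e * (col N i \<bullet> col N 0)" unfolding c using N i n by simp
    also have "col N i \<bullet> col N 0 = (N\<^sup>T * N) $$ (i, 0)" using N i n by simp
    finally show ?thesis using i n by (simp add: NN)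
  qed
  have A'0': "A' $$ (0, j) = (if j = 0 then e else 0)" if "j < n" for j
    using A'0[OF that] A'sym A' n that by (metis index_transpose_mat(1) carrier_matD neq0_conv)
  define A3 where "A3 = mat ?n1 ?n1 (\<lambda>(i, j). A' $$ (Suc i, Suc j))"
  have A3: "A3 \<in> carrier_mat ?n1 ?n1" unfolding A3_def by simp
  have blk: "A' = four_block_mat (mat 1 1 (\<lambda>_. e)) (0\<^sub>m 1 ?n1) (0\<^sub>m ?n1 1) A3"
    by (rule eq_matI) (use A' n A'0 A'0' in \<open>auto simp: A3_def\<close>)
  have A3sym: "A3\<^sup>T = A3"
  proof (rule eq_matI)
    fix i j assume "i < dim_row A3" "j < dim_col A3"
    hence ij: "Suc i < n" "Suc j < n" using A3 by auto
    hence "A' $$ (Suc i, Suc j) = A' $$ (Suc j, Suc i)"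
      using A' arg_cong[OF A'sym, of "\<lambda>M. M $$ (Suc j, Suc i)"] by simp
    thus "A3\<^sup>T $$ (i, j) = A3 $$ (i, j)" using ij unfolding A3_def by simp
  qed (use A3 in auto)
  have "similar_mat A' A"
    by (rule similar_matI[of _ _ "N\<^sup>T" N n]) (use N A A' NN NN' A'_def in auto)
  hence "char_poly A' = char_poly A" by (rule char_poly_similar)
  also have "\<dots> = [: -e, 1 :] * (\<Prod>e \<leftarrow> es. [:- e, 1:])" by (rule cp)
  also have "char_poly A' = char_poly (mat 1 1 (\<lambda>_. e)) * char_poly A3"
    unfolding blk by (rule char_poly_four_block_zeros_col[OF _ _ A3]) auto
  also have "char_poly (mat 1 1 (\<lambda>_. e)) = [: -e, 1 :]"
    by (simp add: char_poly_defs det_def sign_def)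
  finally have "char_poly A3 = (\<Prod> e \<leftarrow> es. [:- e, 1:])"
    by (metis mult_cancel_left pCons_eq_0_iff zero_neq_one)
  from Cons(1)[OF A3 A3sym this] obtain U where U: "U \<in> carrier_mat ?n1 ?n1"
    and UU: "U\<^sup>T * U = 1\<^sub>m ?n1"
    and D: "U\<^sup>T * A3 * U = mat ?n1 ?n1 (\<lambda>(i, j). if i = j then es ! i else 0)" by blast
  define F where "F = four_block_mat (1\<^sub>m 1) (0\<^sub>m 1 ?n1) (0\<^sub>m ?n1 1) U"
  have F: "F \<in> carrier_mat n n" unfolding F_def using U n by (metis Suc_diff_1 Suc_eq_plus1_left carrier_matI four_block_carrier_mat neq0_conv one_carrier_mat)
  have FT: "F\<^sup>T = four_block_mat (1\<^sub>m 1) (0\<^sub>m 1 ?n1) (0\<^sub>m ?n1 1) (U\<^sup>T)"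
    unfolding F_def by (rule eq_matI) (use U n in auto)
  have FF: "F\<^sup>T * F = 1\<^sub>m n"
    unfolding FT unfolding F_def using U n
    by (subst mult_four_block_mat[of _ 1 1 _ ?n1 _ ?n1 _ _ 1 _ ?n1]) (auto simp: UU intro!: eq_matI)
  have FAF: "F\<^sup>T * A' * F = mat n n (\<lambda>(i, j). if i = j then (e # es) ! i else 0)"
    unfolding FT blk unfolding F_def using U n A3
    apply (subst mult_four_block_mat[of _ 1 1 _ ?n1 _ ?n1 _ _ 1 _ ?n1], auto)
    apply (subst mult_four_block_mat[of _ 1 1 _ ?n1 _ ?n1 _ _ 1 _ ?n1], auto simp: D)
    by (rule eq_matI) (auto simp: nth_Cons split: nat.splits)
  show ?case
  proof (intro bexI conjI)
    show "N * F \<in> carrier_mat n n" using N F by simp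
    have t: "(N * F)\<^sup>T = F\<^sup>T * N\<^sup>T" by (rule transpose_mult[OF N F])
    have "(N * F)\<^sup>T * (N * F) = F\<^sup>T * (N\<^sup>T * N) * F"
      unfolding t using N F by (simp add: assoc_mult_mat[of _ n n _ n _ n])
    thus "(N * F)\<^sup>T * (N * F) = 1\<^sub>m n" using F FF by (simp add: NN)
    have "(N * F)\<^sup>T * A * (N * F) = F\<^sup>T * A' * F"
      unfolding t A'_def using N F A by (simp add: assoc_mult_mat[of _ n n _ n _ n])
    thus "(N * F)\<^sup>T * A * (N * F) = mat n n (\<lambda>(i, j). if i = j then (e # es) ! i else 0)"
      by (simp add: FAF)
  qed
qed

section \<open>From the list of eigenvalues to a spectral decomposition over the vertices\<close>

lemma monic_eq_prod_proots:
  fixes p :: "'a :: field poly"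
  assumes "monic p" "size (proots p) = degree p"
  shows "p = (\<Prod>x\<in>#proots p. [:- x, 1:])"
  using assms
proof (induct "degree p" arbitrary: p)
  case 0
  hence "p = 1" by (metis monic_degree_0)
  thus ?case by simp
next
  case (Suc d p)
  then obtain a where a: "a \<in># proots p" by (metis multiset_nonemptyE nat.distinct(1) size_empty)
  have p0: "p \<noteq> 0" using Suc.hyps(2) by auto
  with a have "poly p a = 0" by simp
  then obtain q where q: "p = [:- a, 1:] * q" by (auto simp: poly_eq_0_iff_dvd)
  hence q0: "q \<noteq> 0" using p0 by auto
  have dq: "degree p = Suc (degree q)" unfolding q using q0 by (subst degree_mult_eq) auto
  have pq: "proots p = add_mset a (proots q)"
    unfolding q using q0 by (subst proots_mult) auto
  have "lead_coeff q = 1" using Suc.prems(1) unfolding q lead_coeff_mult by simp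
  hence "q = (\<Prod>x\<in>#proots q. [:- x, 1:])"
    using Suc.hyps(1)[of q] Suc.hyps(2) Suc.prems dq pq by simp
  thus ?case unfolding pq using q by simp
qed

lemma char_poly_adj_mat:
  assumes G: "pair_graph G" and xs: "distinct xs" "set xs = pverts G"
  shows "char_poly (adj_mat G xs) = (\<Prod>e\<leftarrow>adj_eigenvalues G. [:- e, 1:])"
proof -
  let ?p = "char_poly (adj_mat G xs)"
  have A: "adj_mat G xs \<in> carrier_mat (length xs) (length xs)" by (simp add: adj_mat_def)
  have d: "degree ?p = length xs" and m: "monic ?p" using degree_monic_char_poly[OF A] by auto
  have e: "mset (adj_eigenvalues G) = proots ?p"
    unfolding adj_eigenvalues_eq[OF xs] by simp
  have "size (proots ?p) = degree ?p"
    unfolding e[symmetric] d size_mset length_adj_eigenvalues[OF G] using xs distinct_card by metis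
  from monic_eq_prod_proots[OF m this] show ?thesis
    unfolding e[symmetric] by (metis mset_map prod_mset_prod_list)
qed

text \<open>The three identities are U^T U = 1, U U^T = 1 and A = U D U^T, read entry by entry.
  Indexing the vectors by vertices removes the enumeration of the vertices from all that
  follows.\<close>

lemma adj_orthonormal_eigenbasis:
  fixes G :: "'a pair_pre_digraph"
  assumes G: "pair_graph G" and n: "card (pverts G) = n"
  obtains u :: "nat \<Rightarrow> 'a \<Rightarrow> real" where
    "\<And>i j. i < n \<Longrightarrow> j < n \<Longrightarrow> (\<Sum>v\<in>pverts G. u i v * u j v) = of_bool (i = j)"
    "\<And>v w. v \<in> pverts G \<Longrightarrow> w \<in> pverts G \<Longrightarrow> (\<Sum>i<n. u i v * u i w) = of_bool (v = w)"
    "\<And>v w. v \<in> pverts G \<Longrightarrow> w \<in> pverts G \<Longrightarrow>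
       (\<Sum>i<n. adj_eigenvalues G ! i * u i v * u i w) = of_bool ((v, w) \<in> parcs G)"
proof -
  interpret pair_graph G by fact
  obtain xs where xs: "distinct xs" "set xs = pverts G"
    using pair_finite_verts finite_distinct_list by blast
  have lx: "length xs = n" using xs n distinct_card by metis
  define A where "A = adj_mat G xs"
  define es where "es = adj_eigenvalues G"
  have A: "A \<in> carrier_mat n n" unfolding A_def adj_mat_def lx by simp
  have "A\<^sup>T = A"
    by (rule eq_matI) (use A in \<open>auto simp: A_def adj_mat_def lx intro: arcs_symmetric\<close>)
  from symmetric_mat_orthonormal_diagonalization[OF A this]
  obtain U where U: "U \<in> carrier_mat n n" and UU: "U\<^sup>T * U = 1\<^sub>m n"
    and D: "U\<^sup>T * A * U = mat n n (\<lambda>(i, j). if i = j then es ! i else 0)"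
    using char_poly_adj_mat[OF G xs] unfolding A_def es_def by blast
  have UU': "U * U\<^sup>T = 1\<^sub>m n"
    using mat_mult_left_right_inverse[OF _ U UU] U by simp
  have "A = (U * U\<^sup>T) * A * (U * U\<^sup>T)" unfolding UU' using A by simp
  also have "\<dots> = U * (U\<^sup>T * A * U) * U\<^sup>T"
    using U A by (simp add: assoc_mult_mat[of _ n n _ n _ n])
  finally have AD: "A = U * mat n n (\<lambda>(i, j). if i = j then es ! i else 0) * U\<^sup>T" unfolding D .
  define idx where "idx = the_inv_into {..<n} ((!) xs)"
  have inj: "inj_on ((!) xs) {..<n}" using xs(1) lx by (auto simp: inj_on_nth)
  have idx: "idx (xs ! a) = a" if "a < n" for a
    unfolding idx_def using that inj by (intro the_inv_into_f_f) auto
  have bij: "bij_betw ((!) xs) {..<n} (pverts G)"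
    using bij_betw_nth[OF xs(1), of "{..<n}" "pverts G"] lx xs(2) by auto
  have idxl: "idx v < n" "xs ! idx v = v" if "v \<in> pverts G" for v
  proof -
    obtain a where "a < n" "xs ! a = v" using \<open>v \<in> pverts G\<close> bij unfolding bij_betw_def by (metis imageE lessThan_iff)
    thus "idx v < n" "xs ! idx v = v" using idx by auto
  qed
  define u where "u i v = U $$ (idx v, i)" for i v
  show ?thesis
  proof (rule that[of u])
    fix i j assume ij: "i < n" "j < n"
    have "(\<Sum>v\<in>pverts G. u i v * u j v) = (\<Sum>a<n. U $$ (a, i) * U $$ (a, j))"
      unfolding u_def sum.reindex_bij_betw[OF bij, symmetric]
      by (intro sum.cong) (auto simp: idx)
    also have "\<dots> = (U\<^sup>T * U) $$ (i, j)"
      using U ij by (simp add: scalar_prod_def atLeast0LessThan)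
    finally show "(\<Sum>v\<in>pverts G. u i v * u j v) = of_bool (i = j)" using ij by (simp add: UU)
  next
    fix v w assume vw: "v \<in> pverts G" "w \<in> pverts G"
    note iv = idxl[OF vw(1)] and iw = idxl[OF vw(2)]
    have "(\<Sum>i<n. u i v * u i w) = (U * U\<^sup>T) $$ (idx v, idx w)"
      using U iv iw by (simp add: u_def scalar_prod_def atLeast0LessThan)
    also have "\<dots> = of_bool (idx v = idx w)" using iv iw by (simp add: UU')
    also have "(idx v = idx w) = (v = w)" using iv iw by metis
    finally show "(\<Sum>i<n. u i v * u i w) = of_bool (v = w)" .
    have 1: "(U * mat n n (\<lambda>(i, j). if i = j then es ! i else 0)) $$ (a, i) = es ! i * U $$ (a, i)"
      if "a < n" "i < n" for a i
    proof -
      have "(U * mat n n (\<lambda>(i, j). if i = j then es ! i else 0)) $$ (a, i)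
          = (\<Sum>j<n. U $$ (a, j) * (if j = i then es ! j else 0))"
        using that U by (simp add: scalar_prod_def atLeast0LessThan)
      also have "\<dots> = (\<Sum>j<n. if j = i then es ! i * U $$ (a, i) else 0)"
        by (intro sum.cong) auto
      finally show ?thesis using that by simp
    qed
    have 2: "(M * U\<^sup>T) $$ (a, b) = (\<Sum>i<n. M $$ (a, i) * U $$ (b, i))"
      if "M \<in> carrier_mat n n" "a < n" "b < n" for M a b
      using that U by (simp add: scalar_prod_def atLeast0LessThan)
    have "of_bool ((v, w) \<in> parcs G) = A $$ (idx v, idx w)"
      unfolding A_def adj_mat_def lx using iv iw by simp
    also have "\<dots> = (\<Sum>i<n. es ! i * U $$ (idx v, i) * U $$ (idx w, i))"
      unfolding AD using iv iw by (subst 2) (use U 1 in \<open>auto simp del: index_mult_mat(1)\<close>)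
    finally show "(\<Sum>i<n. adj_eigenvalues G ! i * u i v * u i w) = of_bool ((v, w) \<in> parcs G)"
      by (simp add: u_def es_def)
  qed
qed

text \<open>This is the quadratic form x^T A x: every edge contributes twice, once for each of its
  two arcs.\<close>

definition adj_form :: "'a pair_pre_digraph \<Rightarrow> ('a \<Rightarrow> real) \<Rightarrow> real" where
  "adj_form G f = (\<Sum>(v, w)\<in>parcs G. f v * f w)"

lemma adj_form_eq_sum:
  assumes "pair_graph G"
  shows "adj_form G f = (\<Sum>v\<in>pverts G. \<Sum>w\<in>pverts G. of_bool ((v, w) \<in> parcs G) * (f v * f w))"
proof -
  interpret pair_graph G by fact
  have s: "parcs G \<subseteq> pverts G \<times> pverts G" using wellformed' by auto
  have "adj_form G f = (\<Sum>(v, w)\<in>pverts G \<times> pverts G. of_bool ((v, w) \<in> parcs G) * (f v * f w))"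
    unfolding adj_form_def using s
    by (intro sum.mono_neutral_cong_left) (auto simp: pair_finite_verts)
  thus ?thesis by (simp only: sum.cartesian_product)
qed

lemma adj_eigenvalues_decreasing:
  assumes "i \<le> j" "j < length (adj_eigenvalues G)"
  shows "adj_eigenvalues G ! j \<le> adj_eigenvalues G ! i"
proof -
  have "sorted (rev (adj_eigenvalues G))" unfolding adj_eigenvalues_def by simp
  thus ?thesis using assms by (simp add: sorted_rev_nth_mono)
qed

lemma eigenvalue_sum_eq: "eigenvalue_sum k G = (\<Sum>i<k. adj_eigenvalues G ! i)"
proof -
  have "eigenvalue_sum k G = (\<Sum>i\<in>{1..k}. adj_eigenvalues G ! (i - 1))"
    unfolding eigenvalue_sum_def adj_eigenvalue_def ..
  also have "\<dots> = (\<Sum>i<k. adj_eigenvalues G ! i)"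
    by (rule sum.reindex_bij_witness[of _ Suc "\<lambda>i. i - 1"]) auto
  finally show ?thesis .
qed

text \<open>Ky Fan's principle. Expanded in an eigenbasis, the left side is a combination of the
  eigenvalues with coefficients \<open>w j\<close> in [0, 1] of total \<open>k\<close>; it is
  largest when all the mass lies on the first \<open>k\<close> eigenvalues.\<close>

lemma eigenvalue_sum_ge_sum_adj_form:
  assumes G: "pair_graph G" and k: "k \<le> card (pverts G)"
    and orth: "\<And>i j. i < k \<Longrightarrow> j < k \<Longrightarrow> (\<Sum>v\<in>pverts G. f i v * f j v) = of_bool (i = j)"
  shows "(\<Sum>i<k. adj_form G (f i)) \<le> eigenvalue_sum k G"
proof -
  interpret pair_graph G by fact
  define V where "V = pverts G"
  have fin: "finite V" unfolding V_def by simp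
  define n where "n = card V"
  define e where "e i = adj_eigenvalues G ! i" for i
  obtain u where
    uo: "\<And>i j. i < n \<Longrightarrow> j < n \<Longrightarrow> (\<Sum>v\<in>V. u i v * u j v) = of_bool (i = j)" and
    uc: "\<And>v w. v \<in> V \<Longrightarrow> w \<in> V \<Longrightarrow> (\<Sum>i<n. u i v * u i w) = of_bool (v = w)" and
    ua: "\<And>v w. v \<in> V \<Longrightarrow> w \<in> V \<Longrightarrow> (\<Sum>i<n. e i * u i v * u i w) = of_bool ((v, w) \<in> parcs G)"
    by (rule adj_orthonormal_eigenbasis[OF G refl, folded V_def n_def e_def]) (rule that)
  define c where "c i j = (\<Sum>v\<in>V. f i v * u j v)" for i j
  have dec: "e j \<le> e i" if "i \<le> j" "j < n" for i j
    unfolding e_def using adj_eigenvalues_decreasing that length_adj_eigenvalues[OF G]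
    unfolding n_def V_def by metis
  \<comment> \<open>The weight \<open>g\<close> is left open because two instances are needed: the
    eigenvalues give the quadratic form, the constant 1 gives the norm.\<close>
  have cc: "(\<Sum>j<n. g j * (c i j)\<^sup>2) = (\<Sum>v\<in>V. \<Sum>w\<in>V. (\<Sum>j<n. g j * u j v * u j w) * (f i v * f i w))"
    for g i
  proof -
    have "g j * (c i j)\<^sup>2 = (\<Sum>v\<in>V. \<Sum>w\<in>V. g j * u j v * u j w * (f i v * f i w))" for j
    proof -
      have "g j * (c i j)\<^sup>2 = g j * (\<Sum>v\<in>V. \<Sum>w\<in>V. (f i v * u j v) * (f i w * u j w))"
        unfolding c_def power2_eq_square by (simp only: sum_product)
      also have "\<dots> = (\<Sum>v\<in>V. \<Sum>w\<in>V. g j * ((f i v * u j v) * (f i w * u j w)))"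
        by (simp only: sum_distrib_left)
      finally show ?thesis by (simp add: mult_ac)
    qed
    hence "(\<Sum>j<n. g j * (c i j)\<^sup>2) = (\<Sum>j<n. \<Sum>v\<in>V. \<Sum>w\<in>V. g j * u j v * u j w * (f i v * f i w))"
      by simp
    also have "\<dots> = (\<Sum>v\<in>V. \<Sum>j<n. \<Sum>w\<in>V. g j * u j v * u j w * (f i v * f i w))"
      by (rule sum.swap)
    also have "\<dots> = (\<Sum>v\<in>V. \<Sum>w\<in>V. \<Sum>j<n. g j * u j v * u j w * (f i v * f i w))"
      by (rule sum.cong[OF refl], rule sum.swap)
    finally show ?thesis by (simp only: sum_distrib_right)
  qed
  have form: "adj_form G (f i) = (\<Sum>j<n. e j * (c i j)\<^sup>2)" for i
    unfolding adj_form_eq_sum[OF G] cc V_def[symmetric] by (intro sum.cong refl) (simp add: ua)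
  have norm: "(\<Sum>j<n. (c i j)\<^sup>2) = 1" if "i < k" for i
  proof -
    have "(\<Sum>j<n. (c i j)\<^sup>2) = (\<Sum>v\<in>V. \<Sum>w\<in>V. of_bool (v = w) * (f i v * f i w))"
      using cc[of "\<lambda>_. 1" i] by (simp add: uc)
    also have "\<dots> = (\<Sum>v\<in>V. \<Sum>w\<in>V. if v = w then f i v * f i v else 0)"
      by (intro sum.cong refl) auto
    also have "\<dots> = (\<Sum>v\<in>V. f i v * f i v)" using fin by simp
    finally show ?thesis using orth[OF that that] unfolding V_def by simp
  qed
  define w where "w j = (\<Sum>i<k. (c i j)\<^sup>2)" for j
  have w0: "w j \<ge> 0" for j unfolding w_def by (simp add: sum_nonneg)
  have w1: "w j \<le> 1" if j: "j < n" for j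
  proof -
    \<comment> \<open>\<open>h\<close> is the orthogonal projection of \<open>u j\<close> to the
      span of the \<open>f i\<close>. Its squared length is \<open>w j\<close>, hence at most that
      of \<open>u j\<close>.\<close>
    define h where "h v = (\<Sum>i<k. c i j * f i v)" for v
    have uf: "(\<Sum>v\<in>V. u j v * h v) = w j"
    proof -
      have "(\<Sum>v\<in>V. u j v * h v) = (\<Sum>v\<in>V. \<Sum>i<k. c i j * (f i v * u j v))"
        unfolding h_def sum_distrib_left by (intro sum.cong refl) (simp add: mult_ac)
      also have "\<dots> = (\<Sum>i<k. \<Sum>v\<in>V. c i j * (f i v * u j v))" by (rule sum.swap)
      also have "\<dots> = w j" unfolding w_def sum_distrib_left[symmetric] c_def[symmetric]
        by (simp add: power2_eq_square)
      finally show ?thesis .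
    qed
    have ff: "(\<Sum>v\<in>V. h v * h v) = w j"
    proof -
      have "(\<Sum>v\<in>V. h v * h v)
          = (\<Sum>v\<in>V. \<Sum>i<k. \<Sum>l<k. c i j * c l j * (f i v * f l v))"
        unfolding h_def sum_product by (intro sum.cong refl) (simp add: mult_ac)
      also have "\<dots> = (\<Sum>i<k. \<Sum>v\<in>V. \<Sum>l<k. c i j * c l j * (f i v * f l v))" by (rule sum.swap)
      also have "\<dots> = (\<Sum>i<k. \<Sum>l<k. \<Sum>v\<in>V. c i j * c l j * (f i v * f l v))"
        by (rule sum.cong[OF refl], rule sum.swap)
      also have "\<dots> = (\<Sum>i<k. \<Sum>l<k. if i = l then c i j * c i j else 0)"
        unfolding sum_distrib_left[symmetric] V_def by (intro sum.cong refl) (simp add: orth)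
      also have "\<dots> = w j" unfolding w_def by (simp add: power2_eq_square)
      finally show ?thesis .
    qed
    have "0 \<le> (\<Sum>v\<in>V. (u j v - h v) * (u j v - h v))" by (intro sum_nonneg) auto
    also have "\<dots> = (\<Sum>v\<in>V. u j v * u j v - 2 * (u j v * h v) + h v * h v)"
      by (intro sum.cong refl) (simp add: algebra_simps)
    also have "\<dots> = (\<Sum>v\<in>V. u j v * u j v) - 2 * (\<Sum>v\<in>V. u j v * h v) + (\<Sum>v\<in>V. h v * h v)"
      by (simp add: sum.distrib sum_subtractf sum_distrib_left)
    also have "\<dots> = 1 - w j" using uo[OF j j] unfolding uf ff by simp
    finally show ?thesis by simp
  qed
  have ws: "(\<Sum>j<n. w j) = k"
  proof -
    have "(\<Sum>j<n. w j) = (\<Sum>i<k. \<Sum>j<n. (c i j)\<^sup>2)" unfolding w_def by (rule sum.swap)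
    thus ?thesis by (simp add: norm)
  qed
  have kn: "k \<le> n" using k unfolding n_def V_def .
  have sub: "(\<Sum>j<n. h j * of_bool (j < k)) = (\<Sum>j<k. h j)" for h :: "nat \<Rightarrow> real"
    using kn by (intro sum.mono_neutral_cong_right) auto
  show ?thesis
  proof (cases "k = 0")
    case True thus ?thesis by (simp add: eigenvalue_sum_eq)
  next
    case False
    have "(\<Sum>i<k. adj_form G (f i)) = (\<Sum>j<n. e j * w j)"
      unfolding form w_def sum_distrib_left by (rule sum.swap)
    also have "\<dots> = (\<Sum>j<n. (e j - e (k - 1)) * w j) + e (k - 1) * k"
      by (simp add: left_diff_distrib sum_subtractf sum_distrib_left[symmetric] ws)
    \<comment> \<open>After the shift by \<open>e (k - 1)\<close> the factors are nonnegative for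
      \<open>j < k\<close> and nonpositive beyond, so replacing \<open>w j\<close> by the indicator
      can only increase the sum. The shift cancels since both weights have total
      \<open>k\<close>.\<close>
    also have "(\<Sum>j<n. (e j - e (k - 1)) * w j) \<le> (\<Sum>j<n. (e j - e (k - 1)) * of_bool (j < k))"
    proof (rule sum_mono)
      fix j assume "j \<in> {..<n}"
      hence j: "j < n" by simp
      show "(e j - e (k - 1)) * w j \<le> (e j - e (k - 1)) * of_bool (j < k)"
      proof (cases "j < k")
        case True
        hence "e j \<ge> e (k - 1)" using dec[of j "k - 1"] kn False by simp
        thus ?thesis using True w1[OF j] by (simp add: mult_left_le)
      next
        case nk: False
        hence "e j \<le> e (k - 1)" using dec[of "k - 1" j] j by simp
        thus ?thesis using nk w0[of j] by (simp add: mult_nonpos_nonneg)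
      qed
    qed
    also have "\<dots> = (\<Sum>j<k. e j) - e (k - 1) * k"
      unfolding sub by (simp add: sum_subtractf)
    finally show ?thesis unfolding eigenvalue_sum_eq e_def by simp
  qed
qed

text \<open>If \<open>k\<close> eigenvalues, all at most 2, had sum at least \<open>2 * k\<close>,
  each would be 2. Then the first two eigenvectors would attain equality and be multiples of the
  same \<open>h\<close>, although they are orthogonal unit vectors.\<close>

lemma eigenvalue_sum_less_if_form_less:
  fixes h :: "'a \<Rightarrow> real"
  assumes G: "pair_graph G" and k: "2 \<le> k" "k \<le> card (pverts G)"
    and le: "\<And>f. adj_form G f \<le> 2 * (\<Sum>v\<in>pverts G. (f v)\<^sup>2)"
    and eq: "\<And>f. adj_form G f = 2 * (\<Sum>v\<in>pverts G. (f v)\<^sup>2) \<Longrightarrow> \<exists>c. \<forall>v\<in>pverts G. f v = c * h v"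
  shows "eigenvalue_sum k G < 2 * real k"
proof (rule ccontr)
  assume "\<not> ?thesis"
  hence S: "(\<Sum>i<k. adj_eigenvalues G ! i) \<ge> 2 * real k" by (simp add: eigenvalue_sum_eq)
  interpret pair_graph G by fact
  define V where "V = pverts G"
  have fin: "finite V" unfolding V_def by simp
  define n where "n = card V"
  define e where "e i = adj_eigenvalues G ! i" for i
  obtain u where
    uo: "\<And>i j. i < n \<Longrightarrow> j < n \<Longrightarrow> (\<Sum>v\<in>V. u i v * u j v) = of_bool (i = j)" and
    ua: "\<And>v w. v \<in> V \<Longrightarrow> w \<in> V \<Longrightarrow> (\<Sum>i<n. e i * u i v * u i w) = of_bool ((v, w) \<in> parcs G)"
    by (rule adj_orthonormal_eigenbasis[OF G refl, folded V_def n_def e_def]) (rule that)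
  have kn: "k \<le> n" using k unfolding n_def V_def by simp
  have form: "adj_form G (u i) = e i" if i: "i < n" for i
  proof -
    have "adj_form G (u i) = (\<Sum>v\<in>V. \<Sum>w\<in>V. (\<Sum>j<n. e j * u j v * u j w) * (u i v * u i w))"
      unfolding adj_form_eq_sum[OF G] V_def[symmetric] by (intro sum.cong refl) (simp add: ua)
    also have "\<dots> = (\<Sum>v\<in>V. \<Sum>w\<in>V. \<Sum>j<n. e j * u j v * u j w * (u i v * u i w))"
      by (simp only: sum_distrib_right)
    also have "\<dots> = (\<Sum>v\<in>V. \<Sum>j<n. \<Sum>w\<in>V. e j * u j v * u j w * (u i v * u i w))"
      by (rule sum.cong[OF refl], rule sum.swap)
    also have "\<dots> = (\<Sum>j<n. \<Sum>v\<in>V. \<Sum>w\<in>V. e j * u j v * u j w * (u i v * u i w))"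
      by (rule sum.swap)
    also have "\<dots> = (\<Sum>j<n. e j * ((\<Sum>v\<in>V. u i v * u j v) * (\<Sum>w\<in>V. u i w * u j w)))"
    proof (rule sum.cong[OF refl])
      fix j
      have "e j * ((\<Sum>v\<in>V. u i v * u j v) * (\<Sum>w\<in>V. u i w * u j w))
          = (\<Sum>v\<in>V. \<Sum>w\<in>V. e j * ((u i v * u j v) * (u i w * u j w)))"
        by (subst sum_product) (simp only: sum_distrib_left)
      thus "(\<Sum>v\<in>V. \<Sum>w\<in>V. e j * u j v * u j w * (u i v * u i w)) =
          e j * ((\<Sum>v\<in>V. u i v * u j v) * (\<Sum>w\<in>V. u i w * u j w))"
        by (simp add: mult_ac)
    qed
    also have "\<dots> = (\<Sum>j<n. if i = j then e i else 0)"
      by (intro sum.cong refl) (auto simp: uo i)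
    finally show ?thesis using i by simp
  qed
  have nu: "(\<Sum>v\<in>V. (u i v)\<^sup>2) = 1" if "i < n" for i
    using uo[OF that that] by (simp add: power2_eq_square)
  have e2: "e i \<le> 2" if "i < n" for i
    using le[of "u i"] form[OF that] nu[OF that] unfolding V_def by simp
  have all2: "e i = 2" if i: "i < k" for i
  proof (rule ccontr)
    assume "e i \<noteq> 2"
    hence "e i < 2" using e2[of i] i kn by simp
    hence "(\<Sum>i<k. e i) < (\<Sum>i<k. 2)" using i kn
      by (intro sum_strict_mono_ex1) (auto intro!: e2)
    thus False using S unfolding e_def by simp
  qed
  have "\<exists>c. \<forall>v\<in>V. u i v = c * h v" if "i < k" for i
    using eq[of "u i"] form[of i] nu[of i] all2[OF that] that kn unfolding V_def by simp
  from this[of 0] this[of 1] k obtain c d where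
    c: "\<And>v. v \<in> V \<Longrightarrow> u 0 v = c * h v" and d: "\<And>v. v \<in> V \<Longrightarrow> u (Suc 0) v = d * h v" by auto
  have n1: "0 < n" "Suc 0 < n" using k kn by auto
  have "c * d * (\<Sum>v\<in>V. (h v)\<^sup>2) = (\<Sum>v\<in>V. u 0 v * u (Suc 0) v)"
    by (simp add: c d sum_distrib_left power2_eq_square mult_ac)
  hence "c * d * (\<Sum>v\<in>V. (h v)\<^sup>2) = 0" using uo[of 0 "Suc 0"] n1 by simp
  moreover have "c\<^sup>2 * (\<Sum>v\<in>V. (h v)\<^sup>2) = 1" using nu[OF n1(1)] by (simp add: c sum_distrib_left power_mult_distrib)
  moreover have "d\<^sup>2 * (\<Sum>v\<in>V. (h v)\<^sup>2) = 1" using nu[OF n1(2)] by (simp add: d sum_distrib_left power_mult_distrib)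
  ultimately show False by auto
qed

text \<open>Writing f in units of \<open>h\<close> turns 2 |f|^2 - f^T A f into something that
  dominates half of a weighted sum of squares of differences of f/h along the arcs. So it is
  nonnegative, and if it vanishes then f/h is constant along edges and, by connectedness,
  everywhere.\<close>

lemma eigenvalue_sum_less_if_superharmonic:
  fixes h :: "'a \<Rightarrow> real"
  assumes G: "pair_graph G" and conn: "connected (with_proj G)" and k: "2 \<le> k" "k \<le> card (pverts G)"
    and pos: "\<And>v. v \<in> pverts G \<Longrightarrow> h v > 0"
    and sup: "\<And>v. v \<in> pverts G \<Longrightarrow> (\<Sum>w | (v, w) \<in> parcs G. h w) \<le> 2 * h v"
  shows "eigenvalue_sum k G < 2 * real k"
proof -
  interpret pair_graph G by fact
  define V where "V = pverts G"
  have fin: "finite V" unfolding V_def by simp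
  define E where "E = parcs G"
  have finE: "finite E" and EV: "E \<subseteq> V \<times> V" unfolding E_def V_def using wellformed' by auto
  have symE: "(w, v) \<in> E" if "(v, w) \<in> E" for v w using that arcs_symmetric unfolding E_def by blast
  have swap: "(\<Sum>(v, w)\<in>E. g v w) = (\<Sum>(v, w)\<in>E. g w v)" for g :: "'a \<Rightarrow> 'a \<Rightarrow> real"
    by (rule sum.reindex_bij_witness[of _ prod.swap prod.swap]) (auto intro: symE)
  have sos: "2 * (2 * (\<Sum>v\<in>V. (f v)\<^sup>2) - adj_form G f) \<ge> (\<Sum>(v, w)\<in>E. h v * h w * (f v / h v - f w / h w)\<^sup>2)" for f
  proof -
    \<comment> \<open>Completing the square: \<open>g v w\<close> and \<open>g w v\<close> are the
      diagonal terms of an arc, and superharmonicity bounds the sum of \<open>g v w\<close> over the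
      neighbours \<open>w\<close> by \<open>2 * (f v)\<^sup>2\<close>.\<close>
    define g where "g v w = h w / h v * (f v)\<^sup>2" for v w
    have "(\<Sum>(v, w)\<in>E. h v * h w * (f v / h v - f w / h w)\<^sup>2) = (\<Sum>(v, w)\<in>E. g v w + g w v - 2 * (f v * f w))"
    proof (rule sum.cong[OF refl], clarsimp)
      fix v w assume "(v, w) \<in> E"
      hence "h v > 0" "h w > 0" using EV pos unfolding V_def by auto
      thus "h v * h w * (f v / h v - f w / h w)\<^sup>2 = g v w + g w v - 2 * (f v * f w)"
        unfolding g_def by (simp add: field_simps power2_eq_square)
    qed
    also have "\<dots> = 2 * (\<Sum>(v, w)\<in>E. g v w) - 2 * adj_form G f"
      using swap[of g] unfolding adj_form_def E_def[symmetric]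
      by (simp add: case_prod_unfold sum.distrib sum_subtractf sum_distrib_left)
    also have "(\<Sum>(v, w)\<in>E. g v w) = (\<Sum>v\<in>V. \<Sum>w | (v, w) \<in> E. g v w)"
    proof -
      have "E = Sigma V (\<lambda>v. {w. (v, w) \<in> E})" using EV by auto
      moreover have "finite {w. (v, w) \<in> E}" for v
        by (rule finite_subset[OF _ fin]) (use EV in auto)
      ultimately show ?thesis using sum.Sigma[of V "\<lambda>v. {w. (v, w) \<in> E}" g] fin by simp
    qed
    also have "\<dots> \<le> (\<Sum>v\<in>V. 2 * (f v)\<^sup>2)"
    proof (rule sum_mono)
      fix v assume v: "v \<in> V"
      have "(\<Sum>w | (v, w) \<in> E. g v w) = (\<Sum>w | (v, w) \<in> E. h w) * ((f v)\<^sup>2 / h v)"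
        unfolding g_def sum_distrib_right by (simp add: field_simps)
      also have "\<dots> \<le> 2 * h v * ((f v)\<^sup>2 / h v)"
        using sup[of v] v pos[of v] unfolding V_def E_def by (intro mult_right_mono) auto
      finally show "(\<Sum>w | (v, w) \<in> E. g v w) \<le> 2 * (f v)\<^sup>2" using pos[of v] v unfolding V_def by simp
    qed
    finally show ?thesis by (simp add: sum_distrib_left)
  qed
  have t0: "h v * h w * (f v / h v - f w / h w)\<^sup>2 \<ge> 0" if "(v, w) \<in> E" for v w f
    using that EV pos[of v] pos[of w] unfolding V_def by auto
  show ?thesis
  proof (rule eigenvalue_sum_less_if_form_less[OF G k, of h])
    fix f
    have "0 \<le> (\<Sum>(v, w)\<in>E. h v * h w * (f v / h v - f w / h w)\<^sup>2)"
      by (rule sum_nonneg) (use t0 in auto)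
    with sos[of f] show "adj_form G f \<le> 2 * (\<Sum>v\<in>pverts G. (f v)\<^sup>2)" unfolding V_def by simp
  next
    fix f assume a: "adj_form G f = 2 * (\<Sum>v\<in>pverts G. (f v)\<^sup>2)"
    hence "(\<Sum>(v, w)\<in>E. h v * h w * (f v / h v - f w / h w)\<^sup>2) \<le> 0" using sos[of f] unfolding V_def by simp
    hence "(\<Sum>(v, w)\<in>E. h v * h w * (f v / h v - f w / h w)\<^sup>2) = 0"
      by (intro antisym sum_nonneg) (use t0 in auto)
    hence "\<forall>x\<in>E. (case x of (v, w) \<Rightarrow> h v * h w * (f v / h v - f w / h w)\<^sup>2) = 0"
      by (subst (asm) sum_nonneg_eq_0_iff[OF finE]) (use t0 in auto)
    hence edge: "f v / h v = f w / h w" if "(v, w) \<in> E" for v w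
      using that EV pos[of v] pos[of w] unfolding V_def by fastforce
    have sc: "strongly_connected (with_proj G)" using symmetric_connected_imp_strongly_connected[OF _ conn] sym_arcs by simp
    then obtain v0 where v0: "v0 \<in> V" unfolding strongly_connected_def V_def by auto
    have "f v = (f v0 / h v0) * h v" if v: "v \<in> pverts G" for v
    proof -
      have "v0 \<rightarrow>\<^sup>*\<^bsub>with_proj G\<^esub> v" using sc v v0 unfolding strongly_connected_def V_def by simp
      hence "f v0 / h v0 = f v / h v"
      proof (induct rule: reachable_induct)
        case (step x y) thus ?case using edge[of x y] unfolding E_def by simp
      qed simp
      thus ?thesis using pos[OF v] by (simp add: field_simps)
    qed
    thus "\<exists>c. \<forall>v\<in>pverts G. f v = c * h v" by blast
  qed
qed

section \<open>Rayleigh quotients of weighted subtrees\<close>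

text \<open>In other words, the subgraph induced by \<open>U\<close> has largest eigenvalue at least
  \<open>\<mu>\<close>. A test vector is demanded instead of an eigenvalue so that rounded explicit
  weights suffice as a witness.\<close>

definition carries :: "'a pair_pre_digraph \<Rightarrow> 'a set \<Rightarrow> real \<Rightarrow> bool" where
  "carries G U \<mu> \<longleftrightarrow> (\<exists>f :: 'a \<Rightarrow> real. (\<forall>v\<in>pverts G - U. f v = 0) \<and>
     (\<Sum>v\<in>pverts G. (f v)\<^sup>2) > 0 \<and> \<mu> * (\<Sum>v\<in>pverts G. (f v)\<^sup>2) \<le> adj_form G f)"

text \<open>Disjoint supports make the normalised vectors orthonormal. Edges between different
  supports do no harm, as Ky Fan's principle only involves the value of the form at each single
  vector.\<close>

lemma eigenvalue_sum_ge_if_carries: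
  assumes G: "pair_graph G" and k: "k \<le> card (pverts G)"
    and c: "\<And>i. i < k \<Longrightarrow> carries G (U i) (\<mu> i)"
    and disj: "\<And>i j. i < k \<Longrightarrow> j < k \<Longrightarrow> i \<noteq> j \<Longrightarrow> U i \<inter> U j = {}"
  shows "(\<Sum>i<k. \<mu> i) \<le> eigenvalue_sum k G"
proof -
  define nn where "nn f = (\<Sum>v\<in>pverts G. (f v)\<^sup>2)" for f :: "'a \<Rightarrow> real"
  have "\<exists>f. \<forall>i<k. (\<forall>v\<in>pverts G - U i. f i v = 0) \<and> nn (f i) > 0 \<and> \<mu> i * nn (f i) \<le> adj_form G (f i)"
    using c unfolding carries_def nn_def by metis
  then obtain f :: "nat \<Rightarrow> 'a \<Rightarrow> real" where
    f0: "\<And>i v. i < k \<Longrightarrow> v \<in> pverts G \<Longrightarrow> v \<notin> U i \<Longrightarrow> f i v = 0" and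
    f1: "\<And>i. i < k \<Longrightarrow> nn (f i) > 0" and
    f2: "\<And>i. i < k \<Longrightarrow> \<mu> i * nn (f i) \<le> adj_form G (f i)" by blast
  define g where "g i v = f i v / sqrt (nn (f i))" for i v
  have "(\<Sum>i<k. \<mu> i) \<le> (\<Sum>i<k. adj_form G (g i))"
  proof (rule sum_mono)
    fix i assume "i \<in> {..<k}"
    hence i: "i < k" by simp
    have "adj_form G (g i) = (\<Sum>(v, w)\<in>parcs G. (f i v * f i w) / nn (f i))"
      unfolding adj_form_def g_def using f1[OF i] by (intro sum.cong refl) auto
    also have "\<dots> = adj_form G (f i) / nn (f i)"
      unfolding adj_form_def by (simp add: case_prod_unfold sum_divide_distrib)
    finally show "\<mu> i \<le> adj_form G (g i)" using f1[OF i] f2[OF i] by (simp only: pos_le_divide_eq)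
  qed
  also have "\<dots> \<le> eigenvalue_sum k G"
  proof (rule eigenvalue_sum_ge_sum_adj_form[OF G k])
    fix i j assume i: "i < k" and j: "j < k"
    show "(\<Sum>v\<in>pverts G. g i v * g j v) = of_bool (i = j)"
    proof (cases "i = j")
      case True
      have "(\<Sum>v\<in>pverts G. g i v * g i v) = (\<Sum>v\<in>pverts G. (f i v)\<^sup>2 / nn (f i))"
        unfolding g_def using f1[OF i] by (intro sum.cong refl) (auto simp: power2_eq_square)
      also have "\<dots> = 1" using f1[OF i] unfolding sum_divide_distrib[symmetric] nn_def[symmetric] by simp
      finally show ?thesis using True by simp
    next
      case False
      have "g i v * g j v = 0" if "v \<in> pverts G" for v
        using f0[OF i that] f0[OF j that] disj[OF i j False] unfolding g_def by auto
      thus ?thesis using False by simp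
    qed
  qed
  finally show ?thesis .
qed

text \<open>\<open>p\<close> is a parent function, so the arcs between \<open>g i\<close> and
  \<open>g (p i)\<close> form a tree. Any other arcs among these vertices only raise the form
  because the weights are nonnegative; the tree need not be shown to be induced.\<close>

lemma carries_weights:
  fixes w :: "nat \<Rightarrow> real"
  assumes G: "pair_graph G" and inj: "inj_on g {..<N}" and gV: "\<And>i. i < N \<Longrightarrow> g i \<in> pverts G"
    and p: "\<And>i. i < N \<Longrightarrow> 0 < i \<Longrightarrow> p i < i"
    and arc: "\<And>i. i < N \<Longrightarrow> 0 < i \<Longrightarrow> (g i, g (p i)) \<in> parcs G"
    and w: "\<And>i. i < N \<Longrightarrow> w i \<ge> 0" and pos: "(\<Sum>i<N. (w i)\<^sup>2) > 0"
    and ineq: "\<mu> * (\<Sum>i<N. (w i)\<^sup>2) \<le> 2 * (\<Sum>i=1..<N. w i * w (p i))"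
  shows "carries G (g ` {..<N}) \<mu>"
proof -
  interpret pair_graph G by fact
  define f where "f v = (if v \<in> g ` {..<N} then w (the_inv_into {..<N} g v) else 0)" for v
  have fg: "f (g i) = w i" if "i < N" for i
    unfolding f_def using that inj by (simp add: the_inv_into_f_f)
  have f0: "f v \<ge> 0" for v
  proof (cases "v \<in> g ` {..<N}")
    case True then obtain i where "i < N" "v = g i" by auto
    thus ?thesis using fg w by simp
  qed (simp add: f_def)
  have sq: "(\<Sum>v\<in>pverts G. (f v)\<^sup>2) = (\<Sum>i<N. (w i)\<^sup>2)"
  proof -
    have "(\<Sum>v\<in>pverts G. (f v)\<^sup>2) = (\<Sum>v\<in>g ` {..<N}. (f v)\<^sup>2)"
      by (rule sum.mono_neutral_right) (auto simp: f_def gV)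
    also have "\<dots> = (\<Sum>i<N. (f (g i))\<^sup>2)" by (simp add: sum.reindex[OF inj])
    finally show ?thesis by (simp add: fg)
  qed
  have inj': "g i = g j \<longleftrightarrow> i = j" if "i < N" "j < N" for i j
    using inj that by (auto simp: inj_on_def)
  define D where "D = (\<lambda>i. (g i, g (p i))) ` {1..<N}"
  define D' where "D' = (\<lambda>i. (g (p i), g i)) ` {1..<N}"
  have pN: "p i < N" if "i \<in> {1..<N}" for i using p[of i] that by auto
  have "e \<notin> D'" if eD: "e \<in> D" for e
  proof
    assume "e \<in> D'"
    then obtain i j where ij: "i \<in> {1..<N}" "j \<in> {1..<N}" "g i = g (p j)" "g (p i) = g j"
      using eD unfolding D_def D'_def by auto
    hence "i = p j" "p i = j" using pN[of i] pN[of j] inj'[of i "p j"] inj'[of "p i" j] by auto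
    thus False using p[of i] p[of j] ij by auto
  qed
  hence dD: "D \<inter> D' = {}" by blast
  have injD: "inj_on (\<lambda>i. (g i, g (p i))) {1..<N}" "inj_on (\<lambda>i. (g (p i), g i)) {1..<N}"
    using inj' unfolding inj_on_def by auto
  have "f (g (p i)) = w (p i)" if "i \<in> {1..<N}" for i using fg pN[OF that] by simp
  hence sD: "(\<Sum>(v, u)\<in>D. f v * f u) = (\<Sum>i=1..<N. w i * w (p i))"
    and sD': "(\<Sum>(v, u)\<in>D'. f v * f u) = (\<Sum>i=1..<N. w i * w (p i))"
    unfolding D_def D'_def sum.reindex[OF injD(1)] sum.reindex[OF injD(2)]
    by (auto simp: fg mult.commute intro!: sum.cong)
  have DE: "D \<union> D' \<subseteq> parcs G"
  proof -
    have "(g i, g (p i)) \<in> parcs G" "(g (p i), g i) \<in> parcs G" if "i \<in> {1..<N}" for i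
      using arc[of i] arcs_symmetric that by auto
    thus ?thesis unfolding D_def D'_def by blast
  qed
  have "2 * (\<Sum>i=1..<N. w i * w (p i)) = (\<Sum>(v, u)\<in>D \<union> D'. f v * f u)"
    using sD sD' by (subst sum.union_disjoint[OF _ _ dD]) (auto simp: D_def D'_def)
  also have "\<dots> \<le> adj_form G f"
    unfolding adj_form_def by (rule sum_mono2[OF _ DE]) (auto simp: f0 intro!: mult_nonneg_nonneg)
  finally show ?thesis
    unfolding carries_def using ineq pos sq by (intro exI[of _ f]) (auto simp: f_def)
qed

definition simple_path :: "'a pair_pre_digraph \<Rightarrow> 'a list \<Rightarrow> bool" where
  "simple_path G ys \<longleftrightarrow> distinct ys \<and> set ys \<subseteq> pverts G \<and> successively (\<lambda>u v. (u, v) \<in> parcs G) ys"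

lemma simple_path_nth: "simple_path G ys \<Longrightarrow> Suc i < length ys \<Longrightarrow> (ys ! i, ys ! Suc i) \<in> parcs G"
  unfolding simple_path_def successively_conv_nth by blast

text \<open>The vector \<open>sin (j \<theta>)\<close> is an eigenvector of the path for the eigenvalue \<open>2 cos \<theta>\<close> if \<open>\<theta> = pi / (N + 1)\<close>.\<close>

lemma sum_sin_consecutive:
  "2 * cos \<theta> * (\<Sum>i<Suc N. (sin (real (Suc i) * \<theta>))\<^sup>2)
     = 2 * (\<Sum>i=1..<Suc N. sin (real (Suc i) * \<theta>) * sin (real i * \<theta>))
       + sin (real (Suc N) * \<theta>) * sin (real (Suc (Suc N)) * \<theta>)"
proof (induct N)
  case 0
  have "sin (2 * \<theta>) = 2 * sin \<theta> * cos \<theta>" by (rule sin_double)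
  thus ?case by (simp add: power2_eq_square)
next
  case (Suc N)
  have 1: "sin (real (Suc (Suc (Suc N))) * \<theta>) + sin (real (Suc N) * \<theta>)
      = 2 * cos \<theta> * sin (real (Suc (Suc N)) * \<theta>)"
  proof -
    have "real (Suc (Suc (Suc N))) * \<theta> = real (Suc (Suc N)) * \<theta> + \<theta>"
      "real (Suc N) * \<theta> = real (Suc (Suc N)) * \<theta> - \<theta>" by (simp_all add: algebra_simps)
    thus ?thesis by (simp add: sin_add sin_diff)
  qed
  define a b c where "a = sin (real (Suc N) * \<theta>)" and "b = sin (real (Suc (Suc N)) * \<theta>)"
    and "c = sin (real (Suc (Suc (Suc N))) * \<theta>)"
  have "2 * cos \<theta> * (\<Sum>i<Suc (Suc N). (sin (real (Suc i) * \<theta>))\<^sup>2)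
      = 2 * cos \<theta> * (\<Sum>i<Suc N. (sin (real (Suc i) * \<theta>))\<^sup>2) + 2 * cos \<theta> * b * b"
    unfolding b_def by (simp add: algebra_simps power2_eq_square)
  also have "2 * cos \<theta> * b * b = (c + a) * b" using 1 unfolding a_def b_def c_def by simp
  finally have "2 * cos \<theta> * (\<Sum>i<Suc (Suc N). (sin (real (Suc i) * \<theta>))\<^sup>2) =
     2 * (\<Sum>i=1..<Suc N. sin (real (Suc i) * \<theta>) * sin (real i * \<theta>)) + a * b + (c + a) * b"
    unfolding Suc.hyps a_def b_def by simp
  moreover have "(\<Sum>i=1..<Suc (Suc N). sin (real (Suc i) * \<theta>) * sin (real i * \<theta>))
      = (\<Sum>i=1..<Suc N. sin (real (Suc i) * \<theta>) * sin (real i * \<theta>)) + b * a"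
    unfolding a_def b_def by simp
  ultimately show ?case unfolding a_def[symmetric] b_def[symmetric] c_def[symmetric]
    by (simp add: algebra_simps)
qed

text \<open>The sine vector is positive on the path, and for this angle the identity for sums of
  sines has no boundary term, so the quotient is exactly 2 cos \<theta>.\<close>

lemma carries_simple_path:
  assumes G: "pair_graph G" and ys: "simple_path G ys" "ys \<noteq> []"
  shows "carries G (set ys) (2 * cos (pi / (real (length ys) + 1)))"
proof -
  interpret pair_graph G by fact
  define N where "N = length ys"
  obtain M where M: "N = Suc M" using ys(2) unfolding N_def by (cases ys) auto
  define \<theta> where "\<theta> = pi / (real N + 1)"
  define w where "w i = sin (real (Suc i) * \<theta>)" for i
  have wpos: "w i > 0" if "i < N" for i
  proof -
    have "real (Suc i) * \<theta> < pi" using that unfolding \<theta>_def by (simp add: field_simps)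
    moreover have "real (Suc i) * \<theta> > 0" unfolding \<theta>_def by simp
    ultimately show ?thesis unfolding w_def by (intro sin_gt_zero)
  qed
  have "sin (real (Suc (Suc M)) * \<theta>) = 0"
  proof -
    have "real (Suc (Suc M)) * \<theta> = pi" unfolding \<theta>_def M by (simp add: field_simps)
    thus ?thesis by (simp only: sin_pi)
  qed
  hence "2 * cos \<theta> * (\<Sum>i<N. (w i)\<^sup>2) = 2 * (\<Sum>i=1..<N. w i * w (i - 1))"
    using sum_sin_consecutive[of \<theta> M] unfolding M w_def
    by (auto intro!: sum.cong)
  moreover have "(\<Sum>i<N. (w i)\<^sup>2) > 0"
  proof (rule sum_pos)
    show "(w i)\<^sup>2 > 0" if "i \<in> {..<N}" for i using wpos[of i] that by (simp only: lessThan_iff zero_less_power)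
  qed (use M in auto)
  ultimately have "carries G ((!) ys ` {..<N}) (2 * cos \<theta>)"
  proof (intro carries_weights[OF G, where p = "\<lambda>i. i - 1" and w = w])
    show "inj_on ((!) ys) {..<N}" using ys(1) unfolding simple_path_def N_def by (auto simp: inj_on_nth)
    show "(ys ! i, ys ! (i - 1)) \<in> parcs G" if "i < N" "0 < i" for i
      using simple_path_nth[OF ys(1), of "i - 1"] that arcs_symmetric unfolding N_def by auto
    show "ys ! i \<in> pverts G" if "i < N" for i
      using ys(1) that unfolding simple_path_def N_def by auto
  qed (use wpos in \<open>auto intro: less_imp_le\<close>)
  moreover have "(!) ys ` {..<N} = set ys" unfolding N_def by (auto simp: in_set_conv_nth)
  ultimately show ?thesis unfolding \<theta>_def N_def by simp
qed

text \<open>Half of the quadratic form of a path with these weights, in recursive form so that it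
  evaluates on literal lists.\<close>

fun cons_prods :: "'b :: comm_semiring_1 list \<Rightarrow> 'b" where
  "cons_prods (x # y # zs) = x * y + cons_prods (y # zs)"
| "cons_prods _ = 0"

definition sum_squares :: "'b :: comm_semiring_1 list \<Rightarrow> 'b" where
  "sum_squares xs = (\<Sum>x\<leftarrow>xs. x\<^sup>2)"

lemma cons_prods_conv_sum: "cons_prods xs = (\<Sum>i=1..<length xs. xs ! i * xs ! (i - 1))"
proof -
  have "cons_prods xs = (\<Sum>i<length xs - 1. xs ! i * xs ! Suc i)"
    by (induct xs rule: cons_prods.induct) (simp_all add: sum.lessThan_Suc_shift del: sum.lessThan_Suc)
  also have "\<dots> = (\<Sum>i=1..<length xs. xs ! i * xs ! (i - 1))"
    by (rule sum.reindex_bij_witness[of _ "\<lambda>i. i - 1" Suc]) (auto simp: mult.commute)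
  finally show ?thesis .
qed

text \<open>
  The tree has the path \<open>ys\<close> and further vertices \<open>zs\<close>, where \<open>zs ! j\<close> is joined to entry number \<open>es ! j\<close>
  of \<open>ys @ zs\<close>; its vertices have the weights \<open>as @ bs\<close>.
\<close>

lemma carries_caterpillar:
  fixes as bs :: "nat list"
  assumes G: "pair_graph G" and ys: "simple_path G ys" and zs: "distinct zs" "set zs \<subseteq> pverts G"
    and disj: "set ys \<inter> set zs = {}" and la: "length as = length ys" and lb: "length bs = length zs"
    and le: "length es = length zs"
    and arc: "\<And>j. j < length zs \<Longrightarrow> es ! j < length ys + j \<and> (zs ! j, (ys @ zs) ! (es ! j)) \<in> parcs G"
    and pos: "0 < sum_squares as" and den: "0 < d"
    and ineq: "m * (sum_squares as + sum_squares bs)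
       \<le> 2 * d * (cons_prods as + (\<Sum>j<length es. bs ! j * (as @ bs) ! (es ! j)))"
  shows "carries G (set ys \<union> set zs) (real m / real d)"
proof -
  interpret pair_graph G by fact
  define L where "L = length ys"
  define N where "N = L + length zs"
  define w where "w i = real ((as @ bs) ! i)" for i
  define p where "p i = (if i < L then i - 1 else es ! (i - L))" for i
  define g where "g i = (ys @ zs) ! i" for i
  have sq: "(\<Sum>i<N. (w i)\<^sup>2) = real (sum_squares as + sum_squares bs)"
  proof -
    have "sum_squares as + sum_squares bs = sum_list (map (\<lambda>x. x\<^sup>2) (as @ bs))"
      unfolding sum_squares_def by simp
    also have "\<dots> = (\<Sum>i<N. ((as @ bs) ! i)\<^sup>2)"
      unfolding sum_list_sum_nth by (intro sum.cong) (auto simp: N_def L_def la lb nth_append)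
    finally show ?thesis unfolding w_def by simp
  qed
  have L0: "L > 0" using pos la unfolding L_def sum_squares_def by (cases ys) auto
  have pr: "(\<Sum>i=1..<N. w i * w (p i)) = real (cons_prods as + (\<Sum>j<length es. bs ! j * (as @ bs) ! (es ! j)))"
  proof -
    have "{1..<N} = {1..<L} \<union> {L..<N}" using L0 unfolding N_def by auto
    hence "(\<Sum>i=1..<N. w i * w (p i)) = (\<Sum>i=1..<L. w i * w (p i)) + (\<Sum>i=L..<N. w i * w (p i))"
      by (simp add: sum.union_disjoint)
    also have "(\<Sum>i=1..<L. w i * w (p i)) = real (cons_prods as)"
      unfolding cons_prods_conv_sum la L_def[symmetric] of_nat_sum
      by (intro sum.cong) (auto simp: w_def p_def nth_append la L_def[symmetric])
    also have "(\<Sum>i=L..<N. w i * w (p i)) = (\<Sum>j<length es. w (j + L) * w (p (j + L)))"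
      by (rule sum.reindex_bij_witness[of _ "\<lambda>j. j + L" "\<lambda>i. i - L"]) (auto simp: N_def le)
    also have "\<dots> = real (\<Sum>j<length es. bs ! j * (as @ bs) ! (es ! j))"
      unfolding of_nat_sum by (intro sum.cong) (auto simp: w_def p_def nth_append la L_def[symmetric])
    finally show ?thesis by simp
  qed
  have d': "distinct (ys @ zs)" "set (ys @ zs) \<subseteq> pverts G" using ys zs disj unfolding simple_path_def by auto
  have len: "length (ys @ zs) = N" unfolding N_def L_def by simp
  have "carries G (g ` {..<N}) (real m / real d)"
  proof (rule carries_weights[OF G, where w = w and p = p])
    show "inj_on g {..<N}" using d'(1) len unfolding g_def by (auto simp: inj_on_def nth_eq_iff_index_eq)
    show "g i \<in> pverts G" if "i < N" for i using d'(2) that len unfolding g_def by (metis nth_mem subsetD)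
    show "p i < i" if "i < N" "0 < i" for i
      using that arc[of "i - L"] unfolding p_def N_def L_def by auto
    show "(g i, g (p i)) \<in> parcs G" if "i < N" "0 < i" for i
    proof (cases "i < L")
      case True
      thus ?thesis using simple_path_nth[OF ys, of "i - 1"] that arcs_symmetric
        unfolding g_def p_def L_def by (auto simp: nth_append)
    next
      case False
      thus ?thesis using arc[of "i - L"] that unfolding g_def p_def N_def L_def by (simp add: nth_append)
    qed
    show "w i \<ge> 0" for i unfolding w_def by simp
    show "(\<Sum>i<N. (w i)\<^sup>2) > 0" unfolding sq using pos by simp
    have "real m * real (sum_squares as + sum_squares bs)
       \<le> 2 * real d * real (cons_prods as + (\<Sum>j<length es. bs ! j * (as @ bs) ! (es ! j)))"
      using ineq by (metis (mono_tags, lifting) of_nat_mono of_nat_mult of_nat_numeral)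
    thus "real m / real d * (\<Sum>i<N. (w i)\<^sup>2) \<le> 2 * (\<Sum>i=1..<N. w i * w (p i))"
      unfolding sq pr using den by (simp add: field_simps)
  qed
  moreover have "g ` {..<N} = set (ys @ zs)" unfolding g_def len[symmetric] by (auto simp: set_conv_nth simp del: set_append)
  ultimately show ?thesis by simp
qed

section \<open>Trees with a very long path\<close>

text \<open>The path is cut into blocks of \<open>r\<close> vertices. A window of \<open>r\<close>
  positions meets at most two consecutive blocks, so \<open>j\<close> pieces spoil at most
  \<open>2 * j\<close> of at least \<open>k + j\<close> blocks and leave \<open>k - j\<close> of
  them for the other vectors. Only the trace of a piece on the path has to be located: what lies off
  the path meets no block.\<close>

lemma eigenvalue_sum_ge_pieces:
  assumes G: "pair_graph G" and xs: "simple_path G xs" and r: "0 < r" and jk: "j \<le> k"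
    and long: "k + j \<le> length xs div r"
    and c: "\<And>i. i < j \<Longrightarrow> carries G (U i) (\<mu> i)"
    and disj: "\<And>i i'. i < j \<Longrightarrow> i' < j \<Longrightarrow> i \<noteq> i' \<Longrightarrow> U i \<inter> U i' = {}"
    and loc: "\<And>i l. i < j \<Longrightarrow> l < length xs \<Longrightarrow> xs ! l \<in> U i \<Longrightarrow> a i \<le> l \<and> l < a i + r"
  shows "(\<Sum>i<j. \<mu> i) + real (k - j) * (2 * cos (pi / (real r + 1))) \<le> eigenvalue_sum k G"
proof -
  interpret pair_graph G by fact
  define blk where "blk t = map ((!) xs) [t * r..<Suc t * r]" for t
  define T where "T = {..<length xs div r}"
  define bad where "bad = (\<Union>i<j. {a i div r, Suc (a i div r)})"
  have dist: "distinct xs" "set xs \<subseteq> pverts G" using xs unfolding simple_path_def by auto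
  have tl: "Suc t * r \<le> length xs" if "t \<in> T" for t
  proof -
    have "Suc t * r \<le> (length xs div r) * r" using that unfolding T_def by (intro mult_le_mono1) simp
    also have "\<dots> \<le> length xs" by (rule div_times_less_eq_dividend)
    finally show ?thesis .
  qed
  have blk_set: "set (blk t) = (!) xs ` {t * r..<Suc t * r}" for t unfolding blk_def by simp
  have blk_path: "simple_path G (blk t)" if "t \<in> T" for t
  proof -
    note l = tl[OF that]
    have "distinct (blk t)" using dist(1) l unfolding blk_def
      by (auto simp: distinct_map inj_on_def nth_eq_iff_index_eq)
    moreover have "set (blk t) \<subseteq> pverts G" using dist(2) l unfolding blk_set by (auto intro!: subsetD[OF dist(2)])
    moreover have "(blk t ! i, blk t ! Suc i) \<in> parcs G" if "Suc i < length (blk t)" for i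
      using simple_path_nth[OF xs, of "t * r + i"] l that unfolding blk_def by simp
    ultimately show ?thesis unfolding simple_path_def successively_conv_nth by blast
  qed
  have blk_len: "length (blk t) = r" for t unfolding blk_def by simp
  have blk_disj: "set (blk t) \<inter> set (blk t') = {}" if tt: "t \<in> T" "t' \<in> T" "t \<noteq> t'" for t t'
  proof -
    have "t = l div r" if "l \<in> {t * r..<Suc t * r}" for l t
      using that by (metis atLeastLessThan_iff div_nat_eqI mult.commute)
    moreover have "l = l'" if "l \<in> {t * r..<Suc t * r}" "l' \<in> {t' * r..<Suc t' * r}" "xs ! l = xs ! l'" for l l'
      using that tl[OF tt(1)] tl[OF tt(2)] dist(1) by (auto simp: nth_eq_iff_index_eq)
    ultimately show ?thesis using tt(3) unfolding blk_set by blast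
  qed
  have blk_U: "set (blk t) \<inter> U i = {}" if t: "t \<in> T" "t \<notin> bad" and i: "i < j" for t i
  proof -
    have False if l: "l \<in> {t * r..<Suc t * r}" "xs ! l \<in> U i" for l
    proof -
      have al: "a i \<le> l" "l < a i + r" using loc[OF i _ l(2)] l(1) tl[OF t(1)] by auto
      have lt: "l div r = t" using l(1) by (metis atLeastLessThan_iff div_nat_eqI mult.commute)
      have "a i div r \<le> t" using al(1) lt div_le_mono by blast
      moreover have "t \<le> Suc (a i div r)"
        using div_le_mono[of l "a i + r" r] al(2) lt r by (simp add: div_add_self2)
      ultimately have "t = a i div r \<or> t = Suc (a i div r)" by linarith
      thus False using t(2) i unfolding bad_def by auto
    qed
    thus ?thesis unfolding blk_set by blast
  qed
  have "card bad \<le> (\<Sum>i<j. card {a i div r, Suc (a i div r)})" unfolding bad_def by (rule card_UN_le) simp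
  also have "\<dots> \<le> (\<Sum>i<j. 2)" by (rule sum_mono) (simp add: card_insert_le_m1)
  finally have cb: "card bad \<le> 2 * j" by simp
  have "finite bad" unfolding bad_def by auto
  hence "card (T - bad) \<ge> card T - card bad" by (simp add: diff_card_le_card_Diff)
  hence "k - j \<le> card (T - bad)" using cb long jk unfolding T_def by simp
  moreover have "finite (T - bad)" unfolding T_def by simp
  ultimately obtain s where s: "inj_on s {..<k - j}" "s ` {..<k - j} \<subseteq> T - bad"
    using card_le_inj[of "{..<k - j}" "T - bad"] by auto
  define W where "W i = (if i < j then U i else set (blk (s (i - j))))" for i
  define \<nu> where "\<nu> i = (if i < j then \<mu> i else 2 * cos (pi / (real r + 1)))" for i
  have sT: "s (i - j) \<in> T" "s (i - j) \<notin> bad" if "i < k" "\<not> i < j" for i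
  proof -
    have "i - j \<in> {..<k - j}" using that by auto
    thus "s (i - j) \<in> T" "s (i - j) \<notin> bad" using s(2) by blast+
  qed
  have kc: "k \<le> card (pverts G)"
  proof -
    have "k \<le> length xs div r" using long by simp
    also have "\<dots> \<le> length xs" by simp
    also have "\<dots> = card (set xs)" using dist(1) distinct_card by metis
    also have "\<dots> \<le> card (pverts G)" by (rule card_mono) (use dist in auto)
    finally show ?thesis .
  qed
  have "(\<Sum>i<k. \<nu> i) \<le> eigenvalue_sum k G"
  proof (rule eigenvalue_sum_ge_if_carries[OF G kc, of W])
    fix i assume i: "i < k"
    show "carries G (W i) (\<nu> i)"
    proof (cases "i < j")
      case True thus ?thesis using c unfolding W_def \<nu>_def by simp
    next
      case False
      have "blk (s (i - j)) \<noteq> []" using blk_len[of "s (i - j)"] r by auto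
      from carries_simple_path[OF G blk_path[OF sT(1)[OF i False]] this]
      show ?thesis using False unfolding W_def \<nu>_def by (simp add: blk_len)
    qed
  next
    fix i i' assume i: "i < k" "i' < k" "i \<noteq> i'"
    have "s (i - j) \<noteq> s (i' - j)" if "\<not> i < j" "\<not> i' < j"
    proof -
      have "i - j < k - j" "i' - j < k - j" "i - j \<noteq> i' - j" using i that by linarith+
      thus ?thesis using inj_onD[OF s(1), of "i - j" "i' - j"] by auto
    qed
    thus "W i \<inter> W i' = {}"
      using disj[of i i'] i blk_U[OF sT[OF i(1)], of i'] blk_U[OF sT[OF i(2)], of i]
        blk_disj[OF sT(1)[OF i(1)] sT(1)[OF i(2)]]
      unfolding W_def by (auto split: if_splits)
  qed
  moreover have "(\<Sum>i<k. \<nu> i) = (\<Sum>i<j. \<mu> i) + real (k - j) * (2 * cos (pi / (real r + 1)))"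
  proof -
    have "(\<Sum>i<k. \<nu> i) = (\<Sum>i<j. \<nu> i) + (\<Sum>i=j..<k. \<nu> i)"
      unfolding lessThan_atLeast0 using jk by (simp add: sum.atLeastLessThan_concat)
    thus ?thesis unfolding \<nu>_def by simp
  qed
  ultimately show ?thesis by simp
qed

text \<open>The only form in which acyclicity is used below: the arc would close the path to a cycle
  with \<open>length ys\<close> arcs.\<close>

lemma tree_no_chord:
  assumes T: "tree_graph G" and ys: "simple_path G ys" and l: "3 \<le> length ys"
  shows "(last ys, hd ys) \<notin> parcs G"
proof
  assume a: "(last ys, hd ys) \<in> parcs G"
  have G: "pair_graph G" using T unfolding tree_graph_def by simp
  interpret pair_graph G by fact
  define arcs_of where "arcs_of = (\<lambda>zs :: 'a list. zip zs (tl zs))"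
  have walk: "awalk (hd zs) (arcs_of zs) (last zs) \<and> pawalk_verts (hd zs) (arcs_of zs) = zs"
    if "zs \<noteq> []" "set zs \<subseteq> pverts G" "successively (\<lambda>u v. (u, v) \<in> parcs G) zs" for zs
    using that
  proof (induct zs rule: induct_list012)
    case (3 x y zs)
    hence "awalk y (arcs_of (y # zs)) (last (y # zs)) \<and> pawalk_verts y (arcs_of (y # zs)) = y # zs" by simp
    moreover have "arcs_of (x # y # zs) = (x, y) # arcs_of (y # zs)" unfolding arcs_of_def by simp
    ultimately show ?case using 3(4,5) by (simp add: awalk_Cons_iff)
  qed (auto simp: arcs_of_def awalk_Nil_iff)
  have ne: "ys \<noteq> []" using l by auto
  define c where "c = arcs_of (ys @ [hd ys])"
  have "successively (\<lambda>u v. (u, v) \<in> parcs G) (ys @ [hd ys])"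
    using ys a ne unfolding simple_path_def by (simp add: successively_append_iff)
  moreover have "hd ys \<in> pverts G" using hd_in_set[OF ne] ys unfolding simple_path_def by blast
  ultimately have w: "awalk (hd ys) c (hd ys)" "pawalk_verts (hd ys) c = ys @ [hd ys]"
    using walk[of "ys @ [hd ys]"] ne ys unfolding c_def simple_path_def by (auto simp: hd_append)
  have "distinct (tl (ys @ [hd ys]))"
    using ys ne unfolding simple_path_def by (cases ys) auto
  moreover have lc: "length c = length ys" using ne unfolding c_def arcs_of_def by simp
  moreover have "c \<noteq> []" using lc l by auto
  ultimately have "cycle c" unfolding cycle_def using w by auto
  thus False using T lc l unfolding tree_graph_def by auto
qed

lemma eta_less: "eta + 12 / 100000 < 20583 / 10000"
proof -
  have "sqrt 5 < 22361 / 10000" by (rule real_less_lsqrt) (auto simp: power2_eq_square)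
  hence "2 + sqrt 5 < (205818 / 100000)\<^sup>2" by (simp add: power2_eq_square)
  hence "eta < 205818 / 100000" unfolding eta_def by (intro real_less_lsqrt) auto
  thus ?thesis by simp
qed

text \<open>
  The bounds \<open>2.0583\<close> and \<open>4.0583\<close> below exceed \<open>\<eta> + 2\<epsilon>\<close> and \<open>2 + \<eta> + 2\<epsilon>\<close>, where \<open>\<epsilon> = 0.00006\<close>.
\<close>

locale long_spine =
  fixes G :: "'a pair_pre_digraph" and k r :: nat and xs :: "'a list"
  assumes tree: "tree_graph G" and k2: "2 \<le> k"
    and small: "eigenvalue_sum k G < 2 * real k + eta - 2"
    and r100: "100 \<le> r"
    and block: "2 * real (k - 1) - 12 / 100000 \<le> real (k - 1) * (2 * cos (pi / (real r + 1)))"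
    and path: "simple_path G xs"
    and longest: "\<And>ys. simple_path G ys \<Longrightarrow> length ys \<le> length xs"
    and long: "(k + 2) * r \<le> length xs"
begin

lemma graph: "pair_graph G" using tree unfolding tree_graph_def by simp

sublocale pair_graph G by (rule graph)

lemma dist: "distinct xs" and verts: "set xs \<subseteq> pverts G" using path unfolding simple_path_def by auto

lemma long': "400 \<le> length xs"
proof -
  have "4 * 100 \<le> (k + 2) * r" using k2 r100 by (intro mult_mono) auto
  thus ?thesis using long by simp
qed

lemma long_div:
  assumes "j \<le> 2"
  shows "k + j \<le> length xs div r"
proof -
  have "(k + j) * r \<le> (k + 2) * r" using assms by (intro mult_le_mono1) simp
  hence "(k + j) * r \<le> length xs" using long by simp
  thus ?thesis using r100 by (simp add: less_eq_div_iff_mult_less_eq)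
qed

text \<open>The assumptions do not distinguish the two ends of the path, so every fact about one end
  holds for the other.\<close>

lemma long_spine_rev: "long_spine G k r (rev xs)"
proof
  show "simple_path G (rev xs)" using path arcs_symmetric unfolding simple_path_def
    by (auto simp: successively_rev elim!: successively_mono)
qed (use tree k2 small r100 block longest long in auto)

text \<open>The piece and \<open>k - 1\<close> blocks together would give more than \<eta> + 0.00012
  + 2(k - 1) - 0.00012 = 2k + \<eta> - 2.\<close>

lemma no_piece:
  assumes "carries G U m" "20583 / 10000 \<le> m"
    and loc: "\<And>l. l < length xs \<Longrightarrow> xs ! l \<in> U \<Longrightarrow> a \<le> l \<and> l < a + 100"
  shows False
proof -
  have trace: "a \<le> l \<and> l < a + r" if "l < length xs" "xs ! l \<in> U" for l
    using loc[OF that] r100 by simp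
  have "(\<Sum>i<1::nat. m) + real (k - 1) * (2 * cos (pi / (real r + 1))) \<le> eigenvalue_sum k G"
    by (rule eigenvalue_sum_ge_pieces[OF graph path, where U = "\<lambda>_. U" and a = "\<lambda>_. a"])
      (use assms(1) trace r100 k2 long_div[of 1] in auto)
  thus False using small block eta_less assms(2) k2 by (auto simp: of_nat_diff)
qed

lemma no_two_pieces:
  assumes "carries G U m" "carries G W m'" "40583 / 10000 \<le> m + m'" and UW: "U \<inter> W = {}"
    and locU: "\<And>l. l < length xs \<Longrightarrow> xs ! l \<in> U \<Longrightarrow> a \<le> l \<and> l < a + 100"
    and locW: "\<And>l. l < length xs \<Longrightarrow> xs ! l \<in> W \<Longrightarrow> b \<le> l \<and> l < b + 100"
  shows False
proof -
  have "(\<Sum>i<2::nat. if i = 0 then m else m') + real (k - 2) * (2 * cos (pi / (real r + 1))) \<le> eigenvalue_sum k G"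
  proof (rule eigenvalue_sum_ge_pieces[OF graph path,
        where U = "\<lambda>i. if i = (0::nat) then U else W" and a = "\<lambda>i. if i = 0 then a else b"])
    show "k + 2 \<le> length xs div r" by (rule long_div) simp
    fix i l :: nat assume il: "i < 2" "l < length xs" "xs ! l \<in> (if i = 0 then U else W)"
    show "(if i = 0 then a else b) \<le> l \<and> l < (if i = 0 then a else b) + r"
      using il locU[of l] locW[of l] r100 by (auto split: if_splits)
  qed (use assms(1,2) UW r100 k2 in \<open>auto simp: less_2_cases_iff\<close>)
  moreover have "(\<Sum>i<2::nat. if i = 0 then m else m') = m + m'" by (simp add: numeral_2_eq_2)
  \<comment> \<open>The assumption \<open>block\<close> speaks of \<open>k - 1\<close> blocks, but
    two pieces leave \<open>k - 2\<close>. The block in excess accounts for at most 2.\<close>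
  moreover have "real (k - 2) * (2 * cos (pi / (real r + 1)))
      = real (k - 1) * (2 * cos (pi / (real r + 1))) - 2 * cos (pi / (real r + 1))"
    using k2 by (simp add: of_nat_diff algebra_simps)
  moreover have "2 * cos (pi / (real r + 1)) \<le> 2" by simp
  moreover have "real (k - 1) = real k - 1" using k2 by (simp add: of_nat_diff)
  ultimately show False using small block eta_less assms(3) by linarith
qed

end

section \<open>Forbidden configurations\<close>

text \<open>\<open>m\<close> is the quotient in units of 1/10000; the factor 20000 also contains the
  2 that counts every edge in both directions.\<close>

lemma leaf_piece:
  fixes as :: "nat list"
  assumes G: "pair_graph G" and ys: "simple_path G ys" and w: "w \<in> pverts G" "w \<notin> set ys"
    and i: "i < length ys" "(w, ys ! i) \<in> parcs G" and la: "length as = length ys"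
    and pos: "0 < sum_squares as"
    and ineq: "m * (sum_squares as + b\<^sup>2) \<le> 20000 * (cons_prods as + b * as ! i)"
  shows "carries G (set ys \<union> {w}) (real m / 10000)"
proof -
  have "carries G (set ys \<union> set [w]) (real m / real 10000)"
    by (rule carries_caterpillar[OF G ys, where as = as and bs = "[b]" and es = "[i]"])
      (use w i la pos ineq in \<open>auto simp: nth_append sum_squares_def\<close>)
  thus ?thesis by simp
qed

lemma two_leaves_piece:
  fixes as :: "nat list"
  assumes G: "pair_graph G" and ys: "simple_path G ys" and w: "w \<in> pverts G" "w \<notin> set ys"
    and w': "w' \<in> pverts G" "w' \<notin> set ys" "w \<noteq> w'"
    and i: "i < length ys" "(w, ys ! i) \<in> parcs G" and j: "j < length ys" "(w', ys ! j) \<in> parcs G"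
    and la: "length as = length ys" and pos: "0 < sum_squares as"
    and ineq: "m * (sum_squares as + b\<^sup>2 + c\<^sup>2) \<le> 20000 * (cons_prods as + b * as ! i + c * as ! j)"
  shows "carries G (set ys \<union> {w, w'}) (real m / 10000)"
proof -
  have "carries G (set ys \<union> set [w, w']) (real m / real 10000)"
    by (rule carries_caterpillar[OF G ys, where as = as and bs = "[b, c]" and es = "[i, j]"])
      (use w w' i j la pos ineq in \<open>auto simp: nth_append sum_squares_def nth_Cons' less_Suc_eq numeral_2_eq_2 algebra_simps\<close>)
  thus ?thesis by simp
qed

lemma long_branch_piece:
  fixes as :: "nat list"
  assumes G: "pair_graph G" and ys: "simple_path G ys" and w: "w \<in> pverts G" "w \<notin> set ys"
    and u: "u \<in> pverts G" "u \<notin> set ys" "u \<noteq> w" "(u, w) \<in> parcs G"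
    and i: "i < length ys" "(w, ys ! i) \<in> parcs G"
    and la: "length as = length ys" and pos: "0 < sum_squares as"
    and ineq: "m * (sum_squares as + b\<^sup>2 + c\<^sup>2) \<le> 20000 * (cons_prods as + b * as ! i + c * b)"
  shows "carries G (set ys \<union> {w, u}) (real m / 10000)"
proof -
  have "carries G (set ys \<union> set [w, u]) (real m / real 10000)"
    \<comment> \<open>\<open>length ys\<close> is the index of \<open>w\<close> in
      \<open>ys @ [w, u]\<close>, so \<open>u\<close> hangs on \<open>w\<close>.\<close>
    by (rule carries_caterpillar[OF G ys, where as = as and bs = "[b, c]" and es = "[i, length ys]"])
      (use w u i la pos ineq in \<open>auto simp: nth_append sum_squares_def nth_Cons' less_Suc_eq numeral_2_eq_2 algebra_simps\<close>)
  thus ?thesis by simp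
qed

context long_spine begin

definition seg :: "nat \<Rightarrow> nat \<Rightarrow> 'a list" where
  "seg a b = map ((!) xs) [a..<b]"

lemma length_seg [simp]: "length (seg a b) = b - a" unfolding seg_def by simp

lemma nth_seg [simp]: "i < b - a \<Longrightarrow> seg a b ! i = xs ! (a + i)" unfolding seg_def by simp

lemma set_seg: "set (seg a b) = (!) xs ` {a..<b}" unfolding seg_def by simp

lemma nth_eq: "i < length xs \<Longrightarrow> j < length xs \<Longrightarrow> xs ! i = xs ! j \<longleftrightarrow> i = j"
  using dist by (simp add: nth_eq_iff_index_eq)

lemma seg_path: "b \<le> length xs \<Longrightarrow> simple_path G (seg a b)"
proof -
  assume b: "b \<le> length xs"
  have "distinct (seg a b)" unfolding seg_def using b by (auto simp: distinct_map inj_on_def nth_eq)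
  moreover have "set (seg a b) \<subseteq> pverts G" unfolding set_seg using verts b by auto
  moreover have "(seg a b ! i, seg a b ! Suc i) \<in> parcs G" if "Suc i < length (seg a b)" for i
    using simple_path_nth[OF path, of "a + i"] that b by simp
  ultimately show ?thesis unfolding simple_path_def successively_conv_nth by blast
qed

lemma mem_seg: "l < length xs \<Longrightarrow> b \<le> length xs \<Longrightarrow> xs ! l \<in> set (seg a b) \<longleftrightarrow> a \<le> l \<and> l < b"
  unfolding set_seg by (auto simp: nth_eq)

lemma seg_disj: "b \<le> c \<Longrightarrow> d \<le> length xs \<Longrightarrow> set (seg a b) \<inter> set (seg c d) = {}"
  unfolding set_seg by (auto simp: nth_eq)

lemma set_seg_subset: "b \<le> length xs \<Longrightarrow> set (seg a b) \<subseteq> set xs"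
  unfolding set_seg by auto

text \<open>Despite the name, \<open>w\<close> may have further neighbours at this stage; only its
  contact with the path is recorded.\<close>

definition leaf :: "nat \<Rightarrow> 'a \<Rightarrow> bool" where
  "leaf i w \<longleftrightarrow> i < length xs \<and> w \<in> pverts G \<and> w \<notin> set xs \<and> (w, xs ! i) \<in> parcs G"

lemma leaf_notin_seg: "leaf i w \<Longrightarrow> b \<le> length xs \<Longrightarrow> w \<notin> set (seg a b)"
  unfolding leaf_def using set_seg_subset by blast

lemma leaf_ne: "leaf i w \<Longrightarrow> l < length xs \<Longrightarrow> xs ! l \<noteq> w"
  unfolding leaf_def by auto

lemma seg_piece:
  assumes "leaf i w" "b \<le> length xs" "a \<le> i" "i < b" "length (as :: nat list) = b - a" "0 < sum_squares as"
    "m * (sum_squares as + c\<^sup>2) \<le> 20000 * (cons_prods as + c * as ! (i - a))"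
  shows "carries G (set (seg a b) \<union> {w}) (real m / 10000)"
  by (rule leaf_piece[OF graph seg_path, where i = "i - a" and as = as and b = c])
    (use assms leaf_notin_seg[OF assms(1,2)] in \<open>auto simp: leaf_def\<close>)

lemma seg_no_two_leaves:
  assumes "leaf i w" "leaf j w'" "w \<noteq> w'" "b \<le> length xs" "a \<le> i" "i < b" "a \<le> j" "j < b"
    "length (as :: nat list) = b - a" "0 < sum_squares as" "b \<le> a + 100"
    "20583 * (sum_squares as + c\<^sup>2 + d\<^sup>2) \<le> 20000 * (cons_prods as + c * as ! (i - a) + d * as ! (j - a))"
  shows False
proof -
  have "carries G (set (seg a b) \<union> {w, w'}) (real 20583 / 10000)"
    by (rule two_leaves_piece[OF graph seg_path, where i = "i - a" and j = "j - a" and as = as and b = c and c = d])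
      (use assms leaf_notin_seg[OF assms(1,4)] leaf_notin_seg[OF assms(2,4)] in \<open>auto simp: leaf_def\<close>)
  thus False
    by (rule no_piece[where a = a]) (use assms(4,11) leaf_ne[OF assms(1)] leaf_ne[OF assms(2)] in \<open>auto simp: mem_seg\<close>)
qed

lemma seg_long_branch_piece:
  assumes "leaf i w" "u \<in> pverts G" "u \<notin> set xs" "(u, w) \<in> parcs G" "b \<le> length xs" "a \<le> i" "i < b"
    "length (as :: nat list) = b - a" "0 < sum_squares as"
    "m * (sum_squares as + c\<^sup>2 + d\<^sup>2) \<le> 20000 * (cons_prods as + c * as ! (i - a) + d * c)"
  shows "carries G (set (seg a b) \<union> {w, u}) (real m / 10000)"
  by (rule long_branch_piece[OF graph seg_path, where i = "i - a" and as = as and b = c and c = d])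
    (use assms leaf_notin_seg[OF assms(1,5)] set_seg_subset[OF assms(5)] no_loops' in \<open>auto simp: leaf_def\<close>)

text \<open>
  The integer weights are rounded Perron vectors of the trees in question. In the names, \<open>right\<close> means
  that the long arm is on the right (the mirror image follows by reversing \<open>xs\<close>), and in
  \<open>no_leaves_2_7_5_20\<close> the numbers are the left and right arm lengths of the two disjoint pieces.
\<close>

lemma no_double_leaf_right:
  assumes "leaf i w" "leaf (i) w'" "w \<noteq> w'" "1 \<le> i" "i + 5 < length xs"
  shows False
  by (rule seg_no_two_leaves[OF assms(1-3), where a = "i - 1" and b = "i + 6" and c = 9 and d = 9
      and as = "[9, 20, 14, 10, 6, 4, 2]"])
    (use assms(4,5) in \<open>auto simp: sum_squares_def\<close>)

lemma no_gap1_right: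
  assumes "leaf i w" "leaf (Suc i) w'" "w \<noteq> w'" "1 \<le> i" "Suc i + 10 < length xs"
  shows False
  by (rule seg_no_two_leaves[OF assms(1-3), where a = "i - 1" and b = "i + 12" and c = 8 and d = 10
      and as = "[8, 18, 20, 15, 11, 8, 6, 4, 3, 2, 1, 1, 1]"])
    (use assms(4,5) in \<open>auto simp: sum_squares_def\<close>)

lemma no_gap2_right:
  assumes "leaf i w" "leaf (i + 2) w'" "w \<noteq> w'" "1 \<le> i" "i + 2 + 10 < length xs"
  shows False
  by (rule seg_no_two_leaves[OF assms(1-3), where a = "i - 1" and b = "i + 13" and c = 7 and d = 10
      and as = "[7, 15, 17, 20, 15, 11, 9, 6, 5, 3, 3, 2, 1, 1]"])
    (use assms(4,5) in \<open>auto simp: sum_squares_def\<close>)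

text \<open>From this gap on the left arm has length 2 instead of 1, because a leaf at position 1
  with another one at position 4 or later occurs in the family. The right arm grows from 10 to 20,
  which brings the quotient closer to that of an infinite arm.\<close>

lemma no_gap3_right:
  assumes "leaf i w" "leaf (i + 3) w'" "w \<noteq> w'" "2 \<le> i" "i + 3 + 20 < length xs"
  shows False
  by (rule seg_no_two_leaves[OF assms(1-3), where a = "i - 2" and b = "i + 24" and c = 8 and d = 10
      and as = "[5, 10, 16, 16, 17, 20, 15, 11, 8, 6, 5, 3, 3, 2, 1, 1, 1, 1, 1, 1, 1, 1, 1, 1, 1, 1]"])
    (use assms(4,5) in \<open>auto simp: sum_squares_def\<close>)

lemma no_gap4_right:
  assumes "leaf i w" "leaf (i + 4) w'" "w \<noteq> w'" "2 \<le> i" "i + 4 + 20 < length xs"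
  shows False
  by (rule seg_no_two_leaves[OF assms(1-3), where a = "i - 2" and b = "i + 25" and c = 7 and d = 10
      and as = "[4, 9, 15, 14, 15, 17, 20, 15, 11, 9, 7, 5, 4, 3, 2, 2, 1, 1, 1, 1, 1, 1, 1, 1, 1, 1, 1]"])
    (use assms(4,5) in \<open>auto simp: sum_squares_def\<close>)

lemma no_gap5_right:
  assumes "leaf i w" "leaf (i + 5) w'" "w \<noteq> w'" "2 \<le> i" "i + 5 + 20 < length xs"
  shows False
  by (rule seg_no_two_leaves[OF assms(1-3), where a = "i - 2" and b = "i + 26" and c = 6 and d = 10
      and as = "[4, 8, 13, 12, 13, 14, 16, 20, 15, 12, 9, 7, 5, 4, 3, 2, 2, 1, 1, 1, 1, 1, 1, 1, 1, 1, 1, 1]"])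
    (use assms(4,5) in \<open>auto simp: sum_squares_def\<close>)

lemma no_gap6_right:
  assumes "leaf i w" "leaf (i + 6) w'" "w \<noteq> w'" "2 \<le> i" "i + 6 + 20 < length xs"
  shows False
  by (rule seg_no_two_leaves[OF assms(1-3), where a = "i - 2" and b = "i + 27" and c = 5 and d = 10
      and as = "[3, 7, 11, 11, 11, 12, 14, 16, 20, 15, 12, 9, 7, 5, 4, 3, 3, 2, 1, 1, 1, 1, 1, 1, 1, 1, 1, 1, 1]"])
    (use assms(4,5) in \<open>auto simp: sum_squares_def\<close>)

lemma no_gap7_right:
  assumes "leaf i w" "leaf (i + 7) w'" "w \<noteq> w'" "2 \<le> i" "i + 7 + 20 < length xs"
  shows False
  by (rule seg_no_two_leaves[OF assms(1-3), where a = "i - 2" and b = "i + 28" and c = 5 and d = 10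
      and as = "[3, 6, 10, 9, 9, 10, 11, 13, 16, 20, 16, 12, 9, 7, 6, 4, 3, 3, 2, 2, 1, 1, 1, 1, 1, 1, 1, 1, 1, 1]"])
    (use assms(4,5) in \<open>auto simp: sum_squares_def\<close>)

lemma no_gap8_right:
  assumes "leaf i w" "leaf (i + 8) w'" "w \<noteq> w'" "2 \<le> i" "i + 8 + 20 < length xs"
  shows False
  by (rule seg_no_two_leaves[OF assms(1-3), where a = "i - 2" and b = "i + 29" and c = 4 and d = 10
      and as = "[2, 5, 8, 8, 8, 8, 9, 11, 13, 16, 20, 16, 12, 9, 7, 6, 4, 3, 3, 2, 2, 1, 1, 1, 1, 1, 1, 1, 1, 1, 1]"])
    (use assms(4,5) in \<open>auto simp: sum_squares_def\<close>)

text \<open>The influence of the left leaf decays with the gap and the margin over 2.0583 becomes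
  thin, whence the finer rounding: 50 instead of 20 at the right branch vertex, and 100 for gap
  12.\<close>

lemma no_gap9_right:
  assumes "leaf i w" "leaf (i + 9) w'" "w \<noteq> w'" "2 \<le> i" "i + 9 + 20 < length xs"
  shows False
  by (rule seg_no_two_leaves[OF assms(1-3), where a = "i - 2" and b = "i + 30" and c = 8 and d = 24
      and as = "[5, 11, 17, 16, 16, 17, 18, 22, 26, 32, 40, 50, 39, 31, 24, 19, 15, 11, 9, 7, 5, 4, 3, 3, 2, 2, 1, 1, 1, 1, 1, 1]"])
    (use assms(4,5) in \<open>auto simp: sum_squares_def\<close>)

lemma no_gap10_right:
  assumes "leaf i w" "leaf (i + 10) w'" "w \<noteq> w'" "2 \<le> i" "i + 10 + 20 < length xs"
  shows False
  by (rule seg_no_two_leaves[OF assms(1-3), where a = "i - 2" and b = "i + 31" and c = 7 and d = 24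
      and as = "[4, 9, 14, 13, 13, 13, 15, 17, 21, 25, 31, 40, 50, 39, 31, 24, 19, 15, 12, 9, 7, 6, 4, 3, 3, 2, 2, 1, 1, 1, 1, 1, 1]"])
    (use assms(4,5) in \<open>auto simp: sum_squares_def\<close>)

lemma no_gap11_right:
  assumes "leaf i w" "leaf (i + 11) w'" "w \<noteq> w'" "2 \<le> i" "i + 11 + 20 < length xs"
  shows False
  by (rule seg_no_two_leaves[OF assms(1-3), where a = "i - 2" and b = "i + 32" and c = 5 and d = 24
      and as = "[3, 7, 11, 10, 10, 11, 12, 14, 16, 20, 25, 31, 39, 50, 39, 31, 24, 19, 15, 12, 9, 7, 6, 4, 3, 3, 2, 2, 1, 1, 1, 1, 1, 1]"])
    (use assms(4,5) in \<open>auto simp: sum_squares_def\<close>)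

lemma no_gap12_right:
  assumes "leaf i w" "leaf (i + 12) w'" "w \<noteq> w'" "2 \<le> i" "i + 12 + 20 < length xs"
  shows False
  by (rule seg_no_two_leaves[OF assms(1-3), where a = "i - 2" and b = "i + 33" and c = 8 and d = 49
      and as = "[5, 11, 17, 16, 16, 17, 19, 22, 26, 32, 39, 49, 62, 79, 100, 78, 62, 48, 38, 30, 23, 18, 14, 11, 9, 7, 5, 4, 3, 3, 2, 1, 1, 1, 1]"])
    (use assms(4,5) in \<open>auto simp: sum_squares_def\<close>)

text \<open>The piece is T_{2,3,10}. The left arm must be 3, since T_{2,2,c} belongs to the
  family.\<close>

lemma no_long_branch_right:
  assumes "leaf i w" "u \<in> pverts G" "u \<notin> set xs" "(u, w) \<in> parcs G" "3 \<le> i" "i + 10 < length xs"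
  shows False
proof -
  have "carries G (set (seg (i - 3) (i + 11)) \<union> {w, u}) (real 20583 / 10000)"
    by (rule seg_long_branch_piece[OF assms(1-4), where c = 13 and d = 6 and as = "[4, 9, 14, 20, 15, 11, 9, 7, 5, 4, 3, 2, 1, 1]"])
      (use assms(5,6) in \<open>auto simp: sum_squares_def\<close>)
  thus False
    by (rule no_piece[where a = "i - 3"]) (use assms(3,5,6) leaf_ne[OF assms(1)] in \<open>auto simp: mem_seg\<close>)
qed

text \<open>Each piece alone stays below \<eta>, but 2.01 + 2.05 = 4.06 exceeds 4.0583. The inner
  arms 7 and 5 require distance 7 + 5 + 1 = 13, which is where the pieces containing both leaves
  stop.\<close>

lemma no_leaves_2_7_5_20:
  assumes "leaf i w" "leaf j w'" "w \<noteq> w'" "2 \<le> i" "i + 13 \<le> j" "j + 20 < length xs"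
  shows False
proof -
  have "carries G (set (seg (i - 2) (i + 8)) \<union> {w}) (real 20100 / 10000)"
    by (rule seg_piece[OF assms(1), where c = 25 and as = "[16, 33, 50, 43, 36, 29, 23, 17, 11, 6]"])
      (use assms(4-6) in \<open>auto simp: sum_squares_def\<close>)
  moreover have "carries G (set (seg (j - 5) (j + 21)) \<union> {w'}) (real 20500 / 10000)"
    by (rule seg_piece[OF assms(2), where c = 24 and as = "[6, 13, 20, 29, 38, 50, 40, 32, 25, 20, 16, 13, 10, 8, 7, 5, 4, 3, 3, 2, 2, 1, 1, 1, 1, 1]"])
      (use assms(4-6) in \<open>auto simp: sum_squares_def\<close>)
  ultimately show False
  proof (rule no_two_pieces[where a = "i - 2" and b = "j - 5"])
    have "set (seg (i - 2) (i + 8)) \<inter> set (seg (j - 5) (j + 21)) = {}"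
      by (rule seg_disj) (use assms(5,6) in auto)
    thus "(set (seg (i - 2) (i + 8)) \<union> {w}) \<inter> (set (seg (j - 5) (j + 21)) \<union> {w'}) = {}"
      using assms(3,5,6) leaf_notin_seg[OF assms(1), of "j + 21"] leaf_notin_seg[OF assms(2), of "i + 8"] by auto
  qed (use assms(4-6) leaf_ne[OF assms(1)] leaf_ne[OF assms(2)] in \<open>auto simp: mem_seg\<close>)
qed

text \<open>For leaves near opposite ends, where no outer arm of length 20 is available: with inner
  arms 10 the outer arms 2 and 4 suffice, as 2.015 + 2.044 = 4.059.\<close>

lemma no_leaves_2_10_10_4:
  assumes "leaf i w" "leaf j w'" "w \<noteq> w'" "2 \<le> i" "i + 21 \<le> j" "j + 4 < length xs"
  shows False
proof -
  have "carries G (set (seg (i - 2) (i + 11)) \<union> {w}) (real 20150 / 10000)"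
    by (rule seg_piece[OF assms(1), where c = 10 and as = "[7, 13, 20, 17, 15, 13, 11, 9, 7, 6, 4, 3, 1]"])
      (use assms(4-6) in \<open>auto simp: sum_squares_def\<close>)
  moreover have "carries G (set (seg (j - 10) (j + 5)) \<union> {w'}) (real 20440 / 10000)"
    by (rule seg_piece[OF assms(2), where c = 10 and as = "[1, 2, 3, 4, 5, 6, 8, 10, 13, 16, 20, 15, 11, 7, 3]"])
      (use assms(4-6) in \<open>auto simp: sum_squares_def\<close>)
  ultimately show False
  proof (rule no_two_pieces[where a = "i - 2" and b = "j - 10"])
    have "set (seg (i - 2) (i + 11)) \<inter> set (seg (j - 10) (j + 5)) = {}"
      by (rule seg_disj) (use assms(5,6) in auto)
    thus "(set (seg (i - 2) (i + 11)) \<union> {w}) \<inter> (set (seg (j - 10) (j + 5)) \<union> {w'}) = {}"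
      using assms(3,5,6) leaf_notin_seg[OF assms(1), of "j + 5"] leaf_notin_seg[OF assms(2), of "i + 11"] by auto
  qed (use assms(4-6) leaf_ne[OF assms(1)] leaf_ne[OF assms(2)] in \<open>auto simp: mem_seg\<close>)
qed

text \<open>Outer arms 3 and 3: twice 2.032 is 4.064.\<close>

lemma no_leaves_3_8_8_3:
  assumes "leaf i w" "leaf j w'" "w \<noteq> w'" "3 \<le> i" "i + 17 \<le> j" "j + 3 < length xs"
  shows False
proof -
  have "carries G (set (seg (i - 3) (i + 9)) \<union> {w}) (real 20320 / 10000)"
    by (rule seg_piece[OF assms(1), where c = 25 and as = "[12, 23, 36, 50, 41, 33, 27, 21, 16, 12, 8, 4]"])
      (use assms(4-6) in \<open>auto simp: sum_squares_def\<close>)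
  moreover have "carries G (set (seg (j - 8) (j + 4)) \<union> {w'}) (real 20320 / 10000)"
    by (rule seg_piece[OF assms(2), where c = 25 and as = "[4, 8, 12, 16, 21, 27, 33, 41, 50, 36, 23, 12]"])
      (use assms(4-6) in \<open>auto simp: sum_squares_def\<close>)
  ultimately show False
  proof (rule no_two_pieces[where a = "i - 3" and b = "j - 8"])
    have "set (seg (i - 3) (i + 9)) \<inter> set (seg (j - 8) (j + 4)) = {}"
      by (rule seg_disj) (use assms(5,6) in auto)
    thus "(set (seg (i - 3) (i + 9)) \<union> {w}) \<inter> (set (seg (j - 8) (j + 4)) \<union> {w'}) = {}"
      using assms(3,5,6) leaf_notin_seg[OF assms(1), of "j + 4"] leaf_notin_seg[OF assms(2), of "i + 9"] by auto
  qed (use assms(4-6) leaf_ne[OF assms(1)] leaf_ne[OF assms(2)] in \<open>auto simp: mem_seg\<close>)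
qed

text \<open>The second vertex of the branch lifts the left piece from 2.015 to 2.054, so that now
  even a right outer arm of length 2 is too much: 2.054 + 2.015 = 4.069.\<close>

lemma no_long_branch_leaf:
  assumes "leaf i w" "u \<in> pverts G" "u \<notin> set xs" "(u, w) \<in> parcs G" "leaf j w'" "w \<noteq> w'" "u \<noteq> w'"
    "2 \<le> i" "i + 21 \<le> j" "j + 2 < length xs"
  shows False
proof -
  have "carries G (set (seg (i - 2) (i + 11)) \<union> {w, u}) (real 20540 / 10000)"
    by (rule seg_long_branch_piece[OF assms(1-4), where c = 13 and d = 6 and as = "[6, 13, 20, 16, 12, 10, 7, 6, 4, 3, 2, 1, 1]"])
      (use assms(8-10) in \<open>auto simp: sum_squares_def\<close>)
  moreover have "carries G (set (seg (j - 10) (j + 3)) \<union> {w'}) (real 20150 / 10000)"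
    by (rule seg_piece[OF assms(5), where c = 10 and as = "[1, 3, 4, 6, 7, 9, 11, 13, 15, 17, 20, 13, 7]"])
      (use assms(8-10) in \<open>auto simp: sum_squares_def\<close>)
  ultimately show False
  proof (rule no_two_pieces[where a = "i - 2" and b = "j - 10"])
    have "set (seg (i - 2) (i + 11)) \<inter> set (seg (j - 10) (j + 3)) = {}"
      by (rule seg_disj) (use assms(9,10) in auto)
    thus "(set (seg (i - 2) (i + 11)) \<union> {w, u}) \<inter> (set (seg (j - 10) (j + 3)) \<union> {w'}) = {}"
      using assms(3,6,7,9,10) leaf_notin_seg[OF assms(1), of "j + 3"] leaf_notin_seg[OF assms(5), of "i + 11"]
        set_seg_subset[of "j + 3" "j - 10"] by auto
  qed (use assms(3,8-10) leaf_ne[OF assms(1)] leaf_ne[OF assms(5)] in \<open>auto simp: mem_seg\<close>)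
qed

end

section \<open>What hangs off the long path\<close>

lemma simple_path_Cons:
  "simple_path G (w # ys) \<longleftrightarrow>
     w \<notin> set ys \<and> w \<in> pverts G \<and> simple_path G ys \<and> (ys \<noteq> [] \<longrightarrow> (w, hd ys) \<in> parcs G)"
  unfolding simple_path_def by (cases ys) auto

lemma connected_closure:
  assumes G: "pair_graph G" "connected (with_proj G)" and v0: "v0 \<in> W" "v0 \<in> pverts G"
    and cl: "\<And>u v. u \<in> W \<Longrightarrow> (u, v) \<in> parcs G \<Longrightarrow> v \<in> W"
  shows "pverts G \<subseteq> W"
proof
  interpret pair_graph G by (rule G(1))
  fix v assume v: "v \<in> pverts G"
  have "strongly_connected (with_proj G)"
    using symmetric_connected_imp_strongly_connected[OF sym_arcs G(2)] .
  hence "v0 \<rightarrow>\<^sup>*\<^bsub>with_proj G\<^esub> v" using v v0(2) unfolding strongly_connected_def by simp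
  thus "v \<in> W"
    by (induct rule: reachable_induct) (use v0(1) cl in auto)
qed

context long_spine begin

lemma hd_seg: "a < b \<Longrightarrow> hd (seg a b) = xs ! a" unfolding seg_def by (simp add: hd_map)

lemma last_seg: "a < b \<Longrightarrow> last (seg a b) = xs ! (b - 1)" unfolding seg_def by (simp add: last_map)

lemma seg_ne: "a < b \<Longrightarrow> seg a b \<noteq> []" unfolding seg_def by simp

lemma sym: "(u, v) \<in> parcs G \<longleftrightarrow> (v, u) \<in> parcs G" using arcs_symmetric by blast

lemma arc_verts: "(u, v) \<in> parcs G \<Longrightarrow> u \<in> pverts G \<and> v \<in> pverts G" using wellformed' by blast

lemma no_chord:
  assumes "i < j" "j < length xs" "(xs ! j, xs ! i) \<in> parcs G"
  shows "j = Suc i"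
proof (rule ccontr)
  assume "j \<noteq> Suc i"
  hence "(last (seg i (Suc j)), hd (seg i (Suc j))) \<notin> parcs G"
    using assms by (intro tree_no_chord[OF tree seg_path]) auto
  thus False using assms by (simp add: hd_seg last_seg)
qed

text \<open>Otherwise \<open>w\<close> and the stretch of the path between its two contacts form a
  cycle.\<close>

lemma leaf_position_unique:
  assumes "leaf i w" "leaf j w"
  shows "i = j"
proof -
  have "False" if l: "leaf i w" "leaf j w" "i < j" for i j
  proof -
    have "simple_path G (w # seg i (Suc j))"
      using l leaf_notin_seg[OF l(1), of "Suc j" i] seg_path[of "Suc j" i]
      by (auto simp: simple_path_Cons hd_seg leaf_def)
    from tree_no_chord[OF tree this] show False using l seg_ne[of i "Suc j"]
      by (auto simp: last_seg leaf_def sym)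
  qed
  thus ?thesis using assms by (meson linorder_neqE_nat)
qed

lemma leaf_adj_leaf:
  assumes "leaf i w" "leaf j u" "(u, w) \<in> parcs G"
  shows False
proof -
  have "False" if l: "leaf i w" "leaf j u" "(u, w) \<in> parcs G" "i \<le> j" for i j u w
  proof -
    have "simple_path G (u # w # seg i (Suc j))"
      using l leaf_notin_seg[OF l(1), of "Suc j" i] leaf_notin_seg[OF l(2), of "Suc j" i]
        seg_path[of "Suc j" i] no_loops'[OF l(3)]
      by (auto simp: simple_path_Cons hd_seg leaf_def)
    from tree_no_chord[OF tree this] show False using l seg_ne[of i "Suc j"]
      by (auto simp: last_seg leaf_def sym)
  qed
  thus ?thesis using assms sym by (meson nat_le_linear)
qed

lemma leaf_rev: "leaf i w \<Longrightarrow> long_spine.leaf G (rev xs) (length xs - Suc i) w"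
proof -
  assume a: "leaf i w"
  hence "i < length xs" unfolding leaf_def by simp
  hence "rev xs ! (length xs - Suc i) = xs ! i" "length xs - Suc i < length xs" by (auto simp: rev_nth)
  thus ?thesis using a unfolding leaf_def long_spine.leaf_def[OF long_spine_rev] by simp
qed

text \<open>A neighbour of an end vertex off the path would extend the longest path.\<close>

lemma leaf_pos:
  assumes "leaf i w"
  shows "1 \<le> i" "Suc i < length xs"
proof -
  have i: "i < length xs" and w: "w \<in> pverts G" "w \<notin> set xs" "(w, xs ! i) \<in> parcs G"
    using assms unfolding leaf_def by auto
  show "1 \<le> i"
  proof (rule ccontr)
    assume "\<not> 1 \<le> i"
    hence "i = 0" by simp
    hence "simple_path G (w # xs)" using w path long' by (auto simp: simple_path_Cons hd_conv_nth)
    from longest[OF this] show False by simp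
  qed
  show "Suc i < length xs"
  proof (rule ccontr)
    assume "\<not> Suc i < length xs"
    hence "i = length xs - 1" using i by simp
    moreover have "xs \<noteq> []" using long' by auto
    ultimately have "hd (rev xs) = xs ! i" by (simp add: hd_rev last_conv_nth)
    hence "simple_path G (w # rev xs)"
      using w long_spine.path[OF long_spine_rev] by (auto simp: simple_path_Cons)
    from longest[OF this] show False by simp
  qed
qed

text \<open>The forbidden piece needs an arm of length 1, which \<open>leaf_pos\<close> supplies on
  both sides, and an arm of length 5 on the other side; in so long a path one of the two sides has
  it.\<close>

lemma leaf_unique:
  assumes "leaf i w" "leaf i w'"
  shows "w = w'"
proof (rule ccontr)
  assume ne: "w \<noteq> w'"
  note p = leaf_pos[OF assms(1)]
  show False
  proof (cases "i + 5 < length xs")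
    case True
    thus ?thesis using no_double_leaf_right[OF assms ne] p by simp
  next
    case False
    hence "1 \<le> length xs - Suc i" "length xs - Suc i + 5 < length (rev xs)" using p long' by auto
    with long_spine.no_double_leaf_right[OF long_spine_rev leaf_rev[OF assms(1)] leaf_rev[OF assms(2)] ne]
    show ?thesis .
  qed
qed

lemma leaf_gap:
  assumes "leaf i w" "leaf j w'" "i < j"
  shows "i + 3 \<le> j"
proof (rule ccontr)
  assume "\<not> i + 3 \<le> j"
  hence j: "j = Suc i \<or> j = i + 2" using assms(3) by auto
  have ne: "w \<noteq> w'" using leaf_position_unique assms by blast
  note p = leaf_pos[OF assms(1)] leaf_pos[OF assms(2)]
  show False
  proof (cases "j + 10 < length xs")
    case True
    thus ?thesis using no_gap1_right[OF assms(1) _ ne] no_gap2_right[OF assms(1) _ ne] assms(2) p j by auto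
  next
    case False
    define i' where "i' = length xs - Suc j"
    have i': "1 \<le> i'" "i' + 20 < length xs" using p long' False j unfolding i'_def by auto
    have "length xs - Suc i = (if j = Suc i then Suc i' else i' + 2)" using j p unfolding i'_def by auto
    thus ?thesis
      using long_spine.no_gap1_right[OF long_spine_rev leaf_rev[OF assms(2)] _ ne[symmetric]]
        long_spine.no_gap2_right[OF long_spine_rev leaf_rev[OF assms(2)] _ ne[symmetric]]
        leaf_rev[OF assms(1)] i' j unfolding i'_def[symmetric] by (auto split: if_splits)
  qed
qed

text \<open>Position 1 contradicts maximality, since \<open>u\<close> and \<open>w\<close> could
  replace the single end vertex. If both arms have length at least 3, the longer one provides the
  room for the forbidden piece.\<close>

lemma long_branch_position:
  assumes "leaf i w" "u \<in> pverts G" "u \<notin> set xs" "(u, w) \<in> parcs G"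
  shows "i = 2 \<or> i + 3 = length xs"
proof -
  \<comment> \<open>Stated for an arbitrary spine, so that it can be applied to \<open>xs\<close>
    and to its reversal.\<close>
  have two: "2 \<le> i" if S: "long_spine G k r xs" and l: "long_spine.leaf G xs i w" "u \<notin> set xs" for xs i
  proof (rule ccontr)
    interpret S: long_spine G k r xs by (rule S)
    assume "\<not> 2 \<le> i"
    hence i: "i = 1" using S.leaf_pos[OF l(1)] by simp
    have "simple_path G (u # w # S.seg 1 (length xs))"
      using l i assms(2,4) S.leaf_notin_seg[OF l(1), of "length xs" 1] S.seg_path[of "length xs" 1]
        no_loops'[OF assms(4)] S.set_seg_subset[of "length xs" 1] S.long'
      by (auto simp: simple_path_Cons S.hd_seg S.leaf_def)
    from S.longest[OF this] show False using S.long' by simp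
  qed
  note p = leaf_pos[OF assms(1)]
  have "2 \<le> i" by (rule two[OF _ assms(1,3)]) unfold_locales
  moreover have "2 \<le> length xs - Suc i"
    by (rule two[OF long_spine_rev leaf_rev[OF assms(1)]]) (use assms(3) in simp)
  moreover have False if "3 \<le> i" "3 \<le> length xs - Suc i"
  proof (cases "i + 10 < length xs")
    case True
    thus ?thesis using no_long_branch_right[OF assms] that by simp
  next
    case False
    hence "length xs - Suc i + 10 < length (rev xs)" using p long' by auto
    thus ?thesis
      using long_spine.no_long_branch_right[OF long_spine_rev leaf_rev[OF assms(1)] assms(2) _ assms(4)]
        assms(3) that by simp
  qed
  ultimately show ?thesis using p by arith
qed

text \<open>Rerouting the path through \<open>u\<close> and \<open>w\<close> makes \<open>u'\<close>
  and \<open>xs ! (i - 1)\<close> two leaves at adjacent vertices. This is the configuration of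
  \<open>no_gap1_right\<close>, and the same weights serve.\<close>

lemma no_two_twigs_right:
  assumes "leaf i w" "u \<in> pverts G" "u \<notin> set xs" "(u, w) \<in> parcs G"
    and "u' \<in> pverts G" "u' \<notin> set xs" "(u', w) \<in> parcs G" and "u \<noteq> u'" "i + 10 < length xs"
  shows False
proof -
  define ys where "ys = u # w # seg i (i + 11)"
  have i: "1 \<le> i" using leaf_pos[OF assms(1)] by simp
  have uw: "u \<noteq> w" "u' \<noteq> w" using no_loops' assms by auto
  have sub: "set (seg i (i + 11)) \<subseteq> set xs" using assms(9) by (intro set_seg_subset) simp
  have ys: "simple_path G ys"
    using assms leaf_notin_seg[OF assms(1), of "i + 11" i] seg_path[of "i + 11" i] sub uw
    unfolding ys_def by (auto simp: simple_path_Cons hd_seg leaf_def)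
  have x: "xs ! (i - 1) \<notin> set (seg i (i + 11))" "xs ! (i - 1) \<in> set xs" using i assms(9) by (auto simp: mem_seg)
  have "(xs ! (i - 1), xs ! i) \<in> parcs G" using simple_path_nth[OF path, of "i - 1"] i assms(9) by simp
  hence "carries G (set ys \<union> {u', xs ! (i - 1)}) (real 20583 / 10000)"
    using assms x uw sub i
    by (intro two_leaves_piece[OF graph ys, where i = 1 and j = 2 and b = 8 and c = 10
          and as = "[8, 18, 20, 15, 11, 8, 6, 4, 3, 2, 1, 1, 1]"])
      (auto simp: ys_def sum_squares_def leaf_def dest: arc_verts)
  thus False
    by (rule no_piece[where a = "i - 1"])
      (use assms i leaf_ne[OF assms(1)] in \<open>auto simp: ys_def mem_seg nth_eq\<close>)
qed

lemma twig_unique: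
  assumes "leaf i w" "u \<in> pverts G" "u \<notin> set xs" "(u, w) \<in> parcs G"
    and "u' \<in> pverts G" "u' \<notin> set xs" "(u', w) \<in> parcs G"
  shows "u = u'"
proof (rule ccontr)
  assume ne: "u \<noteq> u'"
  show False
  proof (cases "i + 10 < length xs")
    case True
    thus ?thesis using no_two_twigs_right[OF assms ne] by simp
  next
    case False
    hence "length xs - Suc i + 10 < length (rev xs)" using long' leaf_pos[OF assms(1)] by auto
    thus ?thesis
      using long_spine.no_two_twigs_right[OF long_spine_rev leaf_rev[OF assms(1)] assms(2) _ assms(4,5) _ assms(7) ne]
        assms(3,6) by simp
  qed
qed

text \<open>The branch sits at distance 2 from an end of the path. A third vertex on it would allow
  the two vertices beyond the branch point to be exchanged for three, against maximality.\<close>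

lemma twig_end:
  assumes "leaf i w" "u \<in> pverts G" "u \<notin> set xs" "(u, w) \<in> parcs G" "(z, u) \<in> parcs G"
  shows "z = w"
proof (rule ccontr)
  assume zw: "z \<noteq> w"
  have z: "z \<in> pverts G" using arc_verts[OF assms(5)] by simp
  have zx: "z \<notin> set xs"
  proof
    assume "z \<in> set xs"
    then obtain j where "j < length xs" "z = xs ! j" by (auto simp: in_set_conv_nth)
    hence "leaf j u" using assms(2,3,5) sym unfolding leaf_def by auto
    thus False using leaf_adj_leaf[OF assms(1) _ assms(4)] by blast
  qed
  have no2: "i \<noteq> 2" if S: "long_spine G k r xs" and l: "long_spine.leaf G xs i w" "u \<notin> set xs" "z \<notin> set xs" for xs i
  proof
    interpret S: long_spine G k r xs by (rule S)
    assume i: "i = 2"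
    have "simple_path G (z # u # w # S.seg 2 (length xs))"
      using l i z zw assms(2,4,5) S.leaf_notin_seg[OF l(1), of "length xs" 2] S.seg_path[of "length xs" 2]
        no_loops'[OF assms(4)] no_loops'[OF assms(5)] S.set_seg_subset[of "length xs" 2] S.long'
      by (auto simp: simple_path_Cons S.hd_seg S.leaf_def)
    from S.longest[OF this] show False using S.long' by simp
  qed
  have "i \<noteq> 2" by (rule no2[OF _ assms(1,3) zx]) unfold_locales
  moreover have "length xs - Suc i \<noteq> 2"
    by (rule no2[OF long_spine_rev leaf_rev[OF assms(1)]]) (use assms(3) zx in simp_all)
  ultimately show False using long_branch_position[OF assms(1-4)] by auto
qed

text \<open>
  \<open>B\<close> is the set of positions of \<open>xs\<close> with a neighbour \<open>lf i\<close> off the path, and \<open>D\<close> is the subset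
  of those where \<open>lf i\<close> has a further neighbour \<open>tw i\<close>. Outside \<open>B\<close> and \<open>D\<close> the choices are arbitrary.
\<close>

definition B :: "nat set" where "B = {i. \<exists>w. leaf i w}"

definition lf :: "nat \<Rightarrow> 'a" where "lf i = (SOME w. leaf i w)"

definition D :: "nat set" where "D = {i\<in>B. \<exists>u. u \<in> pverts G \<and> u \<notin> set xs \<and> (u, lf i) \<in> parcs G}"

definition tw :: "nat \<Rightarrow> 'a" where "tw i = (SOME u. u \<in> pverts G \<and> u \<notin> set xs \<and> (u, lf i) \<in> parcs G)"

lemma leaf_lf: "i \<in> B \<Longrightarrow> leaf i (lf i)"
  unfolding B_def lf_def by (auto intro: someI)

lemma leaf_eq: "leaf i w \<longleftrightarrow> i \<in> B \<and> w = lf i"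
  using leaf_lf leaf_unique unfolding B_def by blast

lemma D_B: "i \<in> D \<Longrightarrow> i \<in> B" unfolding D_def by simp

lemma tw: "i \<in> D \<Longrightarrow> tw i \<in> pverts G \<and> tw i \<notin> set xs \<and> (tw i, lf i) \<in> parcs G"
  unfolding D_def tw_def by (rule someI_ex) simp

lemma tw_eq: "i \<in> B \<Longrightarrow> u \<in> pverts G \<Longrightarrow> u \<notin> set xs \<Longrightarrow> (u, lf i) \<in> parcs G \<Longrightarrow> i \<in> D \<and> u = tw i"
  using twig_unique[OF leaf_lf, of i u "tw i"] tw[of i] unfolding D_def by blast

lemma B_less: "i \<in> B \<Longrightarrow> i < length xs" "i \<in> B \<Longrightarrow> 1 \<le> i" "i \<in> B \<Longrightarrow> Suc i < length xs"
  using leaf_pos[OF leaf_lf] leaf_lf by (auto simp: leaf_def)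

lemma finite_B: "finite B" using B_less(1) by (meson bounded_nat_set_is_finite)

lemma D_position: "i \<in> D \<Longrightarrow> i = 2 \<or> i + 3 = length xs"
  using long_branch_position[OF leaf_lf[OF D_B]] tw by blast

text \<open>With the next two lemmas all neighbourhoods are known: the tree is determined by the
  length of the path and the sets \<open>B\<close> and \<open>D\<close>.\<close>

lemma nbr_path:
  assumes "j < length xs"
  shows "(xs ! j, v) \<in> parcs G \<longleftrightarrow>
    (1 \<le> j \<and> v = xs ! (j - 1)) \<or> (Suc j < length xs \<and> v = xs ! Suc j) \<or> (j \<in> B \<and> v = lf j)"
proof
  assume a: "(xs ! j, v) \<in> parcs G"
  show "(1 \<le> j \<and> v = xs ! (j - 1)) \<or> (Suc j < length xs \<and> v = xs ! Suc j) \<or> (j \<in> B \<and> v = lf j)"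
  proof (cases "v \<in> set xs")
    case True
    then obtain l where l: "l < length xs" "v = xs ! l" by (auto simp: in_set_conv_nth)
    have "l \<noteq> j" using a l no_loops' by auto
    thus ?thesis using no_chord[of l j] no_chord[of j l] a l assms sym by (metis diff_Suc_1 linorder_neqE_nat One_nat_def le_add1 plus_1_eq_Suc)
  next
    case False
    hence "leaf j v" using a assms arc_verts sym unfolding leaf_def by blast
    thus ?thesis by (simp add: leaf_eq)
  qed
next
  assume "(1 \<le> j \<and> v = xs ! (j - 1)) \<or> (Suc j < length xs \<and> v = xs ! Suc j) \<or> (j \<in> B \<and> v = lf j)"
  thus "(xs ! j, v) \<in> parcs G"
    using simple_path_nth[OF path, of "j - 1"] simple_path_nth[OF path, of j] assms leaf_lf[of j] sym
    by (auto simp: leaf_def)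
qed

lemma nbr_lf:
  assumes "i \<in> B"
  shows "(lf i, v) \<in> parcs G \<longleftrightarrow> v = xs ! i \<or> (i \<in> D \<and> v = tw i)"
proof
  assume a: "(lf i, v) \<in> parcs G"
  show "v = xs ! i \<or> (i \<in> D \<and> v = tw i)"
  proof (cases "v \<in> set xs")
    case True
    then obtain l where l: "l < length xs" "v = xs ! l" by (auto simp: in_set_conv_nth)
    hence "leaf l (lf i)" using leaf_lf[OF assms] a unfolding leaf_def by auto
    thus ?thesis using leaf_position_unique[OF leaf_lf[OF assms]] l by blast
  next
    case False
    thus ?thesis using tw_eq[OF assms, of v] a arc_verts sym by blast
  qed
next
  assume "v = xs ! i \<or> (i \<in> D \<and> v = tw i)"
  thus "(lf i, v) \<in> parcs G" using leaf_lf[OF assms] tw sym unfolding leaf_def by blast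
qed

lemma nbr_tw:
  assumes "i \<in> D"
  shows "(tw i, v) \<in> parcs G \<longleftrightarrow> v = lf i"
  using twig_end[OF leaf_lf[OF D_B[OF assms]], of "tw i" v] tw[OF assms] sym by blast

lemma lf_notin: "i \<in> B \<Longrightarrow> lf i \<notin> set xs" "i \<in> B \<Longrightarrow> lf i \<in> pverts G"
  using leaf_lf unfolding leaf_def by auto

lemma lf_inj: "i \<in> B \<Longrightarrow> j \<in> B \<Longrightarrow> lf i = lf j \<longleftrightarrow> i = j"
  using leaf_position_unique leaf_lf by metis

lemma tw_ne_lf: "i \<in> D \<Longrightarrow> j \<in> B \<Longrightarrow> tw i \<noteq> lf j"
  using leaf_adj_leaf[OF leaf_lf[OF D_B] leaf_lf, of i j] tw by metis

lemma tw_inj: "i \<in> D \<Longrightarrow> j \<in> D \<Longrightarrow> tw i = tw j \<longleftrightarrow> i = j"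
  using nbr_tw lf_inj D_B by metis

section \<open>Mutual position of two branches\<close>

lemma no_two_branches_right:
  assumes "i \<in> B" "j \<in> B" "i < j" "2 \<le> i" "j + 20 < length xs"
  shows False
proof -
  note l = leaf_lf[OF assms(1)] leaf_lf[OF assms(2)]
  have ne: "lf i \<noteq> lf j" using lf_inj assms by simp
  have "i + 3 \<le> j" by (rule leaf_gap[OF l assms(3)])
  show False
  proof (cases "i + 13 \<le> j")
    case True
    thus ?thesis using no_leaves_2_7_5_20[OF l ne] assms by simp
  next
    case False
    hence "j \<in> {i + 3, i + 4, i + 5, i + 6, i + 7, i + 8, i + 9, i + 10, i + 11, i + 12}"
      using \<open>i + 3 \<le> j\<close> by simp presburger
    thus ?thesis
      using l(2) ne assms no_gap3_right[OF l(1)] no_gap4_right[OF l(1)] no_gap5_right[OF l(1)]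
        no_gap6_right[OF l(1)] no_gap7_right[OF l(1)] no_gap8_right[OF l(1)] no_gap9_right[OF l(1)]
        no_gap10_right[OF l(1)] no_gap11_right[OF l(1)] no_gap12_right[OF l(1)] by blast
  qed
qed

lemma B_rev: "i \<in> B \<Longrightarrow> length xs - Suc i \<in> long_spine.B G (rev xs)"
  using leaf_rev[OF leaf_lf] unfolding long_spine.B_def[OF long_spine_rev] by auto

text \<open>The last assumption says that the outer arms \<open>i\<close> and
  \<open>length xs - 1 - j\<close> have sum at least 6; the arms (2, 2), (2, 3) and (3, 2) thereby
  excluded occur in the family up to reversal. As each arm is at least 2, one of them is at least 4
  or both are 3.\<close>

lemma no_two_branches:
  assumes ij: "i \<in> B" "j \<in> B" "i < j" and i: "2 \<le> i" and j: "j + 3 \<le> length xs"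
    and arms: "j + 7 \<le> i + length xs"
  shows False
proof -
  interpret R: long_spine G k r "rev xs" by (rule long_spine_rev)
  note l = leaf_lf[OF ij(1)] leaf_lf[OF ij(2)]
  note rl = leaf_rev[OF l(1)] leaf_rev[OF l(2)]
  have ne: "lf i \<noteq> lf j" using lf_inj ij by simp
  define i' j' where "i' = length xs - Suc j" and "j' = length xs - Suc i"
  have B': "i' \<in> R.B" "j' \<in> R.B" using B_rev ij unfolding i'_def j'_def by auto
  have ij': "i' < j'" "2 \<le> i'" using ij(3) j unfolding i'_def j'_def by auto
  show False
  proof (cases "j + 20 < length xs \<or> j' + 20 < length xs")
    case True
    thus ?thesis using no_two_branches_right[OF ij i] R.no_two_branches_right[OF B' ij'] by auto
  next
    case far: False
    \<comment> \<open>Both leaves lie within 20 of opposite ends of a path of at least 400 vertices,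
      so two inner arms of length 10 fit between them.\<close>
    hence ij20: "i + 21 \<le> j" "i' + 21 \<le> j'" using long' j unfolding i'_def j'_def by auto
    have "j + 4 < length xs \<or> 4 \<le> i \<or> (i = 3 \<and> j + 4 = length xs)" using arms by linarith
    moreover have "j' + 4 < length xs" if "4 \<le> i" using that ij j unfolding j'_def by simp
    ultimately consider "j + 4 < length xs" | "j' + 4 < length xs" | "i = 3" "j + 4 = length xs" by blast
    thus ?thesis
    proof cases
      case 1
      thus ?thesis using no_leaves_2_10_10_4[OF l ne] i ij20 by simp
    next
      case 2
      thus ?thesis using R.no_leaves_2_10_10_4[OF rl(2,1) ne[symmetric]] ij' ij20
        unfolding i'_def[symmetric] j'_def[symmetric] by simp
    next
      case 3
      thus ?thesis using no_leaves_3_8_8_3[OF l ne] ij20 by simp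
    qed
  qed
qed

text \<open>A right outer arm of length at least 4 is settled by \<open>no_two_branches\<close>;
  lengths 2 and 3 use the second vertex of the branch.\<close>

lemma no_long_branch_leaf_B:
  assumes i: "i \<in> D" "i = 2" and j: "j \<in> B" "i < j" "j + 3 \<le> length xs"
  shows False
proof (cases "j + 5 \<le> length xs")
  case True
  thus ?thesis using no_two_branches[OF D_B[OF i(1)] j(1)] i j by simp
next
  case False
  have ne: "lf i \<noteq> lf j" "tw i \<noteq> lf j" using lf_inj[OF D_B[OF i(1)] j(1)] tw_ne_lf[OF i(1) j(1)] j by auto
  show ?thesis
    using no_long_branch_leaf[OF leaf_lf[OF D_B[OF i(1)]] _ _ _ leaf_lf[OF j(1)] ne] tw[OF i(1)] i(2) j False long'
    by simp
qed

lemma B_gap: "i \<in> B \<Longrightarrow> j \<in> B \<Longrightarrow> i < j \<Longrightarrow> i + 3 \<le> j"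
  using leaf_gap[OF leaf_lf leaf_lf] by blast

text \<open>The neighbourhood lemmas show that the right side is closed under adjacency, and the
  tree is connected.\<close>

lemma verts_eq: "pverts G = set xs \<union> lf ` B \<union> tw ` D"
proof
  have x0: "xs ! 0 \<in> set xs" using long' by (intro nth_mem) auto
  show "pverts G \<subseteq> set xs \<union> lf ` B \<union> tw ` D"
  proof (rule connected_closure[OF graph, of "xs ! 0"])
    fix u v assume u: "u \<in> set xs \<union> lf ` B \<union> tw ` D" and uv: "(u, v) \<in> parcs G"
    consider j where "j < length xs" "u = xs ! j" | i where "i \<in> B" "u = lf i" | i where "i \<in> D" "u = tw i"
      using u by (auto simp: in_set_conv_nth)
    thus "v \<in> set xs \<union> lf ` B \<union> tw ` D"
    proof cases
      case 1 thus ?thesis using nbr_path[OF 1(1), of v] uv by auto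
    next
      case 2 thus ?thesis using nbr_lf[OF 2(1), of v] uv B_less(1)[OF 2(1)] by auto
    next
      case 3 thus ?thesis using nbr_tw[OF 3(1), of v] uv D_B by auto
    qed
  qed (use x0 verts tree in \<open>auto simp: tree_graph_def\<close>)
  show "set xs \<union> lf ` B \<union> tw ` D \<subseteq> pverts G"
    using verts lf_notin(2) tw by blast
qed

lemma card_verts: "card (pverts G) = length xs + card B + card D"
proof -
  have finD: "finite D" using finite_B D_B by (meson finite_subset subsetI)
  have "card (pverts G) = card (set xs \<union> lf ` B) + card (tw ` D)"
    unfolding verts_eq by (rule card_Un_disjoint) (use finite_B finD tw tw_ne_lf in auto)
  also have "card (set xs \<union> lf ` B) = card (set xs) + card (lf ` B)"
    by (rule card_Un_disjoint) (use finite_B lf_notin(1) in auto)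
  also have "card (set xs) = length xs" using dist by (rule distinct_card)
  also have "card (lf ` B) = card B" by (rule card_image) (auto simp: inj_on_def lf_inj)
  also have "card (tw ` D) = card D" by (rule card_image) (auto simp: inj_on_def tw_inj)
  finally show ?thesis .
qed

end

section \<open>Isomorphisms with the named trees\<close>

text \<open>\<open>g\<close> goes from the named tree to \<open>G\<close>, since the coordinates of
  \<open>H\<close> are explicit; the isomorphism itself is its inverse. Arcs of \<open>G\<close> are
  traced back one vertex at a time, as its neighbourhoods are known in that form.\<close>

lemma digraph_isoI:
  assumes G: "pair_graph G" and inj: "inj_on g (pverts H)" and img: "g ` pverts H = pverts G"
    and HV: "parcs H \<subseteq> pverts H \<times> pverts H"
    and fwd: "\<And>a b. (a, b) \<in> parcs H \<Longrightarrow> (g a, g b) \<in> parcs G"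
    and bwd: "\<And>a v. a \<in> pverts H \<Longrightarrow> (g a, v) \<in> parcs G \<Longrightarrow> \<exists>b. (a, b) \<in> parcs H \<and> g b = v"
  shows "digraph_iso (with_proj G) (with_proj H)"
proof -
  interpret pair_graph G by fact
  define f where "f = the_inv_into (pverts H) g"
  have fg: "f (g a) = a" if "a \<in> pverts H" for a
    unfolding f_def by (rule the_inv_into_f_f[OF inj that])
  have bij: "inj_on f (pverts G)" "f ` pverts G = pverts H"
    unfolding f_def img[symmetric] using inj_on_the_inv_into[OF inj] the_inv_into_onto[OF inj] by auto
  have arc: "parcs H = map_prod f f ` parcs G"
  proof
    show "parcs H \<subseteq> map_prod f f ` parcs G"
    proof
      fix e assume e: "e \<in> parcs H"
      obtain a b where ab: "e = (a, b)" by fastforce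
      hence "a \<in> pverts H" "b \<in> pverts H" using e HV by auto
      hence "e = map_prod f f (g a, g b)" using fg ab by simp
      moreover have "(g a, g b) \<in> parcs G" using fwd e ab by simp
      ultimately show "e \<in> map_prod f f ` parcs G" by (rule image_eqI)
    qed
    show "map_prod f f ` parcs G \<subseteq> parcs H"
    proof
      fix e assume "e \<in> map_prod f f ` parcs G"
      then obtain u v where uv: "(u, v) \<in> parcs G" "e = (f u, f v)" by auto
      hence "u \<in> g ` pverts H" "v \<in> g ` pverts H" using wellformed' img by auto
      then obtain a b where ab: "a \<in> pverts H" "u = g a" "b \<in> pverts H" "v = g b" by blast
      then obtain b' where b': "(a, b') \<in> parcs H" "g b' = g b" using bwd uv by blast
      hence "b' = b" using inj ab HV by (auto dest: inj_onD)
      thus "e \<in> parcs H" using b' uv ab fg by simp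
    qed
  qed
  define F where "F = \<lparr>iso_verts = f, iso_arcs = map_prod f f, iso_head = snd, iso_tail = fst\<rparr>"
  have "inj_on (map_prod f f) (parcs G)"
  proof (rule inj_onI)
    fix x y assume xy: "x \<in> parcs G" "y \<in> parcs G" "map_prod f f x = map_prod f f y"
    hence "fst x = fst y" "snd x = snd y"
      using bij(1) arc_fst_in_verts arc_snd_in_verts by (auto simp: map_prod_def case_prod_unfold dest: inj_onD)
    thus "x = y" by (simp add: prod_eq_iff)
  qed
  hence "digraph_isomorphism F"
    unfolding digraph_isomorphism_def F_def using bij(1) by (simp add: wf_digraph_axioms)
  moreover have "with_proj H = app_iso F (with_proj G)"
    unfolding app_iso_def F_def using arc bij(2) by (simp add: with_proj_def)
  ultimately show ?thesis unfolding digraph_iso_def by blast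
qed

context long_spine begin

definition attached :: "nat \<Rightarrow> nat" where "attached i = (if i \<in> D then 2 else 1)"

lemma iso_path_attach:
  assumes ms: "distinct ms" "set ms = B"
  shows "digraph_iso (with_proj G) (with_proj (path_attach (map attached ms) ms (length xs)))"
proof -
  define p where "p = length xs"
  define H where "H = path_attach (map attached ms) ms p"
  define E where "E = {((0::nat, j), (0::nat, Suc j)) | j. Suc j < p}
            \<union> {((Suc i, j), (Suc i, Suc j)) | i j. i < length ms \<and> Suc j < attached (ms ! i)}
            \<union> {((0, ms ! i), (Suc i, 0)) | i. i < length ms}"
  have HV: "pverts H = {(0, j) | j. j < p} \<union> {(Suc i, j) | i j. i < length ms \<and> j < attached (ms ! i)}"
    unfolding H_def path_attach_def Let_def by (simp cong: conj_cong)
  have HE: "parcs H = E \<union> E\<inverse>"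
    unfolding H_def path_attach_def Let_def E_def by (simp cong: conj_cong)
  have mB: "ms ! i \<in> B" if "i < length ms" for i using nth_mem[OF that] ms(2) by blast
  have mp: "ms ! i < p" if "i < length ms" for i using B_less(1)[OF mB[OF that]] p_def by simp
  have minj: "ms ! i = ms ! j \<longleftrightarrow> i = j" if "i < length ms" "j < length ms" for i j
    using ms(1) that by (simp add: nth_eq_iff_index_eq)
  have att: "j < attached i \<longleftrightarrow> j = 0 \<or> (j = 1 \<and> i \<in> D)" for i j unfolding attached_def by auto
  \<comment> \<open>The main path goes to \<open>xs\<close>, the start of the attached path number
    \<open>Suc i\<close> to \<open>lf (ms ! i)\<close>, and its second vertex, if present, to
    \<open>tw (ms ! i)\<close>.\<close>
  define g where "g = (\<lambda>(i, j). case i of 0 \<Rightarrow> xs ! j | Suc i \<Rightarrow> if j = (0::nat) then lf (ms ! i) else tw (ms ! i))"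
  have g [simp]: "g (0, j) = xs ! j" "g (Suc i, 0) = lf (ms ! i)" "g (Suc i, Suc j) = tw (ms ! i)" for i j
    unfolding g_def by simp_all
  have vH: "(0, j) \<in> pverts H \<longleftrightarrow> j < p" "(Suc i, 0) \<in> pverts H \<longleftrightarrow> i < length ms"
    "(Suc i, Suc j) \<in> pverts H \<longleftrightarrow> i < length ms \<and> j = 0 \<and> ms ! i \<in> D" for i j
    unfolding HV by (auto simp: att)
  have "(\<exists>j<p. a = (0, j)) \<or> (\<exists>i<length ms. a = (Suc i, 0)) \<or> (\<exists>i<length ms. ms ! i \<in> D \<and> a = (Suc i, 1))"
    if aH: "a \<in> pverts H" for a
  proof -
    consider (1) j where "a = (0, j)" "j < p" | (2) i j where "a = (Suc i, j)" "i < length ms" "j < attached (ms ! i)"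
      using aH unfolding HV by blast
    thus ?thesis
    proof cases
      case 1 thus ?thesis by blast
    next
      case 2
      hence "j = 0 \<or> (j = 1 \<and> ms ! i \<in> D)" by (simp add: att)
      thus ?thesis using 2 by blast
    qed
  qed
  hence vcases: "thesis" if "a \<in> pverts H" "\<And>j. a = (0, j) \<Longrightarrow> j < p \<Longrightarrow> thesis"
    "\<And>i. a = (Suc i, 0) \<Longrightarrow> i < length ms \<Longrightarrow> thesis"
    "\<And>i. a = (Suc i, 1) \<Longrightarrow> i < length ms \<Longrightarrow> ms ! i \<in> D \<Longrightarrow> thesis" for a thesis
    using that by blast
  have xin: "xs ! j \<in> set xs" if "j < p" for j using that p_def by simp
  have "inj_on g (pverts H)"
  proof (rule inj_onI)
    fix a b assume a: "a \<in> pverts H" and b: "b \<in> pverts H" and e: "g a = g b"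
    have s1: "xs ! j \<noteq> lf (ms ! i)" "lf (ms ! i) \<noteq> xs ! j" if "j < p" "i < length ms" for i j
      using lf_notin(1)[OF mB[OF that(2)]] xin[OF that(1)] by metis+
    have s2: "xs ! j \<noteq> tw (ms ! i)" "tw (ms ! i) \<noteq> xs ! j" if "j < p" "ms ! i \<in> D" for i j
      using tw[OF that(2)] xin[OF that(1)] by metis+
    have s3: "tw (ms ! i) \<noteq> lf (ms ! j)" "lf (ms ! j) \<noteq> tw (ms ! i)" if "ms ! i \<in> D" "j < length ms" for i j
      using tw_ne_lf[OF that(1) mB[OF that(2)]] by metis+
    show "a = b"
      by (rule vcases[OF a]; rule vcases[OF b])
        (use e in \<open>auto simp: s1 s2 s3 nth_eq lf_inj mB minj tw_inj p_def\<close>)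
  qed
  moreover have "g ` pverts H = pverts G"
  proof
    show "g ` pverts H \<subseteq> pverts G"
    proof
      fix v assume "v \<in> g ` pverts H"
      then obtain a where a: "a \<in> pverts H" "v = g a" by auto
      show "v \<in> pverts G"
        by (rule vcases[OF a(1)]) (use a(2) xin verts lf_notin(2) mB tw in auto)
    qed
    show "pverts G \<subseteq> g ` pverts H"
    proof
      fix v assume v: "v \<in> pverts G"
      consider j where "j < p" "v = xs ! j" | i where "i \<in> B" "v = lf i" | i where "i \<in> D" "v = tw i"
        using v unfolding verts_eq p_def by (auto simp: in_set_conv_nth)
      thus "v \<in> g ` pverts H"
      proof cases
        case (1 j) thus ?thesis by (intro image_eqI[of _ _ "(0, j)"]) (auto simp: vH)
      next
        case (2 i)
        then obtain l where "l < length ms" "ms ! l = i" using ms(2) by (metis in_set_conv_nth)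
        thus ?thesis using 2 by (intro image_eqI[of _ _ "(Suc l, 0)"]) (auto simp: vH)
      next
        case (3 i)
        then obtain l where "l < length ms" "ms ! l = i" using ms(2) D_B by (metis in_set_conv_nth)
        thus ?thesis using 3 by (intro image_eqI[of _ _ "(Suc l, Suc 0)"]) (auto simp: vH)
      qed
    qed
  qed
  moreover have "parcs H \<subseteq> pverts H \<times> pverts H"
    unfolding HE E_def using mp by (auto simp: vH att)
  moreover have "(g a, g b) \<in> parcs G" if "(a, b) \<in> parcs H" for a b
  proof -
    have "(g a, g b) \<in> parcs G" if abE: "(a, b) \<in> E" for a b
    proof -
      consider j where "a = (0, j)" "b = (0, Suc j)" "Suc j < p"
        | i where "a = (Suc i, 0)" "b = (Suc i, Suc 0)" "i < length ms" "ms ! i \<in> D"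
        | i where "a = (0, ms ! i)" "b = (Suc i, 0)" "i < length ms"
        using abE unfolding E_def by (auto simp: att)
      thus ?thesis
      proof cases
        case 1 thus ?thesis using nbr_path p_def by simp
      next
        case 2 thus ?thesis using nbr_lf[OF mB[OF 2(3)]] by simp
      next
        case 3 thus ?thesis using nbr_lf[OF mB[OF 3(3)]] sym by simp
      qed
    qed
    thus ?thesis using that sym unfolding HE by blast
  qed
  moreover have "\<exists>b. (a, b) \<in> parcs H \<and> g b = v" if a: "a \<in> pverts H" and v: "(g a, v) \<in> parcs G" for a v
  proof (rule vcases[OF a])
    fix j assume j: "a = (0, j)" "j < p"
    consider "1 \<le> j" "v = xs ! (j - 1)" | "Suc j < p" "v = xs ! Suc j" | "j \<in> B" "v = lf j"
      using v j nbr_path[of j v] p_def by auto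
    thus ?thesis
    proof cases
      case 1 thus ?thesis using j by (intro exI[of _ "(0, j - 1)"]) (auto simp: HE E_def)
    next
      case 2 thus ?thesis using j by (intro exI[of _ "(0, Suc j)"]) (auto simp: HE E_def)
    next
      case 3
      then obtain l where "l < length ms" "ms ! l = j" using ms(2) by (metis in_set_conv_nth)
      thus ?thesis using j 3 by (intro exI[of _ "(Suc l, 0)"]) (auto simp: HE E_def)
    qed
  next
    fix i assume i: "a = (Suc i, 0)" "i < length ms"
    consider "v = xs ! (ms ! i)" | "ms ! i \<in> D" "v = tw (ms ! i)"
      using v i nbr_lf[OF mB[OF i(2)]] by auto
    thus ?thesis
    proof cases
      case 1 thus ?thesis using i by (intro exI[of _ "(0, ms ! i)"]) (auto simp: HE E_def)
    next
      case 2 thus ?thesis using i by (intro exI[of _ "(Suc i, Suc 0)"]) (auto simp: HE E_def att)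
    qed
  next
    fix i assume i: "a = (Suc i, 1)" "i < length ms" "ms ! i \<in> D"
    thus ?thesis using v nbr_tw by (intro exI[of _ "(Suc i, 0)"]) (auto simp: HE E_def att)
  qed
  ultimately show ?thesis unfolding H_def p_def by (intro digraph_isoI[OF graph, where g = g])
qed

lemma iso_T_tree:
  assumes B: "B = {m}"
  shows "digraph_iso (with_proj G) (with_proj (T_tree (attached m) m (length xs - 1 - m)))"
proof -
  define p where "p = length xs"
  define c where "c = p - 1 - m"
  have mB: "m \<in> B" using B by simp
  have m: "m < p" "1 \<le> m" "m + c + 1 = p" using B_less[OF mB] unfolding c_def p_def by auto
  define H where "H = T_tree (attached m) m c"
  define q where "q = (\<lambda>(i::nat, j::nat). if j = 0 then (0, 0) else (i, j))"
  define arm where "arm i = [attached m, m, c] ! i" for i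
  define E where "E = {(q (i, j), q (i, Suc j)) | i j. i < 3 \<and> j < arm i}"
  have HV: "pverts H = {q (i, j) | i j. i < 3 \<and> j \<le> arm i}" and HE: "parcs H = E \<union> E\<inverse>"
    unfolding H_def T_tree_def Let_def E_def q_def arm_def by (auto simp: numeral_3_eq_3)
  have arm [simp]: "arm 0 = attached m" "arm (Suc 0) = m" "arm 2 = c" unfolding arm_def by simp_all
  \<comment> \<open>Arm 0 is the branch, arms 1 and 2 run from \<open>xs ! m\<close> to the left and
    to the right end of the path. All \<open>(i, 0)\<close> get the same image, so \<open>g\<close>
    respects the identification \<open>q\<close>.\<close>
  define g where "g = (\<lambda>(i::nat, j::nat). if j = 0 then xs ! m else if i = 0 then (if j = 1 then lf m else tw m)
      else if i = 1 then xs ! (m - j) else xs ! (m + j))"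
  have gq: "g (q a) = g a" for a unfolding g_def q_def by (auto split: prod.splits)
  have g [simp]: "g (0, 0) = xs ! m" "g (i, 0) = xs ! m" "g (0, Suc 0) = lf m" "g (0, 2) = tw m"
    "g (0, Suc (Suc 0)) = tw m"
    "g (Suc 0, j) = xs ! (m - j)" "g (2, j) = xs ! (m + j)" for i j unfolding g_def by auto
  have q [simp]: "q (i, 0) = (0, 0)" "q (i, Suc j) = (i, Suc j)" for i j unfolding q_def by auto
  have att: "attached m = (if m \<in> D then 2 else 1)" by (simp add: attached_def)
  have vcases: "thesis" if aH: "a \<in> pverts H" and t: "a = (0, 0) \<Longrightarrow> thesis"
    "a = (0, 1) \<Longrightarrow> thesis" "m \<in> D \<Longrightarrow> a = (0, 2) \<Longrightarrow> thesis"
    "\<And>j. a = (Suc 0, j) \<Longrightarrow> 1 \<le> j \<Longrightarrow> j \<le> m \<Longrightarrow> thesis"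
    "\<And>j. a = (2, j) \<Longrightarrow> 1 \<le> j \<Longrightarrow> j \<le> c \<Longrightarrow> thesis" for a thesis
  proof -
    have "\<exists>i j. a = q (i, j) \<and> i < 3 \<and> j \<le> arm i" using aH unfolding HV by simp
    then obtain i j where ij: "a = q (i, j)" "i < 3" "j \<le> arm i" by blast
    show thesis
    proof (cases "j = 0")
      case True thus ?thesis using t(1) ij(1) by simp
    next
      case False
      hence a: "a = (i, j)" "1 \<le> j" using ij(1) unfolding q_def by auto
      have "i = 0 \<or> i = Suc 0 \<or> i = 2" using ij(2) by linarith
      then consider "i = 0" | "i = Suc 0" | "i = 2" by blast
      thus ?thesis
      proof cases
        case 1
        hence "j \<le> attached m" using ij(3) by simp
        hence "j \<le> 2" "m \<notin> D \<Longrightarrow> j \<le> 1" by (simp_all add: att split: if_splits)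
        hence "j = 1 \<or> (j = 2 \<and> m \<in> D)" using a(2) by linarith
        thus ?thesis using t(2,3) a(1) 1 by blast
      next
        case 2
        hence "j \<le> m" using ij(3) by simp
        thus ?thesis using t(4)[of j] a 2 by blast
      next
        case 3
        hence "j \<le> c" using ij(3) by simp
        thus ?thesis using t(5)[of j] a 3 by blast
      qed
    qed
  qed
  have qH: "q (i, j) \<in> pverts H" if "i < 3" "j \<le> arm i" for i j unfolding HV using that by blast
  have vH: "(0, 0) \<in> pverts H" "(0, Suc 0) \<in> pverts H" "m \<in> D \<Longrightarrow> (0, 2) \<in> pverts H"
    "1 \<le> j \<Longrightarrow> j \<le> m \<Longrightarrow> (Suc 0, j) \<in> pverts H" "1 \<le> j \<Longrightarrow> j \<le> c \<Longrightarrow> (2, j) \<in> pverts H" for j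
    using qH[of 0 0] qH[of 0 "Suc 0"] qH[of 0 2] qH[of "Suc 0" j] qH[of 2 j]
    by (simp_all add: att q_def split: if_splits)
  have xin: "xs ! j \<in> set xs" if "j < p" for j using that p_def by simp
  have inj: "inj_on g (pverts H)"
  proof (rule inj_onI)
    fix a b assume a: "a \<in> pverts H" and b: "b \<in> pverts H" and e: "g a = g b"
    have s1: "xs ! j \<noteq> lf m" "lf m \<noteq> xs ! j" if "j < p" for j
      using lf_notin(1)[OF mB] xin[OF that] by metis+
    have s2: "xs ! j \<noteq> tw m" "tw m \<noteq> xs ! j" if "j < p" "m \<in> D" for j
      using tw[OF that(2)] xin[OF that(1)] by metis+
    have s3: "tw m \<noteq> lf m" "lf m \<noteq> tw m" if "m \<in> D"
      using tw_ne_lf[OF that mB] by metis+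
    show "a = b"
      by (rule vcases[OF a]; rule vcases[OF b])
        (use e m in \<open>auto simp: s1 s2 s3 nth_eq p_def[symmetric]\<close>)
  qed
  have img: "g ` pverts H = pverts G"
  proof
    show "g ` pverts H \<subseteq> pverts G"
    proof
      fix v assume "v \<in> g ` pverts H"
      then obtain a where a: "a \<in> pverts H" "v = g a" by auto
      have "xs ! j \<in> pverts G" if "j < p" for j using xin[OF that] verts by blast
      hence "g a \<in> pverts G"
        using lf_notin(2)[OF mB] tw[of m] m by - (rule vcases[OF a(1)], auto)
      thus "v \<in> pverts G" using a(2) by simp
    qed
    show "pverts G \<subseteq> g ` pverts H"
    proof
      fix v assume v: "v \<in> pverts G"
      have "v \<in> set xs \<or> v = lf m \<or> (m \<in> D \<and> v = tw m)" using v D_B unfolding verts_eq B by blast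
      then consider j where "j < p" "v = xs ! j" | "v = lf m" | "m \<in> D" "v = tw m"
        unfolding in_set_conv_nth p_def by blast
      thus "v \<in> g ` pverts H"
      proof cases
        case (1 j)
        consider "j = m" | "j < m" | "m < j" by linarith
        thus ?thesis
        proof cases
          case 1 thus ?thesis using \<open>v = xs ! j\<close> vH(1) by (intro image_eqI[of _ _ "(0, 0)"]) auto
        next
          case 2 thus ?thesis using \<open>v = xs ! j\<close> by (intro image_eqI[of _ _ "(Suc 0, m - j)"]) (auto intro!: vH)
        next
          case 3 thus ?thesis using \<open>v = xs ! j\<close> \<open>j < p\<close> m
            by (intro image_eqI[of _ _ "(2, j - m)"]) (auto intro!: vH)
        qed
      next
        case 2 thus ?thesis using vH(2) by (intro image_eqI[of _ _ "(0, Suc 0)"]) auto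
      next
        case 3 thus ?thesis using vH(3) by (intro image_eqI[of _ _ "(0, 2)"]) auto
      qed
    qed
  qed
  have sub: "parcs H \<subseteq> pverts H \<times> pverts H"
  proof -
    have "E \<subseteq> pverts H \<times> pverts H"
    proof
      fix e assume "e \<in> E"
      then obtain i j where "e = (q (i, j), q (i, Suc j))" "i < 3" "j < arm i" unfolding E_def by blast
      thus "e \<in> pverts H \<times> pverts H" using qH[of i j] qH[of i "Suc j"] by simp
    qed
    thus ?thesis unfolding HE by blast
  qed
  have fwd: "(g a, g b) \<in> parcs G" if "(a, b) \<in> parcs H" for a b
  proof -
    have "(g a, g b) \<in> parcs G" if abE: "(a, b) \<in> E" for a b
    proof -
      obtain i j where ij: "g a = g (i, j)" "g b = g (i, Suc j)" "i < 3" "j < arm i"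
        using abE unfolding E_def by (auto simp only: mem_Collect_eq prod.inject gq)
      consider "i = 0" "j = 0" | "i = 0" "j = Suc 0" "m \<in> D" | "i = Suc 0" "j < m" | "i = 2" "j < c"
      proof -
        have "i = 0 \<or> i = Suc 0 \<or> i = 2" using ij(3) by linarith
        moreover have "j = 0 \<or> (j = Suc 0 \<and> m \<in> D)" if "i = 0"
        proof -
          have "j < attached m" using ij(4) that by simp
          hence "j < 2" "m \<notin> D \<Longrightarrow> j < 1" by (simp_all add: att split: if_splits)
          thus ?thesis by linarith
        qed
        moreover have "j < m" if "i = Suc 0" using ij(4) that by simp
        moreover have "j < c" if "i = 2" using ij(4) that by simp
        ultimately show thesis using that by blast
      qed
      thus ?thesis
      proof cases
        case 1 thus ?thesis using ij nbr_lf[OF mB] sym by simp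
      next
        case 2 thus ?thesis using ij nbr_lf[OF mB] by simp
      next
        case 3
        hence "1 \<le> m - j" "m - j < length xs" "xs ! (m - Suc j) = xs ! (m - j - 1)" using m p_def by auto
        hence "(xs ! (m - j), xs ! (m - Suc j)) \<in> parcs G" using nbr_path by blast
        thus ?thesis using ij 3 by simp
      next
        case 4 thus ?thesis using ij nbr_path[of "m + j" "xs ! (m + Suc j)"] m p_def by simp
      qed
    qed
    thus ?thesis using that sym unfolding HE by blast
  qed
  have E1: "i < 3 \<Longrightarrow> j < arm i \<Longrightarrow> (q (i, j), q (i, Suc j)) \<in> parcs H"
    "i < 3 \<Longrightarrow> j < arm i \<Longrightarrow> (q (i, Suc j), q (i, j)) \<in> parcs H" for i j
    unfolding HE E_def by blast+
  have a0: "0 < attached m" by (simp add: att)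
  have bwd: "\<exists>b. (a, b) \<in> parcs H \<and> g b = v" if a: "a \<in> pverts H" and v: "(g a, v) \<in> parcs G" for a v
  proof (rule vcases[OF a])
    assume [simp]: "a = (0, 0)"
    consider "v = xs ! (m - 1)" | "Suc m < p" "v = xs ! Suc m" | "v = lf m"
      using v nbr_path[of m v] m p_def by auto
    thus ?thesis
    proof cases
      case 1 thus ?thesis using E1(1)[of "Suc 0" 0] m by (intro exI[of _ "(Suc 0, Suc 0)"]) auto
    next
      case 2 thus ?thesis using E1(1)[of 2 0] m by (intro exI[of _ "(2, Suc 0)"]) auto
    next
      case 3 thus ?thesis using E1(1)[of 0 0] a0 by (intro exI[of _ "(0, Suc 0)"]) auto
    qed
  next
    assume a: "a = (0, 1)"
    consider "v = xs ! m" | "m \<in> D" "v = tw m" using v a nbr_lf[OF mB, of v] by auto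
    thus ?thesis
    proof cases
      case 1 thus ?thesis using E1(2)[of 0 0] a0 a by (intro exI[of _ "(0, 0)"]) auto
    next
      case 2 thus ?thesis using E1(1)[of 0 "Suc 0"] a by (intro exI[of _ "(0, 2)"]) (auto simp: att numeral_2_eq_2)
    qed
  next
    assume a: "m \<in> D" "a = (0, 2)"
    thus ?thesis using E1(2)[of 0 "Suc 0"] v nbr_tw[OF a(1)]
      by (intro exI[of _ "(0, Suc 0)"]) (auto simp: att numeral_2_eq_2)
  next
    fix j assume a: "a = (Suc 0, j)" "1 \<le> j" "j \<le> m"
    then obtain j' where j': "j = Suc j'" by (cases j) auto
    have nB: "m - j \<notin> B" using B a m by auto
    have lt: "m - j < length xs" using m p_def by simp
    consider "m - j \<ge> 1" "v = xs ! (m - j - 1)" | "v = xs ! (m - j')"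
      using v a nbr_path[OF lt, of v] nB j' by (auto simp: Suc_diff_Suc)
    thus ?thesis
    proof cases
      case 1 thus ?thesis using E1(1)[of "Suc 0" j] j' a by (intro exI[of _ "(Suc 0, Suc j)"]) auto
    next
      \<comment> \<open>For \<open>j' = 0\<close> the neighbour is the branch vertex, hence the
        witness \<open>q (Suc 0, j')\<close> instead of \<open>(Suc 0, j')\<close>.\<close>
      case 2 thus ?thesis using E1(2)[of "Suc 0" j'] j' a gq[of "(Suc 0, j')"] by (intro exI[of _ "q (Suc 0, j')"]) auto
    qed
  next
    fix j assume a: "a = (2, j)" "1 \<le> j" "j \<le> c"
    then obtain j' where j': "j = Suc j'" by (cases j) auto
    have nB: "m + j \<notin> B" using B a m by auto
    consider "Suc (m + j) < p" "v = xs ! (m + Suc j)" | "v = xs ! (m + j')"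
      using v a nbr_path[of "m + j" v] m nB p_def j' by auto
    thus ?thesis
    proof cases
      case 1 thus ?thesis using E1(1)[of 2 j] j' a m by (intro exI[of _ "(2, Suc j)"]) auto
    next
      case 2 thus ?thesis using E1(2)[of 2 j'] j' a gq[of "(2, j')"] by (intro exI[of _ "q (2, j')"]) auto
    qed
  qed
  have "digraph_iso (with_proj G) (with_proj H)"
    by (rule digraph_isoI[OF graph inj img sub fwd bwd])
  thus ?thesis unfolding H_def c_def p_def .
qed

end

section \<open>Classification\<close>

context long_spine begin

text \<open>If both positions carry a leaf, the tree is the extended Dynkin diagram of type D, and
  \<open>h\<close> is its eigenvector for the eigenvalue 2: value 1 at the two ends and the two
  leaves, 2 elsewhere. With fewer leaves the same values are superharmonic.\<close>

lemma eigenvalue_sum_less_if_B_subset: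
  assumes B: "B \<subseteq> {1, length xs - 2}"
  shows "eigenvalue_sum k G < 2 * real k"
proof -
  define p where "p = length xs"
  have p: "400 \<le> p" using long' p_def by simp
  have D: "D = {}" using D_position D_B B p unfolding p_def by fastforce
  define L where "L = {xs ! 0, xs ! (p - 1)} \<union> lf ` B"
  define h where "h v = (if v \<in> L then 1 else 2 :: real)" for v
  have h: "1 \<le> h v" "h v \<le> 2" for v unfolding h_def by auto
  have lfx: "lf i \<noteq> xs ! j" if "i \<in> B" "j < p" for i j
    using lf_notin(1)[OF that(1)] that(2) p_def by (metis nth_mem)
  have hx: "h (xs ! j) = 2" if "j \<noteq> 0" "j < p - 1" for j
  proof -
    have "j < length xs" "xs \<noteq> []" using that p_def by auto
    hence "xs ! j \<noteq> xs ! 0" "xs ! j \<noteq> xs ! (p - 1)" using that nth_eq[of j 0] nth_eq[of j "p - 1"] p unfolding p_def by auto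
    moreover have "xs ! j \<notin> lf ` B" using lfx[of _ j] that by fastforce
    ultimately show ?thesis unfolding h_def L_def by simp
  qed
  show ?thesis
  proof (rule eigenvalue_sum_less_if_superharmonic[OF graph _ k2])
    show "connected (with_proj G)" using tree unfolding tree_graph_def by simp
    show "0 < h v" for v using h(1)[of v] by simp
    have "k \<le> (k + 2) * r" using r100 by (cases r) auto
    also have "\<dots> \<le> card (pverts G)" using long card_verts by simp
    finally show "k \<le> card (pverts G)" .
    fix v assume "v \<in> pverts G"
    then consider j where "j < p" "v = xs ! j" | i where "i \<in> B" "v = lf i"
      unfolding verts_eq D p_def by (auto simp: in_set_conv_nth)
    thus "(\<Sum>w | (v, w) \<in> parcs G. h w) \<le> 2 * h v"
    proof cases
      case (2 i)
      have "{w. (v, w) \<in> parcs G} = {xs ! i}" using 2 nbr_lf D by auto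
      thus ?thesis using h(2)[of "xs ! i"] h(1)[of v] by simp
    next
      case (1 j)
      have bound: "(\<Sum>w | (v, w) \<in> parcs G. h w) \<le> (\<Sum>w\<in>W. h w)"
        if "{w. (v, w) \<in> parcs G} \<subseteq> W" "finite W" for W
        by (rule sum_mono2) (use that h(1) in \<open>auto intro: order_trans[OF zero_le_one]\<close>)
      have nb: "{w. (v, w) \<in> parcs G} \<subseteq> (if 1 \<le> j then {xs ! (j - 1)} else {}) \<union>
          (if Suc j < p then {xs ! Suc j} else {}) \<union> (if j \<in> B then {lf j} else {})"
        using nbr_path[of j] 1 p_def by auto
      consider "j = 0" | "j = p - 1" | "1 \<le> j" "j < p - 1" using 1(1) by linarith
      thus ?thesis
      proof cases
        case a: 1
        hence "j \<notin> B" using B_less(2) by fastforce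
        hence "{w. (v, w) \<in> parcs G} \<subseteq> {xs ! Suc 0}" using nb a by (auto split: if_splits)
        from bound[OF this] show ?thesis using h(2)[of "xs ! Suc 0"] h(1)[of v] by simp
      next
        case a: 2
        hence "j \<notin> B" using B_less(3)[of j] p_def p by auto
        hence "{w. (v, w) \<in> parcs G} \<subseteq> {xs ! (j - 1)}" using nb a p by (auto split: if_splits)
        from bound[OF this] show ?thesis using h(2)[of "xs ! (j - 1)"] h(1)[of v] by simp
      next
        case a: 3
        have hv: "h v = 2" using hx[of j] a 1 by simp
        have ne: "xs ! (j - 1) \<noteq> xs ! Suc j" using a p_def nth_eq[of "j - 1" "Suc j"] by auto
        show ?thesis
        proof (cases "j \<in> B")
          case False
          hence "{w. (v, w) \<in> parcs G} \<subseteq> {xs ! (j - 1), xs ! Suc j}" using nb by (auto split: if_splits)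
          from bound[OF this] have "(\<Sum>w | (v, w) \<in> parcs G. h w) \<le> h (xs ! (j - 1)) + h (xs ! Suc j)"
            using ne by simp
          thus ?thesis using h(2)[of "xs ! (j - 1)"] h(2)[of "xs ! Suc j"] hv by simp
        next
          case True
          define W where "W = {xs ! (j - 1), xs ! Suc j, lf j}"
          have "{w. (v, w) \<in> parcs G} \<subseteq> W" using nb unfolding W_def by (auto split: if_splits)
          from bound[OF this] have "(\<Sum>w | (v, w) \<in> parcs G. h w) \<le> (\<Sum>w\<in>W. h w)" unfolding W_def by simp
          also have "\<dots> = h (xs ! (j - 1)) + h (xs ! Suc j) + h (lf j)"
          proof -
            have "xs ! (j - 1) \<noteq> lf j" "xs ! Suc j \<noteq> lf j"
              using lfx[OF True, of "j - 1", symmetric] lfx[OF True, of "Suc j", symmetric] a by simp_all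
            thus ?thesis using ne unfolding W_def by simp
          qed
          also have "h (lf j) = 1" using True unfolding h_def L_def by simp
          \<comment> \<open>A vertex with a leaf is next to an end of the path, where
            \<open>h\<close> is 1 instead of 2; this pays for the leaf.\<close>
          also have "h (xs ! (j - 1)) + h (xs ! Suc j) \<le> 3"
          proof -
            have "j = 1 \<or> j = p - 2" using True B p_def by auto
            hence "xs ! (j - 1) \<in> L \<or> xs ! Suc j \<in> L"
              unfolding L_def using p by (auto simp: Suc_diff_Suc numeral_2_eq_2)
            hence "h (xs ! (j - 1)) = 1 \<or> h (xs ! Suc j) = 1" unfolding h_def by auto
            thus ?thesis using h(2)[of "xs ! (j - 1)"] h(2)[of "xs ! Suc j"] by linarith
          qed
          finally show ?thesis using hv by simp
        qed
      qed
    qed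
  qed
qed

section \<open>Arrangements of branches that are members of the family\<close>

lemma iso_list:
  assumes "sorted_list_of_set B = ms"
  shows "digraph_iso (with_proj G) (with_proj (path_attach (map attached ms) ms (length xs)))"
  by (rule iso_path_attach) (use assms finite_B in auto)

definition in_family :: bool where
  "in_family \<longleftrightarrow> (\<exists>H \<in> tree_family (card (pverts G)). digraph_iso (with_proj G) (with_proj H))"

lemma in_familyI: "H \<in> tree_family (card (pverts G)) \<Longrightarrow> digraph_iso (with_proj G) (with_proj H) \<Longrightarrow> in_family"
  unfolding in_family_def by blast

lemma in_family_single:
  assumes "B = {m}" "D = {}" "2 \<le> m" "m + 3 \<le> length xs"
  shows in_family
proof (rule in_familyI)
  have n: "card (pverts G) = length xs + 1" using card_verts assms(1,2) by simp
  show "digraph_iso (with_proj G) (with_proj (T_tree 1 m (length xs - 1 - m)))"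
    using iso_T_tree[OF assms(1)] assms(2) by (simp add: attached_def)
  have "length xs - 1 - m = card (pverts G) - m - 2" using n assms by simp
  moreover have "m \<in> {2..card (pverts G) - 4}" using n assms by simp
  ultimately show "T_tree 1 m (length xs - 1 - m) \<in> tree_family (card (pverts G))"
    unfolding tree_family_def by (intro UnI2 CollectI exI[of _ m]) simp
qed

lemma in_family_single_long:
  assumes "B = {2}" "D = {2}"
  shows in_family
proof (rule in_familyI)
  have n: "card (pverts G) = length xs + 2" using card_verts assms by simp
  show "digraph_iso (with_proj G) (with_proj (T_tree 2 2 (length xs - 3)))"
    using iso_T_tree[OF assms(1)] assms(2) by (simp add: attached_def numeral_3_eq_3)
  have "length xs - 3 = card (pverts G) - 5" using n by simp
  thus "T_tree 2 2 (length xs - 3) \<in> tree_family (card (pverts G))"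
    unfolding tree_family_def by simp
qed

lemma in_family_two:
  assumes B: "B = {a, b}" and D: "D = {}"
    and ab: "(a = 1 \<and> 4 \<le> b \<and> b + 3 \<le> length xs) \<or> (a = 2 \<and> b + 3 = length xs) \<or> (a = 2 \<and> b + 4 = length xs)"
  shows in_family
proof (rule in_familyI)
  have lt: "a < b" using ab long' by auto
  have n: "card (pverts G) = length xs + 2" using card_verts B D lt by simp
  have "sorted_list_of_set B = [a, b]" unfolding B using lt by simp
  from iso_list[OF this] show "digraph_iso (with_proj G) (with_proj (path_attach [1, 1] [a, b] (length xs)))"
    using D by (simp add: attached_def)
  have "length xs = card (pverts G) - 2" using n by simp
  moreover have "a = 1 \<and> b \<in> {4..card (pverts G) - 5} \<or> a = 2 \<and> b = card (pverts G) - 5 \<or> a = 2 \<and> b = card (pverts G) - 6"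
    using ab n by auto
  ultimately show "path_attach [1, 1] [a, b] (length xs) \<in> tree_family (card (pverts G))"
    unfolding tree_family_def by auto
qed

lemma in_family_two_long:
  assumes B: "B = {1, length xs - 3}" and D: "D = {length xs - 3}"
  shows in_family
proof (rule in_familyI)
  have n: "card (pverts G) = length xs + 3" using card_verts B D long' by simp
  have "sorted_list_of_set B = [1, length xs - 3]" unfolding B using long' by simp
  moreover have "1 \<noteq> length xs - 3" using long' by simp
  ultimately show "digraph_iso (with_proj G) (with_proj (path_attach [1, 2] [1, length xs - 3] (length xs)))"
    using iso_list[of "[1, length xs - 3]"] D by (simp add: attached_def)
  have "length xs = card (pverts G) - 3" "length xs - 3 = card (pverts G) - 6" using n by simp_all
  thus "path_attach [1, 2] [1, length xs - 3] (length xs) \<in> tree_family (card (pverts G))"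
    unfolding tree_family_def by simp
qed

lemma in_family_three:
  assumes B: "B = {1, a, length xs - 2}" and D: "D = {}" and a: "4 \<le> a" "a + 5 \<le> length xs"
  shows in_family
proof (rule in_familyI)
  have n: "card (pverts G) = length xs + 3" using card_verts B D a by simp
  have "sorted_list_of_set B = [1, a, length xs - 2]" unfolding B using a by simp
  from iso_list[OF this] show "digraph_iso (with_proj G) (with_proj (path_attach [1, 1, 1] [1, a, length xs - 2] (length xs)))"
    using D by (simp add: attached_def)
  have "length xs = card (pverts G) - 3" "length xs - 2 = card (pverts G) - 5" "a \<in> {4..card (pverts G) - 8}"
    using n a by simp_all
  thus "path_attach [1, 1, 1] [1, a, length xs - 2] (length xs) \<in> tree_family (card (pverts G))"
    unfolding tree_family_def by auto
qed

section \<open>Reversal, and the case distinction by the number of branches\<close>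

lemma B_rev_eq: "long_spine.B G (rev xs) = (\<lambda>i. length xs - Suc i) ` B"
proof
  interpret R: long_spine G k r "rev xs" by (rule long_spine_rev)
  show "(\<lambda>i. length xs - Suc i) ` B \<subseteq> R.B" using B_rev by auto
  show "R.B \<subseteq> (\<lambda>i. length xs - Suc i) ` B"
  proof
    fix i assume i: "i \<in> R.B"
    hence "length xs - Suc i \<in> B" using R.B_rev[OF i] by simp
    moreover have "i = length xs - Suc (length xs - Suc i)" using R.B_less(1)[OF i] by simp
    ultimately show "i \<in> (\<lambda>i. length xs - Suc i) ` B" by blast
  qed
qed

lemma D_rev: "i \<in> D \<Longrightarrow> length xs - Suc i \<in> long_spine.D G (rev xs)"
proof -
  interpret R: long_spine G k r "rev xs" by (rule long_spine_rev)
  assume i: "i \<in> D"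
  have iB: "length xs - Suc i \<in> R.B" using B_rev[OF D_B[OF i]] .
  have "R.lf (length xs - Suc i) = lf i"
    using R.leaf_unique[OF R.leaf_lf[OF iB] leaf_rev[OF leaf_lf[OF D_B[OF i]]]] .
  thus "length xs - Suc i \<in> R.D" unfolding R.D_def using iB tw[OF i] by auto
qed

lemma D_rev_eq: "long_spine.D G (rev xs) = (\<lambda>i. length xs - Suc i) ` D"
proof
  interpret R: long_spine G k r "rev xs" by (rule long_spine_rev)
  show "(\<lambda>i. length xs - Suc i) ` D \<subseteq> R.D" using D_rev by auto
  show "R.D \<subseteq> (\<lambda>i. length xs - Suc i) ` D"
  proof
    fix i assume i: "i \<in> R.D"
    hence "length xs - Suc i \<in> D" using R.D_rev[OF i] by simp
    moreover have "i = length xs - Suc (length xs - Suc i)" using R.B_less(1)[OF R.D_B[OF i]] by simp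
    ultimately show "i \<in> (\<lambda>i. length xs - Suc i) ` D" by blast
  qed
qed

lemma D_subset: "D \<subseteq> {2, length xs - 3}"
  using D_position by fastforce

text \<open>The family lists each shape in one orientation, so half of the cases are read off the
  reversed path. A branch of two vertices forces the other branch to be a leaf next to the opposite
  end; without one, either a leaf is next to an end or the outer arms have sum at most 5.\<close>

lemma in_family_if_pair:
  assumes B: "B = {a, b}" and ab: "a < b" and ns: "\<not> B \<subseteq> {1, length xs - 2}"
  shows in_family
proof -
  interpret R: long_spine G k r "rev xs" by (rule long_spine_rev)
  have fam: "R.in_family \<Longrightarrow> in_family" unfolding R.in_family_def in_family_def .
  define p where "p = length xs"
  have p: "400 \<le> p" using long' p_def by simp
  have mem: "a \<in> B" "b \<in> B" using B by auto
  have bd: "1 \<le> a" "a + 3 \<le> b" "b + 2 \<le> p"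
    using B_less[OF mem(1)] B_less[OF mem(2)] B_gap[OF mem ab] p_def by auto
  have RB: "R.B = {p - Suc b, p - Suc a}" unfolding B_rev_eq B p_def by auto
  have RD: "R.D = (\<lambda>i. p - Suc i) ` D" unfolding D_rev_eq p_def ..
  have DB: "D \<subseteq> {a, b}" using D_B B by blast
  have Dp: "D \<subseteq> {2, p - 3}" using D_subset p_def by simp
  have ps: "p - Suc b < p - Suc a" using bd ab by simp
  consider "2 \<in> D" | "p - 3 \<in> D" | "D = {}" using Dp by blast
  thus ?thesis
  proof cases
    case 1
    hence a2: "a = 2" using DB bd by auto
    have "\<not> b + 3 \<le> p" using no_long_branch_leaf_B[OF 1 refl mem(2)] ab a2 p_def by auto
    hence b: "b = p - 2" using bd by simp
    have "b \<notin> D" using Dp b p by auto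
    hence "D = {2}" using DB 1 a2 by blast
    hence "R.B = {1, length (rev xs) - 3}" "R.D = {length (rev xs) - 3}"
      using RB RD b a2 p p_def by auto
    from R.in_family_two_long[OF this] show ?thesis by (rule fam)
  next
    case 2
    hence b: "b = p - 3" using DB bd by (cases "a = p - 3") auto
    have "p - Suc (p - 3) \<in> R.D" unfolding RD using 2 by blast
    hence 2: "2 \<in> R.D" using p by (simp add: Suc_diff_le)
    have "p - Suc a \<in> R.B" using RB by simp
    moreover have "2 < p - Suc a" using bd b by arith
    ultimately have "\<not> p - Suc a + 3 \<le> length (rev xs)"
      using R.no_long_branch_leaf_B[OF 2 refl] by blast
    hence a1: "a = 1" using bd p_def by simp
    have "a \<notin> D" using Dp a1 p by auto
    hence "D = {length xs - 3}" using DB \<open>p - 3 \<in> D\<close> b p_def by blast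
    thus ?thesis using in_family_two_long B a1 b p_def by simp
  next
    case 3
    have RD0: "R.D = {}" using RD 3 by simp
    show ?thesis
    proof (cases "a = 1")
      case True
      hence "b \<noteq> p - 2" using ns B p_def by auto
      thus ?thesis using in_family_two[OF B 3] True bd p_def by auto
    next
      case a: False
      show ?thesis
      proof (cases "b = p - 2")
        case True
        have "(p - Suc b = 1 \<and> 4 \<le> p - Suc a \<and> p - Suc a + 3 \<le> length (rev xs))"
          using True a bd p p_def by auto
        thus ?thesis using R.in_family_two[OF RB RD0] fam by blast
      next
        case False
        have "2 \<le> a" "b + 3 \<le> p" using a bd False by arith+
        hence "\<not> b + 7 \<le> a + p" using no_two_branches[OF mem ab] unfolding p_def by blast
        hence "a = 2 \<and> b + 3 = p \<or> a = 2 \<and> b + 4 = p \<or> a = 3 \<and> b + 3 = p" using a bd False by auto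
        thus ?thesis
        proof (elim disjE)
          \<comment> \<open>Outer arms 3 and 2; reversed they are 2 and 3, which is the form in the
            family.\<close>
          assume "a = 3 \<and> b + 3 = p"
          hence "p - Suc b = 2 \<and> p - Suc a + 4 = length (rev xs)" using p p_def by auto
          thus ?thesis using R.in_family_two[OF RB RD0] fam by blast
        qed (use in_family_two[OF B 3] p_def in auto)
      qed
    qed
  qed
qed

text \<open>The gaps of at least 3 keep a middle branch at distance at least 4 from both ends.
  Paired with it, an outer branch is tolerated only next to an end of the path, and each end has
  room for just one.\<close>

lemma in_family_if_many:
  assumes B: "B = set ms" and ms: "sorted_wrt (<) ms" "3 \<le> length ms"
  shows in_family
proof -
  define p where "p = length xs"
  obtain a b ms' where ms': "ms = a # b # ms'" using ms(2) by (cases ms; cases "tl ms") auto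
  then obtain c ms'' where ms'': "ms' = c # ms''" using ms(2) by (cases ms') auto
  have mem: "a \<in> B" "b \<in> B" "c \<in> B" unfolding B ms' ms'' by auto
  have ord: "a < b" "b < c" using ms(1) unfolding ms' ms'' by auto
  have bd: "1 \<le> a" "a + 3 \<le> b" "b + 3 \<le> c" "c + 2 \<le> p"
    using B_less[OF mem(1)] B_less[OF mem(3)] B_gap[OF mem(1,2)] B_gap[OF mem(2,3)] ord p_def by auto
  have c: "c = p - 2"
  proof (rule ccontr)
    assume "c \<noteq> p - 2"
    hence "2 \<le> b" "c + 3 \<le> p" "c + 7 \<le> b + p" using bd by arith+
    thus False using no_two_branches[OF mem(2,3) ord(2)] unfolding p_def by blast
  qed
  have a: "a = 1"
  proof (rule ccontr)
    assume "a \<noteq> 1"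
    hence "2 \<le> a" "b + 3 \<le> p" "b + 7 \<le> a + p" using bd by arith+
    thus False using no_two_branches[OF mem(1,2) ord(1)] unfolding p_def by blast
  qed
  have "ms'' = []"
  proof (rule ccontr)
    assume "ms'' \<noteq> []"
    then obtain d where d: "d \<in> set ms''" by (cases ms'') auto
    hence "d \<in> B" "c < d" using ms(1) unfolding B ms' ms'' by auto
    thus False using B_less(3)[of d] c p_def by simp
  qed
  hence B': "B = {1, b, length xs - 2}" unfolding B ms' ms'' a c p_def by auto
  have "D \<subseteq> B \<inter> {2, length xs - 3}" using D_B D_subset by blast
  hence "D = {}" unfolding B' using bd p_def by auto
  from in_family_three[OF B' this] show ?thesis using bd p_def by simp
qed

theorem in_family:
  assumes "2 * real k \<le> eigenvalue_sum k G"
  shows in_family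
proof -
  interpret R: long_spine G k r "rev xs" by (rule long_spine_rev)
  have fam: "R.in_family \<Longrightarrow> in_family" unfolding R.in_family_def in_family_def .
  have ns: "\<not> B \<subseteq> {1, length xs - 2}" using eigenvalue_sum_less_if_B_subset assms by fastforce
  define ms where "ms = sorted_list_of_set B"
  have ms: "set ms = B" "sorted_wrt (<) ms" unfolding ms_def using finite_B by auto
  consider "ms = []" | m where "ms = [m]" | a b where "ms = [a, b]" | "3 \<le> length ms"
    by (cases ms; cases "tl ms"; cases "tl (tl ms)") auto
  thus ?thesis
  proof cases
    case 1 thus ?thesis using ms ns by simp
  next
    case (2 m)
    hence B: "B = {m}" using ms by simp
    have m: "2 \<le> m" "m + 3 \<le> length xs"
      using B_less[of m] ns unfolding B by auto
    have "D \<subseteq> {m}" using D_B B by blast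
    then consider "D = {}" | "D = {m}" by blast
    thus ?thesis
    proof cases
      case 1 thus ?thesis using in_family_single[OF B] m by simp
    next
      case 2
      hence "m = 2 \<or> m + 3 = length xs" using D_position by blast
      thus ?thesis
      proof
        assume "m = 2" thus ?thesis using in_family_single_long B 2 by simp
      next
        assume "m + 3 = length xs"
        hence "length xs - Suc m = 2" by simp
        hence "R.B = {2}" "R.D = {2}" unfolding B_rev_eq D_rev_eq B 2 by auto
        from R.in_family_single_long[OF this] show ?thesis by (rule fam)
      qed
    qed
  next
    case (3 a b)
    hence "B = {a, b}" "a < b" using ms by auto
    thus ?thesis using in_family_if_pair ns by simp
  next
    case 4 thus ?thesis using in_family_if_many[OF ms(1)[symmetric] ms(2)] by simp
  qed
qed

end

section \<open>Long paths in trees of bounded degree\<close>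

text \<open>The Perron vector of a star with d leaves has the value \<open>sqrt d\<close> at the
  centre and 1 at the leaves.\<close>

lemma carries_star:
  assumes G: "pair_graph G" and N: "distinct ws" "set ws \<subseteq> {w. (v, w) \<in> parcs G}" "ws \<noteq> []"
  shows "carries G (insert v (set ws)) (sqrt (length ws))"
proof -
  interpret pair_graph G by fact
  define d where "d = length ws"
  have d: "d > 0" using N(3) unfolding d_def by simp
  have v: "v \<notin> set ws" "v \<in> pverts G" "set ws \<subseteq> pverts G"
  proof -
    show "v \<notin> set ws" "set ws \<subseteq> pverts G" using N(2) no_loops' wellformed' by blast+
    have "hd ws \<in> set ws" using N(3) by simp
    thus "v \<in> pverts G" using N(2) wellformed' by blast
  qed
  define g where "g = (!) (v # ws)"
  define c where "c i = (if i = 0 then sqrt d else 1)" for i :: nat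
  have sq: "(\<Sum>i<Suc d. (c i)\<^sup>2) = 2 * d"
    unfolding sum.lessThan_Suc_shift by (simp add: c_def)
  have "carries G (g ` {..<Suc d}) (sqrt d)"
  proof (rule carries_weights[OF G, where w = c and p = "\<lambda>_. 0"])
    show "inj_on g {..<Suc d}" unfolding g_def d_def using N(1) v(1) by (intro inj_on_nth) auto
    show "g i \<in> pverts G" if "i < Suc d" for i
      using nth_mem[of i "v # ws"] that v unfolding g_def d_def by auto
    show "(g i, g 0) \<in> parcs G" if "i < Suc d" "0 < i" for i
    proof -
      have "g i \<in> set ws" using that unfolding g_def d_def by (cases i) auto
      thus ?thesis using N(2) arcs_symmetric unfolding g_def by auto
    qed
    show "(\<Sum>i<Suc d. (c i)\<^sup>2) > 0" unfolding sq using d by simp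
    have "(\<Sum>i=1..<Suc d. c i * c 0) = (\<Sum>i=1..<Suc d. sqrt d)"
      by (intro sum.cong) (auto simp: c_def)
    thus "sqrt d * (\<Sum>i<Suc d. (c i)\<^sup>2) \<le> 2 * (\<Sum>i=1..<Suc d. c i * c 0)"
      unfolding sq by simp
  qed (auto simp: c_def)
  moreover have "g ` {..<Suc d} = insert v (set ws)"
  proof -
    have "g ` {..<length (v # ws)} = set (v # ws)" unfolding g_def by (auto simp: set_conv_nth)
    thus ?thesis unfolding d_def by simp
  qed
  ultimately show ?thesis unfolding d_def by simp
qed

text \<open>These fill the remaining \<open>k - 1\<close> places beside a star in the bound on the
  degrees.\<close>

lemma carries_singleton:
  assumes G: "pair_graph G" and x: "x \<in> pverts G"
  shows "carries G {x} 0"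
  unfolding carries_def
proof (intro exI conjI)
  interpret pair_graph G by fact
  let ?f = "\<lambda>v. if v = x then 1 else (0::real)"
  show "\<forall>v\<in>pverts G - {x}. ?f v = 0" by simp
  have "(\<Sum>v\<in>pverts G. (?f v)\<^sup>2) = (\<Sum>v\<in>pverts G. ?f v)" by (intro sum.cong) auto
  thus "0 < (\<Sum>v\<in>pverts G. (?f v)\<^sup>2)" using x by simp
  show "0 * (\<Sum>v\<in>pverts G. (?f v)\<^sup>2) \<le> adj_form G ?f"
    unfolding adj_form_def by (simp add: sum_nonneg case_prod_unfold)
qed

lemma degree_less:
  assumes G: "pair_graph G" and k: "1 \<le> k" and small: "eigenvalue_sum k G < s" and s: "s\<^sup>2 \<le> real d" "0 < s"
    and n: "d + k \<le> card (pverts G)"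
  shows "card {w. (v, w) \<in> parcs G} < d"
proof (rule ccontr)
  assume "\<not> ?thesis"
  hence "d \<le> card {w. (v, w) \<in> parcs G}" by simp
  then obtain W where W: "W \<subseteq> {w. (v, w) \<in> parcs G}" "card W = d" "finite W"
    by (rule obtain_subset_with_card_n)
  interpret pair_graph G by fact
  obtain ws where ws: "distinct ws" "set ws = W" using finite_distinct_list[OF W(3)] by blast
  have lws: "length ws = d" using ws W(2) distinct_card by metis
  have "d > 0" using s by (metis of_nat_0_less_iff order_less_le_trans zero_less_power)
  hence ne: "ws \<noteq> []" using lws by auto
  have star: "carries G (insert v W) (sqrt d)"
    using carries_star[OF G ws(1) _ ne] W ws lws by simp
  have "card (pverts G - insert v W) \<ge> k - 1"
  proof -
    have "card (insert v W) \<le> Suc d" using W by (simp add: card_insert_if)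
    moreover have "card (pverts G - insert v W) \<ge> card (pverts G) - card (insert v W)"
      using W by (intro diff_card_le_card_Diff) simp
    ultimately show ?thesis using n by linarith
  qed
  then obtain t where t: "inj_on t {..<k - 1}" "t ` {..<k - 1} \<subseteq> pverts G - insert v W"
    using card_le_inj[of "{..<k - 1}" "pverts G - insert v W"] by auto
  define U where "U i = (if i = 0 then insert v W else {t (i - 1)})" for i :: nat
  have tU: "t (i - 1) \<in> pverts G - insert v W" if "i < k" "i \<noteq> 0" for i
  proof -
    have "i - 1 \<in> {..<k - 1}" using that by auto
    thus ?thesis using t(2) by blast
  qed
  have "(\<Sum>i<k. if i = 0 then sqrt d else 0) \<le> eigenvalue_sum k G"
  proof (rule eigenvalue_sum_ge_if_carries[OF G, of k U])
    show "k \<le> card (pverts G)" using n by simp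
    show "carries G (U i) (if i = 0 then sqrt d else 0)" if "i < k" for i
      using star carries_singleton[OF G, of "t (i - 1)"] tU[OF that] unfolding U_def by auto
    show "U i \<inter> U j = {}" if "i < k" "j < k" "i \<noteq> j" for i j
    proof -
      have "t (i - 1) \<noteq> t (j - 1)" if "i \<noteq> 0" "j \<noteq> 0"
        using inj_onD[OF t(1), of "i - 1" "j - 1"] that \<open>i < k\<close> \<open>j < k\<close> \<open>i \<noteq> j\<close> by fastforce
      thus ?thesis using tU[OF that(1)] tU[OF that(2)] that(3) unfolding U_def by auto
    qed
  qed
  moreover have "(\<Sum>i<k. if i = 0 then sqrt d else 0) = sqrt d" using k by simp
  moreover have "s \<le> sqrt d" using s by (intro real_le_rsqrt)
  ultimately show False using small by simp
qed

lemma simple_path_snoc: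
  "simple_path G (ys @ [v]) \<longleftrightarrow>
     v \<notin> set ys \<and> v \<in> pverts G \<and> simple_path G ys \<and> (ys \<noteq> [] \<longrightarrow> (last ys, v) \<in> parcs G)"
  unfolding simple_path_def by (cases "ys = []") (auto simp: successively_append_iff)

text \<open>\<open>R i\<close> is the ball of radius \<open>i\<close> around \<open>x\<close>. A
  vertex together with its fewer than \<open>d\<close> neighbours makes at most \<open>d\<close>
  vertices, so each step multiplies the size by at most \<open>d\<close>; and every vertex is the
  end of a simple path from \<open>x\<close>, which has at most \<open>p\<close> vertices.\<close>

lemma card_le_longest_path:
  assumes G: "pair_graph G" "connected (with_proj G)" and x: "x \<in> pverts G"
    and deg: "\<And>v. v \<in> pverts G \<Longrightarrow> card {w. (v, w) \<in> parcs G} < d"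
    and longest: "\<And>ys. simple_path G ys \<Longrightarrow> length ys \<le> p"
  shows "card (pverts G) \<le> d ^ p"
proof -
  interpret pair_graph G by (rule G(1))
  define R where "R = rec_nat {x} (\<lambda>_ S. \<Union>v\<in>S. insert v {w. (v, w) \<in> parcs G})"
  have R0: "R 0 = {x}" and RS: "R (Suc i) = (\<Union>v\<in>R i. insert v {w. (v, w) \<in> parcs G})" for i
    unfolding R_def by simp_all
  have RV: "R i \<subseteq> pverts G" for i
    by (induct i) (use x wellformed' in \<open>auto simp: R0 RS\<close>)
  have fR: "finite (R i)" for i by (rule finite_subset[OF RV]) simp
  have fN: "finite {w. (v, w) \<in> parcs G}" for v
    by (rule finite_subset[of _ "pverts G"]) (use wellformed' in auto)
  have cR: "card (R i) \<le> d ^ i" for i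
  proof (induct i)
    case (Suc i)
    have "card (R (Suc i)) \<le> (\<Sum>v\<in>R i. card (insert v {w. (v, w) \<in> parcs G}))"
      unfolding RS by (rule card_UN_le[OF fR])
    also have "\<dots> \<le> (\<Sum>v\<in>R i. d)"
    proof (rule sum_mono)
      fix v assume "v \<in> R i"
      hence "card {w. (v, w) \<in> parcs G} < d" using RV deg by blast
      thus "card (insert v {w. (v, w) \<in> parcs G}) \<le> d" using fN by (simp add: card_insert_if)
    qed
    also have "\<dots> \<le> d ^ Suc i" using Suc by simp
    finally show ?case .
  qed (simp add: R0)
  have Rmono: "R i \<subseteq> R j" if "i \<le> j" for i j
    by (rule lift_Suc_mono_le[OF _ that]) (auto simp: RS)
  have path_R: "last ys \<in> R (length ys)" if "simple_path G ys" "ys \<noteq> []" "hd ys = x" for ys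
    using that
  proof (induct ys rule: rev_induct)
    case (snoc v ys)
    show ?case
    proof (cases "ys = []")
      case True thus ?thesis using snoc Rmono[of 0 1] R0 by auto
    next
      case False
      hence "last ys \<in> R (length ys)" "(last ys, v) \<in> parcs G"
        using snoc by (auto simp: simple_path_snoc hd_append)
      thus ?thesis by (auto simp: RS)
    qed
  qed simp
  have "pverts G \<subseteq> {v. \<exists>ys. simple_path G ys \<and> ys \<noteq> [] \<and> hd ys = x \<and> last ys = v}"
  proof (rule connected_closure[OF G, of x])
    have "simple_path G [x]" using x unfolding simple_path_def by simp
    thus "x \<in> {v. \<exists>ys. simple_path G ys \<and> ys \<noteq> [] \<and> hd ys = x \<and> last ys = v}" by force
  next
    fix u v assume "u \<in> {v. \<exists>ys. simple_path G ys \<and> ys \<noteq> [] \<and> hd ys = x \<and> last ys = v}"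
      and uv: "(u, v) \<in> parcs G"
    then obtain ys where ys: "simple_path G ys" "ys \<noteq> []" "hd ys = x" "last ys = u" by auto
    show "v \<in> {v. \<exists>ys. simple_path G ys \<and> ys \<noteq> [] \<and> hd ys = x \<and> last ys = v}"
    proof (cases "v \<in> set ys")
      case True
      \<comment> \<open>If \<open>v\<close> already lies on the path, the path is cut off at
        \<open>v\<close>.\<close>
      then obtain as bs where as: "ys = (as @ [v]) @ bs" by (metis append.assoc append_Cons append_Nil split_list)
      have "simple_path G (as @ [v])"
        using ys(1) unfolding as simple_path_def successively_append_iff[of _ "as @ [v]" bs] by auto
      moreover have "hd (as @ [v]) = x" using ys(3) unfolding as by (cases as) auto
      ultimately show ?thesis by (intro CollectI exI[of _ "as @ [v]"]) auto
    next
      case False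
      hence "simple_path G (ys @ [v])" using ys uv wellformed' by (auto simp: simple_path_snoc)
      thus ?thesis using ys by (intro CollectI exI[of _ "ys @ [v]"]) auto
    qed
  qed (rule x)
  also have "\<dots> \<subseteq> R p" using path_R longest Rmono by blast
  finally have "card (pverts G) \<le> card (R p)" using fR by (intro card_mono)
  thus ?thesis using cR[of p] by simp
qed

text \<open>With \<epsilon> = 0.00006 and cos \<theta> = 1 - \<epsilon>/(k - 1), a block loses at
  most 2\<epsilon>/(k - 1) against 2, so \<open>k - 1\<close> blocks lose at most 2\<epsilon> =
  0.00012.\<close>

lemma r_eps_bounds:
  assumes k: "2 \<le> k"
  shows "100 \<le> r_eps k 0.00006"
    and "2 * real (k - 1) - 12 / 100000 \<le> real (k - 1) * (2 * cos (pi / (real (nat (r_eps k 0.00006)) + 1)))"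
proof -
  define e where "e = 0.00006 / (real k - 1)"
  define \<theta> where "\<theta> = arccos (1 - e)"
  define R where "R = r_eps k 0.00006"
  have Rdef: "R = \<lceil>pi / \<theta>\<rceil> - 1" unfolding R_def r_eps_def \<theta>_def e_def ..
  have k1: "real k - 1 \<ge> 1" using k by simp
  have e: "0 < e" "e \<le> 0.00006" unfolding e_def using k1 by (auto simp: divide_simps)
  have cos: "cos \<theta> = 1 - e" unfolding \<theta>_def using e by (intro cos_arccos) auto
  have th: "0 < \<theta>" "\<theta> \<le> pi"
  proof -
    have "0 \<le> \<theta>" "\<theta> \<le> pi" unfolding \<theta>_def using e by (auto intro: arccos_lbound arccos_ubound)
    moreover have "\<theta> \<noteq> 0" using cos e by auto
    ultimately show "0 < \<theta>" "\<theta> \<le> pi" by auto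
  qed
  have small: "\<theta> < pi / 100"
  proof (rule ccontr)
    assume "\<not> \<theta> < pi / 100"
    hence "cos \<theta> \<le> cos (pi / 100)" using th by (intro cos_monotone_0_pi_le) auto
    \<comment> \<open>The half angle: 1 - cos (pi/100) = 2 (sin y)^2 is at least 2 * 0.009^2 =
      0.000162, more than \<open>e\<close>. The crude bounds 2 and 4 for pi are enough.\<close>
    define y where "y = pi / 200"
    have y: "1 / 100 \<le> y" "y < 2 / 100" unfolding y_def using pi_ge_two pi_less_4 by auto
    have "y ^ 3 \<le> (2 / 100) ^ 3" using y by (intro power_mono) auto
    hence y3: "y ^ 3 \<le> 8 / 1000000" by (simp add: power3_eq_cube)
    have "\<bar>sin y - (\<Sum>m<3. sin_coeff m * y ^ m)\<bar> \<le> inverse (fact 3) * \<bar>y\<bar> ^ 3"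
      by (rule Maclaurin_sin_bound)
    moreover have "(\<Sum>m<3. sin_coeff m * y ^ m) = y"
      by (simp add: numeral_3_eq_3 sin_coeff_def)
    moreover have "\<bar>y\<bar> = y" using y by simp
    ultimately have m: "\<bar>sin y - y\<bar> * 6 \<le> y ^ 3" by (simp add: fact_numeral)
    have "(y - sin y) * 6 \<le> \<bar>sin y - y\<bar> * 6" by (intro mult_right_mono) auto
    also note m
    also note y3
    finally have "sin y \<ge> 9 / 1000" using y(1) by (simp add: field_simps)
    hence "(sin y)\<^sup>2 \<ge> (9 / 1000)\<^sup>2" by (intro power_mono) auto
    moreover have "cos (pi / 100) = 1 - 2 * (sin y)\<^sup>2"
      using cos_double_sin[of y] unfolding y_def by simp
    ultimately show False using \<open>cos \<theta> \<le> cos (pi / 100)\<close> cos e by (simp add: power2_eq_square)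
  qed
  have "100 < pi / \<theta>" using small th by (simp add: field_simps)
  hence "100 < \<lceil>pi / \<theta>\<rceil>" by (simp add: less_ceiling_iff)
  thus R100: "100 \<le> r_eps k 0.00006" using Rdef R_def by simp
  \<comment> \<open>The \<open>- 1\<close> in \<open>r_eps\<close> matches the angle pi/(r + 1) of a
    path with r vertices: r + 1 is the ceiling itself.\<close>
  have "pi / \<theta> \<le> real (nat R) + 1" using R100 unfolding R_def[symmetric] Rdef by (simp add: le_of_int_ceiling)
  hence "pi / (real (nat R) + 1) \<le> \<theta>" using th by (simp add: field_simps)
  hence "cos \<theta> \<le> cos (pi / (real (nat R) + 1))" using th by (intro cos_monotone_0_pi_le) auto
  hence "1 - e \<le> cos (pi / (real (nat R) + 1))" using cos by simp
  hence A: "real (k - 1) * (2 * (1 - e)) \<le> real (k - 1) * (2 * cos (pi / (real (nat R) + 1)))"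
    by (intro mult_left_mono) auto
  have B: "2 * real (k - 1) - 12 / 100000 = real (k - 1) * (2 * (1 - e))"
    unfolding e_def using k k1 by (simp add: of_nat_diff field_simps)
  show "2 * real (k - 1) - 12 / 100000 \<le> real (k - 1) * (2 * cos (pi / (real (nat (r_eps k 0.00006)) + 1)))"
    unfolding R_def[symmetric] by (rule ord_eq_le_trans[OF B A])
qed

theorem theorem4p3:
  fixes k n :: nat and T :: "'a pair_pre_digraph"
  assumes "k \<ge> 2"
    and "tree_graph T"
    and "card (pverts T) = n"
    and "real n \<ge> (2 * real k + 1) powi (30 + 33 * (int k - 1) * r_eps k 0.00006)"
    and "eigenvalue_sum k T \<in> {2 * real k ..< 2 * real k + eta - 2}"
  shows "\<exists>H \<in> tree_family n. digraph_iso (with_proj T) (with_proj H)"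
proof -
  define r where "r = nat (r_eps k 0.00006)"
  have r: "100 \<le> r" and ri: "int r = r_eps k 0.00006" using r_eps_bounds(1)[OF assms(1)] unfolding r_def by auto
  have T: "pair_graph T" "connected (with_proj T)" using assms(2) unfolding tree_graph_def by auto
  interpret pair_graph T by (rule T(1))
  define N where "N = 30 + 33 * (k - 1) * r"
  have "30 + 33 * (int k - 1) * r_eps k 0.00006 = int N"
    unfolding N_def ri[symmetric] using assms(1) by (simp add: of_nat_diff)
  hence "(2 * real k + 1) ^ N \<le> real n" using assms(4) by simp
  hence nN: "(2 * k + 1) ^ N \<le> n"
  proof -
    have "real ((2 * k + 1) ^ N) = (2 * real k + 1) ^ N" by (simp add: add.commute)
    thus ?thesis using \<open>(2 * real k + 1) ^ N \<le> real n\<close> by (metis of_nat_le_iff)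
  qed
  define d where "d = (2 * k + 1)\<^sup>2"
  have b: "1 < 2 * k + 1" using assms(1) by simp
  have "d + k \<le> n"
  proof -
    have "k \<le> d" unfolding d_def power2_eq_square by simp
    hence "d + k \<le> (2 * k + 1) * d" using assms(1) by simp
    also have "\<dots> = (2 * k + 1) ^ 3" unfolding d_def by (simp add: power2_eq_square power3_eq_cube)
    also have "\<dots> \<le> (2 * k + 1) ^ N" by (rule power_increasing) (auto simp: N_def)
    finally show ?thesis using nN by simp
  qed
  \<comment> \<open>Since \<eta> < 3, the eigenvalue sum is below 2k + 1, the square root of
    \<open>d\<close>.\<close>
  have deg: "card {w. (v, w) \<in> parcs T} < d" for v
  proof (rule degree_less[OF T(1), of k "2 * real k + 1"])
    show "eigenvalue_sum k T < 2 * real k + 1" using assms(5) eta_less by simp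
  qed (use assms(1,3) \<open>d + k \<le> n\<close> in \<open>auto simp: d_def\<close>)
  have bound: "length ys \<le> card (pverts T)" if "simple_path T ys" for ys
  proof -
    have "length ys = card (set ys)" using that unfolding simple_path_def by (metis distinct_card)
    also have "\<dots> \<le> card (pverts T)" using that unfolding simple_path_def by (intro card_mono) auto
    finally show ?thesis .
  qed
  have "simple_path T []" unfolding simple_path_def by simp
  moreover have "\<forall>ys. simple_path T ys \<longrightarrow> length ys < Suc (card (pverts T))" using bound less_Suc_eq_le by blast
  ultimately have "\<exists>xs. simple_path T xs \<and> (\<forall>ys. simple_path T ys \<longrightarrow> length ys \<le> length xs)"
    by (rule Lattices_Big.ex_has_greatest_nat)
  then obtain xs where xs: "simple_path T xs" "\<And>ys. simple_path T ys \<Longrightarrow> length ys \<le> length xs" by blast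
  have "pverts T \<noteq> {}" using \<open>d + k \<le> n\<close> assms(1,3) by auto
  then obtain x where "x \<in> pverts T" by blast
  from card_le_longest_path[OF T this deg xs(2)] have "n \<le> d ^ length xs" using assms(3) by simp
  also have "d ^ length xs = (2 * k + 1) ^ (2 * length xs)" unfolding d_def by (rule power_mult[symmetric])
  finally have "(2 * k + 1) ^ N \<le> (2 * k + 1) ^ (2 * length xs)" using nN by (rule le_trans[rotated])
  hence "N \<le> 2 * length xs" by (rule power_le_imp_le_exp[OF b])
  \<comment> \<open>With \<open>p = length xs\<close>, comparing exponents in (2k + 1)^N \<le> n
    \<le> (2k + 1)^(2p) gives N \<le> 2p, and 2(k + 2) \<le> 33(k - 1) holds for every k \<ge>
    2.\<close>
  moreover have "2 * ((k + 2) * r) \<le> N"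
  proof -
    have "(2 * (k + 2)) * r \<le> (33 * (k - 1)) * r" using assms(1) by (intro mult_le_mono1) simp
    thus ?thesis unfolding N_def by simp
  qed
  ultimately have long: "(k + 2) * r \<le> length xs" by simp
  have "long_spine T k r xs"
    by (rule long_spine.intro[OF assms(2,1) _ r r_eps_bounds(2)[OF assms(1), folded r_def] xs long])
      (use assms(5) in simp)
  from long_spine.in_family[OF this] show ?thesis
    using assms(3,5) unfolding long_spine.in_family_def[OF \<open>long_spine T k r xs\<close>] by simp
qed

end
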